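(* Suppose $\mathcal{M}$ is a compact Riemann surface and $\{p_1,\ldots,p_n\}\subset\mathcal{M}$ is a finite set of distinct points. Suppose $g_0$ is a complete, bounded-curvature, smooth, conformal metric on $\mathcal{N}:=\mathcal{M}\setminus\{p_1,\ldots,p_n\}$ with strictly negative curvature in a neighbourhood of each point $p_i$. Let $g(t)$, $t\in(0,T]$ (for some $T>0$), be the cusp-contracting Ricci flow on $\mathcal{M}$ with initial condition $(\mathcal{N},g_0)$ constructed as described in the context. If $\tilde g(t)$ is a smooth Ricci flow on $\mathcal{M}$ for some time interval $t\in(0,\delta)$, with $\delta\in(0,T]$, such that $\tilde g(t)\to g_0$ smoothly locally on $\mathcal{N}$ as $t\downarrow0$ and the Gauss curvature of $\tilde g(t)$ is uniformly bounded below, then $\tilde g(t)$ agrees with $g(t)$ for $t\in(0,\delta)$.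
   Context: A Ricci flow on a surface is a smooth family of Riemannian metrics $g(t)$ with $\frac{\partial}{\partial t}g(t)=-2Kg(t)$, where $K$ is the Gauss curvature of $g(t)$. A metric on a Riemann surface is conformal if in each local complex coordinate $z=x+iy$ it has the form $e^{2u}|dz|^2=e^{2u}(dx^2+dy^2)$; $u$ is its conformal factor. Smooth local convergence on $\mathcal{N}$ means smooth convergence on compact subsets of $\mathcal{N}$, metrics on $\mathcal{M}$ being restricted to $\mathcal{N}$ via the natural inclusion. Properties of the constructed flow $g(t)$: it is a smooth Ricci flow on all of $\mathcal{M}$ for $t\in(0,T]$; $g(t)\to g_0$ smoothly locally on $\mathcal{N}$ as $t\downarrow0$; for some $C<\infty$ and all sufficiently small $t\in(0,T]$ one has $\frac1C(-\ln t)\le \operatorname{diam}(\mathcal{M},g(t))\le C(-\ln t)$; and its curvature is bounded below uniformly as $t\downarrow 0$. Construction of $g(t)$: near each $p_i$ take a local complex coordinate $z$, with $p_i$ at $z=0$, defined on a domain containing the closed unit disc, such that the supremum of the curvature of $g_0$ on the punctured unit disc $D\setminus\{0\}$ is strictly negative; by scaling the metric, assume without loss of generality that this curvature is less than $-1$. Write $g_0=e^{2a}|dz|^2$ there; then $a\to\infty$ at $z=0$. Fix a smooth $\psi:\mathbb{R}\to\mathbb{R}$ with $\psi(s)=s$ for $s\le-1$, $\psi(s)=0$ for $s\ge1$ and $\psi''\le0$. Replacing $a$ by $\psi(a-k)+k$ near each puncture and passing to a subsequence gives an increasing sequence of smooth conformal metrics $g_k$ on $\mathcal{M}$ such that: $g_k=g_0$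 outside the discs $D_{1/k}=\{|z|<1/k\}$ about the punctures; $g_k\le g_0$ on $\mathcal{N}$; the infimum over $D_{1/k}$ of the conformal factor of $g_k$ tends to $\infty$ as $k\to\infty$; and the Gauss curvatures of the $g_k$ are bounded below independently of $k$. Let $g_k(t)$ be the Ricci flow on $\mathcal{M}$ with $g_k(0)=g_k$, and let $T>0$ be such that all these flows exist for $t\in[0,T]$. The metrics $g_k(t)$ increase with $k$, and $g(t):=\lim_{k\to\infty}g_k(t)$ on $\mathcal{M}$ for $t\in(0,T]$. *)

theory Defs
  imports "HOL-Analysis.Analysis"
begin

section \<open>Smooth functions on sets that need not be open\<close>

text \<open>
  The sets used below are of the form \<open>V \<times> I\<close> with \<open>V\<close> open and \<open>I\<close> a nondegenerate interval,
  or relatively open subsets of such an interval, so that derivatives within the set are unique.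
  At a closed end point of \<open>I\<close> the derivatives are one-sided.
\<close>

primrec Ck_on :: "nat \<Rightarrow> 'a::real_normed_vector set \<Rightarrow> ('a \<Rightarrow> 'b::real_normed_vector) \<Rightarrow> bool" where
  "Ck_on 0 S f = continuous_on S f"
| "Ck_on (Suc k) S f =
     (\<exists>f'. (\<forall>x\<in>S. (f has_derivative f' x) (at x within S)) \<and> (\<forall>v. Ck_on k S (\<lambda>x. f' x v)))"

definition smooth_on :: "'a::real_normed_vector set \<Rightarrow> ('a \<Rightarrow> 'b::real_normed_vector) \<Rightarrow> bool" where
  "smooth_on S f \<longleftrightarrow> (\<forall>k. Ck_on k S f)"


section \<open>Riemann surfaces\<close>

text \<open>A local complex coordinate: its domain, and a map whose values off the domain are irrelevant.\<close>

type_synonym 'a coord = "'a set \<times> ('a \<Rightarrow> complex)"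

definition is_chart :: "'a topology \<Rightarrow> 'a coord \<Rightarrow> bool" where
  "is_chart X c \<longleftrightarrow> openin X (fst c) \<and> open (snd c ` fst c) \<and>
     homeomorphic_map (subtopology X (fst c)) (top_of_set (snd c ` fst c)) (snd c)"

definition transition :: "'a coord \<Rightarrow> 'a coord \<Rightarrow> complex \<Rightarrow> complex" where
  "transition c d = snd d \<circ> inv_into (fst c) (snd c)"

definition compatible :: "'a coord \<Rightarrow> 'a coord \<Rightarrow> bool" where
  "compatible c d \<longleftrightarrow>
     transition c d holomorphic_on snd c ` (fst c \<inter> fst d) \<and>
     transition d c holomorphic_on snd d ` (fst c \<inter> fst d)"

text \<open>
  The complex structure \<open>A\<close> is a maximal atlas, i.e. the set of all local complex coordinates.
  Second countability is automatic (Rado), and trivial in the compact case.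
\<close>

definition riemann_surface :: "'a topology \<Rightarrow> 'a coord set \<Rightarrow> bool" where
  "riemann_surface X A \<longleftrightarrow>
     connected_space X \<and> Hausdorff_space X \<and>
     (\<forall>c\<in>A. is_chart X c) \<and> (\<Union>c\<in>A. fst c) = topspace X \<and>
     (\<forall>c\<in>A. \<forall>d\<in>A. compatible c d) \<and>
     (\<forall>c. is_chart X c \<and> (\<forall>d\<in>A. compatible c d) \<longrightarrow> c \<in> A)"


section \<open>Riemannian metrics and Gauss curvature\<close>

text \<open>
  A metric tensor is given by its coordinate expressions: \<open>g c p v w\<close> is the inner product at \<open>p\<close>
  of the two tangent vectors that are represented by \<open>v\<close> and \<open>w\<close> in the coordinate \<open>c\<close> (a real
  tangent vector being identified with a complex number). Under a holomorphic change of coordinate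
  these are multiplied by the complex derivative of the transition map.
\<close>

type_synonym 'a metric_tensor = "'a coord \<Rightarrow> 'a \<Rightarrow> complex \<Rightarrow> complex \<Rightarrow> real"

definition coeff :: "'a metric_tensor \<Rightarrow> 'a coord \<Rightarrow> complex \<Rightarrow> complex \<Rightarrow> complex \<Rightarrow> real" where
  "coeff g c v w z = g c (inv_into (fst c) (snd c) z) v w"

definition riemannian_metric :: "'a coord set \<Rightarrow> 'a set \<Rightarrow> 'a metric_tensor \<Rightarrow> bool" where
  "riemannian_metric A N g \<longleftrightarrow>
     (\<forall>c\<in>A. \<forall>p\<in>fst c \<inter> N. bilinear (g c p) \<and> (\<forall>v w. g c p v w = g c p w v) \<and>
                            (\<forall>v. v \<noteq> 0 \<longrightarrow> g c p v v > 0)) \<and>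
     (\<forall>c\<in>A. \<forall>d\<in>A. \<forall>p\<in>fst c \<inter> fst d \<inter> N. \<forall>v w.
        g c p v w = g d p (deriv (transition c d) (snd c p) * v)
                          (deriv (transition c d) (snd c p) * w)) \<and>
     (\<forall>c\<in>A. \<forall>v w. smooth_on (snd c ` (fst c \<inter> N)) (coeff g c v w))"

definition metric_eq :: "'a coord set \<Rightarrow> 'a set \<Rightarrow> 'a metric_tensor \<Rightarrow> 'a metric_tensor \<Rightarrow> bool" where
  "metric_eq A N g h \<longleftrightarrow> (\<forall>c\<in>A. \<forall>p\<in>fst c \<inter> N. \<forall>v w. g c p v w = h c p v w)"

definition metric_le :: "'a coord set \<Rightarrow> 'a set \<Rightarrow> 'a metric_tensor \<Rightarrow> 'a metric_tensor \<Rightarrow> bool" where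
  "metric_le A N g h \<longleftrightarrow> (\<forall>c\<in>A. \<forall>p\<in>fst c \<inter> N. \<forall>v. g c p v v \<le> h c p v v)"

definition scale_metric :: "real \<Rightarrow> 'a metric_tensor \<Rightarrow> 'a metric_tensor" where
  "scale_metric r g = (\<lambda>c p v w. r * g c p v w)"

definition conformal :: "'a coord set \<Rightarrow> 'a set \<Rightarrow> 'a metric_tensor \<Rightarrow> bool" where
  "conformal A N g \<longleftrightarrow>
     (\<forall>c\<in>A. \<forall>p\<in>fst c \<inter> N. \<exists>u. \<forall>v w. g c p v w = exp (2 * u) * (v \<bullet> w))"

text \<open>For a conformal metric \<open>g = exp (2 * u) |dz|^2\<close> this is \<open>u\<close>, as a function of \<open>z\<close>.\<close>

definition conf_factor :: "'a metric_tensor \<Rightarrow> 'a coord \<Rightarrow> complex \<Rightarrow> real" where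
  "conf_factor g c z = ln (coeff g c 1 1 z) / 2"

definition dir :: "2 \<Rightarrow> complex" where
  "dir i = (if i = 1 then 1 else \<i>)"

definition pd :: "2 \<Rightarrow> (complex \<Rightarrow> real) \<Rightarrow> complex \<Rightarrow> real" where
  "pd i f z = deriv (\<lambda>s::real. f (z + of_real s * dir i)) 0"

definition gram :: "'a metric_tensor \<Rightarrow> 'a coord \<Rightarrow> complex \<Rightarrow> real^2^2" where
  "gram g c z = (\<chi> i j. coeff g c (dir i) (dir j) z)"

text \<open>The Christoffel symbol with upper index \<open>k\<close> and lower indices \<open>i\<close>, \<open>j\<close>.\<close>

definition christoffel :: "'a metric_tensor \<Rightarrow> 'a coord \<Rightarrow> 2 \<Rightarrow> 2 \<Rightarrow> 2 \<Rightarrow> complex \<Rightarrow> real" where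
  "christoffel g c k i j z =
     (\<Sum>l\<in>UNIV. matrix_inv (gram g c z) $ k $ l *
        (pd i (\<lambda>z. gram g c z $ j $ l) z + pd j (\<lambda>z. gram g c z $ i $ l) z
         - pd l (\<lambda>z. gram g c z $ i $ j) z)) / 2"

text \<open>The \<open>l\<close>-component of \<open>R(\<partial>\<^sub>i, \<partial>\<^sub>j)\<partial>\<^sub>k\<close>, where \<open>R(X, Y) = \<nabla>\<^sub>X\<nabla>\<^sub>Y - \<nabla>\<^sub>Y\<nabla>\<^sub>X - \<nabla>\<^bsub>[X, Y]\<^esub>\<close>.\<close>

definition riemann_tensor :: "'a metric_tensor \<Rightarrow> 'a coord \<Rightarrow> 2 \<Rightarrow> 2 \<Rightarrow> 2 \<Rightarrow> 2 \<Rightarrow> complex \<Rightarrow> real" where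
  "riemann_tensor g c l i j k z =
     pd i (christoffel g c l j k) z - pd j (christoffel g c l i k) z +
     (\<Sum>m\<in>UNIV. christoffel g c m j k z * christoffel g c l i m z
              - christoffel g c m i k z * christoffel g c l j m z)"

text \<open>
  The sectional curvature \<open>g(R(\<partial>\<^sub>1, \<partial>\<^sub>2)\<partial>\<^sub>2, \<partial>\<^sub>1) / det g\<close> of the tangent plane at \<open>p\<close>, computed in the
  coordinate \<open>c\<close>. Its value does not depend on \<open>c\<close>; statements about it are made in all coordinates.
\<close>

definition gauss_curvature :: "'a metric_tensor \<Rightarrow> 'a coord \<Rightarrow> 'a \<Rightarrow> real" where
  "gauss_curvature g c p =
     (let z = snd c p in
       (\<Sum>l\<in>UNIV. gram g c z $ l $ 1 * riemann_tensor g c l 1 2 2 z) / det (gram g c z))"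

definition curvature_bounded_below :: "'a coord set \<Rightarrow> 'a set \<Rightarrow> real \<Rightarrow> 'a metric_tensor \<Rightarrow> bool" where
  "curvature_bounded_below A N b g \<longleftrightarrow> (\<forall>c\<in>A. \<forall>p\<in>fst c \<inter> N. b \<le> gauss_curvature g c p)"

definition bounded_curvature :: "'a coord set \<Rightarrow> 'a set \<Rightarrow> 'a metric_tensor \<Rightarrow> bool" where
  "bounded_curvature A N g \<longleftrightarrow> (\<exists>b. \<forall>c\<in>A. \<forall>p\<in>fst c \<inter> N. \<bar>gauss_curvature g c p\<bar> \<le> b)"


section \<open>Riemannian distance and completeness\<close>

definition piecewise_C1_path :: "'a topology \<Rightarrow> 'a coord set \<Rightarrow> 'a set \<Rightarrow> (real \<Rightarrow> 'a) \<Rightarrow> bool" where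
  "piecewise_C1_path X A N \<gamma> \<longleftrightarrow>
     pathin (subtopology X N) \<gamma> \<and>
     (\<exists>S. finite S \<and>
        (\<forall>a b. a < b \<and> {a..b} \<subseteq> {0..1} \<and> {a<..<b} \<inter> S = {} \<longrightarrow>
           (\<forall>c\<in>A. Ck_on 1 {s\<in>{a..b}. \<gamma> s \<in> fst c} (snd c \<circ> \<gamma>))))"

text \<open>The length of the velocity vector does not depend on the coordinate chosen.\<close>

definition speed :: "'a coord set \<Rightarrow> 'a metric_tensor \<Rightarrow> (real \<Rightarrow> 'a) \<Rightarrow> real \<Rightarrow> real" where
  "speed A g \<gamma> t =
     (let c = (SOME c. c \<in> A \<and> \<gamma> t \<in> fst c);
          w = vector_derivative (snd c \<circ> \<gamma>) (at t)
      in sqrt (g c (\<gamma> t) w w))"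

definition riem_dist :: "'a topology \<Rightarrow> 'a coord set \<Rightarrow> 'a set \<Rightarrow> 'a metric_tensor \<Rightarrow> 'a \<Rightarrow> 'a \<Rightarrow> real" where
  "riem_dist X A N g p q =
     Inf {integral {0..1} (speed A g \<gamma>) | \<gamma>. piecewise_C1_path X A N \<gamma> \<and> \<gamma> 0 = p \<and> \<gamma> 1 = q}"

definition complete_metric :: "'a topology \<Rightarrow> 'a coord set \<Rightarrow> 'a set \<Rightarrow> 'a metric_tensor \<Rightarrow> bool" where
  "complete_metric X A N g \<longleftrightarrow> Metric_space.mcomplete N (riem_dist X A N g)"


section \<open>Ricci flows\<close>

definition ricci_flow :: "'a topology \<Rightarrow> 'a coord set \<Rightarrow> real set \<Rightarrow> (real \<Rightarrow> 'a metric_tensor) \<Rightarrow> bool" where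
  "ricci_flow X A I g \<longleftrightarrow>
     (\<forall>t\<in>I. riemannian_metric A (topspace X) (g t)) \<and>
     (\<forall>c\<in>A. \<forall>v w. smooth_on ((snd c ` fst c) \<times> I) (\<lambda>(z, t). coeff (g t) c v w z)) \<and>
     (\<forall>t\<in>I. \<forall>c\<in>A. \<forall>p\<in>fst c. \<forall>v w.
        ((\<lambda>s. g s c p v w) has_real_derivative
           - 2 * gauss_curvature (g t) c p * g t c p v w) (at t within I))"

text \<open>
  Uniform convergence on compact sets, as \<open>t\<close> decreases to \<open>0\<close>, of the coefficients and of all their
  iterated partial derivatives.
\<close>

definition converges_smoothly_locally ::
    "'a coord set \<Rightarrow> 'a set \<Rightarrow> (real \<Rightarrow> 'a metric_tensor) \<Rightarrow> 'a metric_tensor \<Rightarrow> bool" where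
  "converges_smoothly_locally A N g g0 \<longleftrightarrow>
     (\<forall>c\<in>A. \<forall>K. compact K \<and> K \<subseteq> snd c ` (fst c \<inter> N) \<longrightarrow>
        (\<forall>v w. \<forall>is. uniform_limit K (\<lambda>t. foldr pd is (coeff (g t) c v w))
                      (foldr pd is (coeff g0 c v w)) (at_right 0)))"


section \<open>The cusp-contracting Ricci flow\<close>

definition coord_disc :: "'a coord \<Rightarrow> real \<Rightarrow> 'a set" where
  "coord_disc c r = {x \<in> fst c. snd c x \<in> ball 0 r}"

definition cusp_coordinates ::
    "'a coord set \<Rightarrow> 'a set \<Rightarrow> 'a metric_tensor \<Rightarrow> ('a \<Rightarrow> 'a coord) \<Rightarrow> bool" where
  "cusp_coordinates A P g0 \<zeta> \<longleftrightarrow>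
     (\<forall>p\<in>P. \<zeta> p \<in> A \<and> p \<in> fst (\<zeta> p) \<and> snd (\<zeta> p) p = 0 \<and>
            connected (snd (\<zeta> p) ` fst (\<zeta> p)) \<and> cball 0 1 \<subseteq> snd (\<zeta> p) ` fst (\<zeta> p) \<and>
            (\<forall>q\<in>coord_disc (\<zeta> p) 1 - {p}. gauss_curvature g0 (\<zeta> p) q < -1)) \<and>
     (\<forall>p\<in>P. \<forall>q\<in>P. p \<noteq> q \<longrightarrow> coord_disc (\<zeta> p) 1 \<inter> coord_disc (\<zeta> q) 1 = {})"

definition cutoff :: "(real \<Rightarrow> real) \<Rightarrow> bool" where
  "cutoff \<psi> \<longleftrightarrow> smooth_on UNIV \<psi> \<and> (\<forall>s\<le>-1. \<psi> s = s) \<and> (\<forall>s\<ge>1. \<psi> s = 0) \<and>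
     (\<forall>s. deriv (deriv \<psi>) s \<le> 0)"

text \<open>
  The truncated metrics \<open>h k\<close>, \<open>k \<ge> 1\<close>; \<open>\<kappa>\<close> is the subsequence, so that \<open>h k\<close> is obtained by
  truncating at level \<open>\<kappa> k\<close>.
\<close>

definition cusp_truncation ::
    "'a topology \<Rightarrow> 'a coord set \<Rightarrow> 'a set \<Rightarrow> 'a metric_tensor \<Rightarrow> ('a \<Rightarrow> 'a coord) \<Rightarrow>
     (real \<Rightarrow> real) \<Rightarrow> (nat \<Rightarrow> nat) \<Rightarrow> (nat \<Rightarrow> 'a metric_tensor) \<Rightarrow> bool" where
  "cusp_truncation X A P g0 \<zeta> \<psi> \<kappa> h \<longleftrightarrow>
     strict_mono \<kappa> \<and>
     (\<forall>k\<ge>1. riemannian_metric A (topspace X) (h k) \<and> conformal A (topspace X) (h k)) \<and>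
     (\<forall>k\<ge>1. \<forall>p\<in>P. \<forall>z\<in>ball 0 1 - {0}.
        conf_factor (h k) (\<zeta> p) z = \<psi> (conf_factor g0 (\<zeta> p) z - real (\<kappa> k)) + real (\<kappa> k)) \<and>
     (\<forall>k\<ge>1. metric_eq A (topspace X - (\<Union>p\<in>P. coord_disc (\<zeta> p) (1 / real k))) (h k) g0) \<and>
     (\<forall>k\<ge>1. metric_le A (topspace X) (h k) (h (Suc k))) \<and>
     (\<forall>k\<ge>1. metric_le A (topspace X - P) (h k) g0) \<and>
     (\<forall>p\<in>P. filterlim (\<lambda>k. INF z\<in>ball 0 (1 / real k). conf_factor (h k) (\<zeta> p) z)
              at_top sequentially) \<and>
     (\<exists>b. \<forall>k\<ge>1. curvature_bounded_below A (topspace X) b (h k))"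

text \<open>The construction for a metric whose curvature near the punctures is less than \<open>-1\<close>.\<close>

definition normalised_construction ::
    "'a topology \<Rightarrow> 'a coord set \<Rightarrow> 'a set \<Rightarrow> 'a metric_tensor \<Rightarrow> real \<Rightarrow>
     (real \<Rightarrow> 'a metric_tensor) \<Rightarrow> bool" where
  "normalised_construction X A P g0 T g \<longleftrightarrow>
     (\<exists>\<zeta> \<psi> \<kappa> h G.
        cusp_coordinates A P g0 \<zeta> \<and> cutoff \<psi> \<and> cusp_truncation X A P g0 \<zeta> \<psi> \<kappa> h \<and>
        (\<forall>k\<ge>1. ricci_flow X A {0..T} (G k) \<and> metric_eq A (topspace X) (G k 0) (h k)) \<and>
        (\<forall>t\<in>{0<..T}. \<forall>c\<in>A. \<forall>p\<in>fst c. \<forall>v w. (\<lambda>k. G k t c p v w) \<longlonglongrightarrow> g t c p v w))"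

text \<open>
  The factor \<open>r\<close> undoes the normalisation: if \<open>g(t)\<close> is a Ricci flow then so is \<open>r g(t / r)\<close>, and its
  initial metric is \<open>r g\<^sub>0\<close>.
\<close>

definition cusp_contracting_flow ::
    "'a topology \<Rightarrow> 'a coord set \<Rightarrow> 'a set \<Rightarrow> 'a metric_tensor \<Rightarrow> real \<Rightarrow>
     (real \<Rightarrow> 'a metric_tensor) \<Rightarrow> bool" where
  "cusp_contracting_flow X A P g0 T g \<longleftrightarrow>
     ricci_flow X A {0<..T} g \<and>
     converges_smoothly_locally A (topspace X - P) g g0 \<and>
     (\<exists>r>0. normalised_construction X A P (scale_metric r g0) (r * T)
              (\<lambda>t. scale_metric r (g (t / r))))"

end

theory Submission
  imports Defs "HOL-Complex_Analysis.Cauchy_Integral_Formula"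
begin

text \<open>
  Write a conformal metric as \<open>e |dz|\<^sup>2\<close>. Its Gauss curvature is \<open>- \<Delta> ln e / (2 e)\<close>, so that a conformal
  Ricci flow is a solution of \<open>\<partial>e / \<partial>t = \<Delta> ln e\<close>. Both flows stay conformal, because the ratio of
  two components of the metric is constant in time.

  Let \<open>e'\<close> be the competitor. Its curvature is bounded below, hence it is a supersolution of a Liouville
  equation, and comparison with a barrier near a puncture, where \<open>e0\<close> tends to infinity, shows that
  \<open>e'(t)\<close> becomes uniformly large there as \<open>t \<down> 0\<close>. So \<open>e'\<close> eventually dominates each truncated initial
  metric, and the maximum principle on the compact surface gives \<open>e' \<ge> e\<close> in the limit.

  For the converse, the curvature bound makes \<open>e'(t) exp (- B t)\<close> decreasing in \<open>t\<close>, so that \<open>e'\<close>, and with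
  it \<open>e\<close>, is dominated by a multiple of \<open>e0\<close>, which has finite area. Hence the area of \<open>e'(t) - e(t)\<close>
  tends to \<open>0\<close> as \<open>t \<down> 0\<close>. Instead of the Gauss-Bonnet theorem, a Gronwall estimate for the sum \<open>I(t)\<close> of
  the integrals of \<open>\<beta> (e' - e)\<close> over finitely many coordinate squares, with bump functions \<open>\<beta>\<close>, keeps it
  there: \<open>I' = \<Sum> \<integral> \<Delta>\<beta> (ln e' - ln e)\<close>, and this is at most a multiple of \<open>I\<close> since \<open>e\<close> is bounded
  below and every square is covered by the squares of half the size.
\<close>

section \<open>Laplacian and Gauss curvature in an isothermal coordinate\<close>

text \<open>The maximum principle yields only one of the two inequalities. With cusps present
  neither \<open>e\<close> nor \<open>e'\<close> extends continuously to time 0 on the closed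
  surface, so the comparison goes through a fixed truncated flow, for which all constants are
  finite. It is applied to quotients of densities, which, unlike the densities, are functions on the
  surface. The reverse inequality comes from area, where \<open>e' \<ge> e\<close> makes a one-sided
  estimate sufficient: \<open>0 \<le> ln e' - ln e \<le> (e' - e) / m\<close> with \<open>m\<close>
  a lower bound of \<open>e\<close>, whatever the sign of \<open>\<Delta>\<beta>\<close>. The finite
  area of \<open>e0\<close> at a cusp is extracted from the competitor. The derivative of its
  weighted area is bounded below by a decreasing affine function of that area, so the area stays
  bounded as \<open>t\<close> decreases to 0, and monotone convergence passes the bound on to
  \<open>e0\<close>. A bump that vanishes at the edge of a square cannot control the whole square;
  hence the two sizes of squares, the smaller ones already covering the surface.\<close>

definition lap :: "(complex \<Rightarrow> real) \<Rightarrow> complex \<Rightarrow> real" where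
  "lap f z = pd 1 (pd 1 f) z + pd 2 (pd 2 f) z"

text \<open>Pure second partials along coordinate lines, in the form used by \<open>pd\<close>:
  neither the Laplacian nor the curvature of an isothermal metric involves a mixed one.\<close>

definition C2 :: "complex set \<Rightarrow> (complex \<Rightarrow> real) \<Rightarrow> bool" where
  "C2 V f \<longleftrightarrow> continuous_on V f \<and>
     (\<forall>i. continuous_on V (pd i f) \<and> continuous_on V (pd i (pd i f)) \<and>
       (\<forall>z\<in>V. ((\<lambda>s. f (z + of_real s * dir i)) has_real_derivative pd i f z) (at 0) \<and>
         ((\<lambda>s. pd i f (z + of_real s * dir i)) has_real_derivative pd i (pd i f) z) (at 0)))"

lemma pdI: "((\<lambda>s. f (z + of_real s * dir i)) has_real_derivative d) (at 0) \<Longrightarrow> pd i f z = d"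
  unfolding pd_def by (rule DERIV_imp_deriv)

lemma eventually_line_in:
  assumes "open V" "z \<in> V"
  shows "\<forall>\<^sub>F s in nhds (0::real). z + of_real s * v \<in> (V :: complex set)"
proof -
  have "open ((\<lambda>s::real. z + of_real s * v) -` V)"
    using assms by (intro open_vimage continuous_intros)
  moreover have "0 \<in> (\<lambda>s::real. z + of_real s * v) -` V" using assms by simp
  ultimately show ?thesis
    unfolding eventually_nhds by blast
qed

lemma line_DERIV_cong:
  fixes V :: "complex set"
  assumes "open V" "z \<in> V" "\<And>w. w \<in> V \<Longrightarrow> f w = g w"
  shows "((\<lambda>s::real. f (z + of_real s * v)) has_real_derivative d) (at 0) \<longleftrightarrow>
         ((\<lambda>s. g (z + of_real s * v)) has_real_derivative d) (at 0)"
  by (intro DERIV_cong_ev refl eventually_mono[OF eventually_line_in[OF assms(1,2)]] assms(3))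

lemma pd_cong:
  assumes "open V" "z \<in> V" "\<And>w. w \<in> V \<Longrightarrow> f w = g w"
  shows "pd i f z = pd i g z"
  unfolding pd_def
  by (intro deriv_cong_ev refl eventually_mono[OF eventually_line_in[OF assms(1,2)]] assms(3))

lemma lap_cong:
  assumes "open V" "z \<in> V" "\<And>w. w \<in> V \<Longrightarrow> f w = g w"
  shows "lap f z = lap g z"
proof -
  have "pd i (pd i f) z = pd i (pd i g) z" for i
    using assms by (intro pd_cong[of V]) (auto intro!: pd_cong[of V])
  then show ?thesis by (simp add: lap_def)
qed

text \<open>Since \<open>V\<close> is open, \<open>pd i f\<close> agrees with the candidate
  \<open>fi i\<close> along a short line through each point, so second derivatives may be computed
  from the candidates.\<close>

lemma C2I:
  assumes V: "open V" and f: "continuous_on V f"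
    and fi: "\<And>i. continuous_on V (fi i)" "\<And>i z. z \<in> V \<Longrightarrow>
        ((\<lambda>s. f (z + of_real s * dir i)) has_real_derivative fi i z) (at 0)"
    and fii: "\<And>i. continuous_on V (fii i)" "\<And>i z. z \<in> V \<Longrightarrow>
        ((\<lambda>s. fi i (z + of_real s * dir i)) has_real_derivative fii i z) (at 0)"
  shows "C2 V f" and "\<And>i z. z \<in> V \<Longrightarrow> pd i f z = fi i z"
    and "\<And>i z. z \<in> V \<Longrightarrow> pd i (pd i f) z = fii i z"
proof -
  show p1: "pd i f z = fi i z" if "z \<in> V" for i z
    using fi(2)[OF that] by (rule pdI)
  have d2: "((\<lambda>s. pd i f (z + of_real s * dir i)) has_real_derivative fii i z) (at 0)"
    if "z \<in> V" for i z
    using line_DERIV_cong[OF V that, of "pd i f" "fi i"] p1 fii(2)[OF that] by blast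
  show p2: "pd i (pd i f) z = fii i z" if "z \<in> V" for i z
    using d2[OF that] by (rule pdI)
  show "C2 V f"
    unfolding C2_def
  proof (intro conjI allI ballI)
    show "continuous_on V (pd i f)" for i
      using fi(1)[of i] p1 by (simp cong: continuous_on_cong)
    show "continuous_on V (pd i (pd i f))" for i
      using fii(1)[of i] p2 by (simp cong: continuous_on_cong)
  qed (use f fi(2) d2 p1 p2 in auto)
qed

lemma has_derivative_line:
  assumes "(f has_derivative F) (at z within V)" "open V" "z \<in> V"
  shows "((\<lambda>s::real. f (z + of_real s * v)) has_real_derivative (F v :: real)) (at (0::real))"
proof -
  have f: "(f has_derivative F) (at (z + 0 *\<^sub>R v))"
    using assms by (simp add: at_within_open[of z V])
  have l: "((\<lambda>s::real. z + s *\<^sub>R v) has_derivative (\<lambda>s. s *\<^sub>R v)) (at 0)"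
    by (rule derivative_eq_intros refl | simp)+
  have "((\<lambda>s::real. f (z + s *\<^sub>R v)) has_derivative (\<lambda>s. F (s *\<^sub>R v))) (at 0)"
    by (rule has_derivative_compose[where g = f, OF l f])
  moreover have "(\<lambda>s. F (s *\<^sub>R v)) = (*) (F v)"
    using linear_scale[OF has_derivative_linear[OF assms(1)]] by (simp add: fun_eq_iff mult.commute)
  ultimately show ?thesis by (simp add: has_field_derivative_def scaleR_conv_of_real)
qed

lemma C2_Ck_on:
  assumes V: "open V" and f: "Ck_on 2 V f"
  shows "C2 V f"
proof -
  obtain f' where f': "\<And>x. x \<in> V \<Longrightarrow> (f has_derivative f' x) (at x within V)"
    and 1: "\<And>v. Ck_on 1 V (\<lambda>x. f' x v)"
    using f by (auto simp: numeral_2_eq_2)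
  have "\<forall>v. \<exists>f''. (\<forall>x\<in>V. ((\<lambda>x. f' x v) has_derivative f'' x) (at x within V)) \<and>
      (\<forall>w. continuous_on V (\<lambda>x. f'' x w))"
    using 1 by (auto simp: One_nat_def)
  then obtain f'' where f'': "\<And>v x. x \<in> V \<Longrightarrow> ((\<lambda>x. f' x v) has_derivative f'' v x) (at x within V)"
    and c: "\<And>v w. continuous_on V (\<lambda>x. f'' v x w)"
    by metis
  show ?thesis
  proof (rule C2I(1)[where fi="\<lambda>i x. f' x (dir i)" and fii="\<lambda>i x. f'' (dir i) x (dir i)"])
    show "continuous_on V f" using f' has_derivative_continuous continuous_on_eq_continuous_within by blast
    show "continuous_on V (\<lambda>x. f' x (dir i))" for i
      using f'' has_derivative_continuous continuous_on_eq_continuous_within by blast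
  qed (use V c has_derivative_line[OF f'] has_derivative_line[OF f''] in auto)
qed

lemma C2_ln:
  assumes V: "open V" and f: "C2 V f" and pos: "\<And>z. z \<in> V \<Longrightarrow> f z > 0"
  shows "C2 V (\<lambda>z. ln (f z))" and "\<And>i z. z \<in> V \<Longrightarrow> pd i (\<lambda>z. ln (f z)) z = pd i f z / f z"
proof -
  have nz: "\<forall>z\<in>V. f z \<noteq> 0" using pos by force
  have c: "continuous_on V f" "continuous_on V (pd i f)" "continuous_on V (pd i (pd i f))" for i
    using f by (auto simp: C2_def)
  have d: "((\<lambda>s. f (z + of_real s * dir i)) has_real_derivative pd i f z) (at 0)"
    "((\<lambda>s. pd i f (z + of_real s * dir i)) has_real_derivative pd i (pd i f) z) (at 0)"
    if "z \<in> V" for i z using that f by (auto simp: C2_def)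
  have 1: "continuous_on V (\<lambda>z. ln (f z))" using c nz by (intro continuous_intros) auto
  have 2: "continuous_on V (\<lambda>z. pd i f z / f z)" for i using c nz by (intro continuous_intros) auto
  have 3: "continuous_on V (\<lambda>z. (pd i (pd i f) z * f z - pd i f z * pd i f z) / (f z * f z))" for i
    using c nz by (intro continuous_intros) auto
  have 4: "((\<lambda>s. ln (f (z + of_real s * dir i))) has_real_derivative pd i f z / f z) (at 0)"
    if "z \<in> V" for i z
    using d(1)[OF that, of i] pos[OF that] by (auto intro!: derivative_eq_intros)
  have 5: "((\<lambda>s. pd i f (z + of_real s * dir i) / f (z + of_real s * dir i)) has_real_derivative
       (pd i (pd i f) z * f z - pd i f z * pd i f z) / (f z * f z)) (at 0)"
    if "z \<in> V" for i z
    using DERIV_divide[OF d(2)[OF that, of i] d(1)[OF that, of i]] pos[OF that] by simp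
  show "C2 V (\<lambda>z. ln (f z))" and "\<And>i z. z \<in> V \<Longrightarrow> pd i (\<lambda>z. ln (f z)) z = pd i f z / f z"
    using C2I(1,2)[of V "\<lambda>z. ln (f z)" "\<lambda>i z. pd i f z / f z", OF V 1 2 4 3 5] by auto
qed

lemma C2_diff:
  assumes V: "open V" and f: "C2 V f" and g: "C2 V g"
  shows "C2 V (\<lambda>z. f z - g z)" and "\<And>z. z \<in> V \<Longrightarrow> lap (\<lambda>z. f z - g z) z = lap f z - lap g z"
proof -
  note * = C2I[of V "\<lambda>z. f z - g z" "\<lambda>i z. pd i f z - pd i g z" "\<lambda>i z. pd i (pd i f) z - pd i (pd i g) z"]
  have c: "continuous_on V f" "continuous_on V (pd i f)" "continuous_on V (pd i (pd i f))"
    "continuous_on V g" "continuous_on V (pd i g)" "continuous_on V (pd i (pd i g))" for i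
    using f g by (auto simp: C2_def)
  have d: "((\<lambda>s. f (z + of_real s * dir i)) has_real_derivative pd i f z) (at 0)"
    "((\<lambda>s. pd i f (z + of_real s * dir i)) has_real_derivative pd i (pd i f) z) (at 0)"
    "((\<lambda>s. g (z + of_real s * dir i)) has_real_derivative pd i g z) (at 0)"
    "((\<lambda>s. pd i g (z + of_real s * dir i)) has_real_derivative pd i (pd i g) z) (at 0)"
    if "z \<in> V" for i z using that f g by (auto simp: C2_def)
  show "C2 V (\<lambda>z. f z - g z)"
    by (rule *(1)) (use V c d in \<open>auto intro!: continuous_intros DERIV_diff\<close>)
  show "lap (\<lambda>z. f z - g z) z = lap f z - lap g z" if "z \<in> V" for z
  proof -
    have "pd i (pd i (\<lambda>z. f z - g z)) z = pd i (pd i f) z - pd i (pd i g) z" for i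
      by (rule *(3)) (use V c d that in \<open>auto intro!: continuous_intros DERIV_diff\<close>)
    then show ?thesis by (simp add: lap_def)
  qed
qed

text \<open>The logarithm of the barrier near a puncture has this shape; with \<open>b = 0\<close>
  the lemma also supplies the constants that appear under rescaling.\<close>

lemma C2_quadratic:
  shows "C2 UNIV (\<lambda>z. a + b * (norm (z - z0))\<^sup>2)" and "lap (\<lambda>z. a + b * (norm (z - z0))\<^sup>2) z = 4 * b"
proof -
  let ?f = "\<lambda>z::complex. a + b * (norm (z - z0))\<^sup>2"
  let ?fi = "\<lambda>i z. 2 * b * ((z - z0) \<bullet> dir i)"
  have dd: "dir i \<bullet> dir i = 1" for i by (simp add: dir_def)
  have e: "z + of_real s * dir i = z + s *\<^sub>R dir i" for z s i by (simp add: scaleR_conv_of_real)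
  have 1: "((\<lambda>s. ?f (z + of_real s * dir i)) has_real_derivative ?fi i z) (at 0)" for z i
    unfolding power2_norm_eq_inner e
    by (auto intro!: derivative_eq_intros simp: inner_add_left inner_add_right inner_diff_left inner_diff_right dd inner_commute algebra_simps)
  have 2: "((\<lambda>s. ?fi i (z + of_real s * dir i)) has_real_derivative 2 * b) (at 0)" for z i
    unfolding e by (auto intro!: derivative_eq_intros simp: inner_add_left inner_diff_left dd)
  note * = C2I[of UNIV ?f ?fi "\<lambda>_ _. 2 * b"]
  show "C2 UNIV ?f" by (rule *(1)) (use 1 2 in \<open>auto intro!: continuous_intros\<close>)
  have "pd i (pd i ?f) z = 2 * b" for i
    by (rule *(3)) (use 1 2 in \<open>auto intro!: continuous_intros\<close>)
  then show "lap ?f z = 4 * b" by (simp add: lap_def)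
qed

lemma C2_mono: "C2 V f \<Longrightarrow> W \<subseteq> V \<Longrightarrow> C2 W f"
  unfolding C2_def by (meson continuous_on_subset subsetD)

text \<open>\<open>matrix_inv\<close> chooses some two-sided inverse; associativity forces the
  choice to be the evident one.\<close>

lemma matrix_inv_scalar:
  assumes "(e::real) \<noteq> 0" "A = (\<chi> i j. if i = j then e else 0)"
  shows "matrix_inv (A :: real^2^2) = (\<chi> i j. if i = j then 1 / e else 0)"
proof -
  let ?B = "\<chi> i j. if i = j then 1 / e else 0 :: real^2^2"
  have AB: "A ** ?B = mat 1" "?B ** A = mat 1"
    using assms by (auto simp: matrix_matrix_mult_def mat_def vec_eq_iff sum_2 forall_2)
  have inv: "A ** matrix_inv A = mat 1 \<and> matrix_inv A ** A = mat 1"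
    unfolding matrix_inv_def by (rule someI[of _ ?B]) (use AB in auto)
  then have "matrix_inv A = (?B ** A) ** matrix_inv A"
    by (simp add: AB)
  also have "\<dots> = ?B ** (A ** matrix_inv A)" by (rule matrix_mul_assoc[symmetric])
  also have "\<dots> = ?B" using inv by simp
  finally show ?thesis .
qed

text \<open>In terms of \<open>L = ln E\<close> the Christoffel symbols are half sums of first
  derivatives of \<open>L\<close>. Their quadratic contributions to the curvature cancel, and since
  the Gram matrix is diagonal only one component of the curvature tensor remains, namely
  \<open>- lap L / 2\<close>.\<close>

lemma gauss_curvature_isothermal:
  assumes V: "open V" and z: "snd c p \<in> V"
    and g: "\<And>i j z. z \<in> V \<Longrightarrow> coeff g c (dir i) (dir j) z = (if i = j then E z else 0)"
    and E: "C2 V E" and pos: "\<And>z. z \<in> V \<Longrightarrow> E z > 0"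
  shows "gauss_curvature g c p = - lap (\<lambda>z. ln (E z)) (snd c p) / (2 * E (snd c p))"
proof -
  define L where "L = (\<lambda>z. ln (E z))"
  have L: "C2 V L" and L1: "\<And>i z. z \<in> V \<Longrightarrow> pd i L z = pd i E z / E z"
    using C2_ln[OF V E pos] by (auto simp: L_def)
  have gram: "gram g c z = (\<chi> i j. if i = j then E z else 0)" if "z \<in> V" for z
    using g[OF that] by (simp add: gram_def vec_eq_iff)
  \<comment> \<open>Expressing derivatives of \<open>E\<close> as \<open>E\<close> times derivatives
    of \<open>L\<close> lets the factor cancel against the inverse matrix.\<close>
  have pg: "pd i (\<lambda>z. gram g c z $ j $ l) z = (if j = l then E z * pd i L z else 0)" if "z \<in> V" for i j l z
  proof -
    have "pd i (\<lambda>z. gram g c z $ j $ l) z = pd i (\<lambda>z. if j = l then E z else 0) z"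
      by (rule pd_cong[OF V that]) (simp add: gram)
    also have "\<dots> = (if j = l then pd i E z else 0)"
      by (simp add: pd_def)
    finally show ?thesis using L1[OF that] pos[OF that] by simp
  qed
  have mi: "matrix_inv (gram g c z) $ k $ l = (if k = l then 1 / E z else 0)" if "z \<in> V" for z k l
    using matrix_inv_scalar[OF _ gram[OF that]] pos[OF that] by simp
  have chr: "christoffel g c k i j z =
     ((if j = k then pd i L z else 0) + (if i = k then pd j L z else 0) - (if i = j then pd k L z else 0)) / 2"
    if "z \<in> V" for k i j z
  proof -
    have "christoffel g c k i j z =
       (\<Sum>l\<in>UNIV. (if k = l then 1 / E z else 0) * ((if j = l then E z * pd i L z else 0) +
          (if i = l then E z * pd j L z else 0) - (if i = j then E z * pd l L z else 0))) / 2"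
      using that by (simp only: christoffel_def pg mi)
    also have "\<dots> = (1 / E z * ((if j = k then E z * pd i L z else 0) +
          (if i = k then E z * pd j L z else 0) - (if i = j then E z * pd k L z else 0))) / 2"
      by (simp add: if_distribR if_distrib[where f="\<lambda>x. x * _"] sum.delta cong: if_cong)
    finally have eq: "christoffel g c k i j z = \<dots>" .
    have "E z \<noteq> 0" using pos[OF that] by simp
    then show ?thesis unfolding eq
      by (cases "j = k"; cases "i = k"; cases "i = j") (simp_all add: field_simps)
  qed
  have dL: "((\<lambda>s. pd i L (z + of_real s * dir i)) has_real_derivative pd i (pd i L) z) (at 0)" if "z \<in> V" for i z
    using that L by (auto simp: C2_def)
  have r1: "pd 1 (christoffel g c 1 2 2) z = - pd 1 (pd 1 L) z / 2" if "z \<in> V" for z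
  proof -
    have "pd 1 (christoffel g c 1 2 2) z = pd 1 (\<lambda>z. - pd 1 L z / 2) z"
      by (rule pd_cong[OF V that]) (simp add: chr)
    also have "\<dots> = - pd 1 (pd 1 L) z / 2"
      by (rule pdI) (use dL[OF that, of 1] in \<open>auto intro!: derivative_eq_intros\<close>)
    finally show ?thesis .
  qed
  have r2: "pd 2 (christoffel g c 1 1 2) z = pd 2 (pd 2 L) z / 2" if "z \<in> V" for z
  proof -
    have "pd 2 (christoffel g c 1 1 2) z = pd 2 (\<lambda>z. pd 2 L z / 2) z"
      by (rule pd_cong[OF V that]) (simp add: chr)
    also have "\<dots> = pd 2 (pd 2 L) z / 2"
      by (rule pdI) (use dL[OF that, of 2] in \<open>auto intro!: derivative_eq_intros\<close>)
    finally show ?thesis .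
  qed
  let ?z = "snd c p"
  have "riemann_tensor g c 1 1 2 2 ?z = - lap L ?z / 2"
    using z by (simp add: riemann_tensor_def r1 r2 chr sum_2 lap_def)
  then have "gauss_curvature g c p = (E ?z * (- lap L ?z / 2)) / (E ?z * E ?z)"
    using z by (simp add: gauss_curvature_def Let_def sum_2 gram det_2)
  then show ?thesis using pos[OF z] by (simp add: L_def)
qed

section \<open>Logarithmic diffusion and the comparison principle\<close>

text \<open>If \<open>c < 0\<close>, then \<open>h'\<close> vanishes at the minimum and is negative
  just to the right of it, so the mean value theorem produces a smaller value of
  \<open>h\<close>.\<close>

lemma second_derivative_nonneg_at_min:
  fixes h :: "real \<Rightarrow> real"
  assumes d: "d > 0" and h: "\<And>s. \<bar>s\<bar> < d \<Longrightarrow> (h has_real_derivative h' s) (at s)"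
    and h': "(h' has_real_derivative c) (at 0)" and min: "\<And>s. \<bar>s\<bar> < d \<Longrightarrow> h 0 \<le> h s"
  shows "c \<ge> 0"
proof (rule ccontr)
  assume "\<not> c \<ge> 0"
  have "h' 0 = 0"
    by (rule DERIV_local_min[OF h[of 0] d]) (use d min in auto)
  then obtain e where e: "e > 0" "\<And>k. k > 0 \<Longrightarrow> k < e \<Longrightarrow> h' k < 0"
    using DERIV_neg_dec_right[OF h'] \<open>\<not> c \<ge> 0\<close> by fastforce
  define x where "x = min d e / 2"
  have x: "0 < x" "x < d" "x < e" using d e by (auto simp: x_def)
  obtain y where "0 < y" "y < x" "h x - h 0 = (x - 0) * h' y"
    using MVT2[OF x(1), of h h'] h x by force
  moreover have "(x - 0) * h' y < 0"
    using e(2)[of y] x calculation by (simp add: mult_pos_neg)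
  ultimately show False using min[of x] x by simp
qed

lemma lap_nonneg_at_min:
  assumes V: "open V" and f: "C2 V f" and z: "z \<in> V" and min: "\<And>w. w \<in> V \<Longrightarrow> f z \<le> f w"
  shows "lap f z \<ge> 0"
proof -
  have "pd i (pd i f) z \<ge> 0" for i
  proof -
    obtain d where d: "d > 0" "\<And>s::real. \<bar>s\<bar> < d \<Longrightarrow> z + of_real s * dir i \<in> V"
      using eventually_line_in[OF V z, of "dir i"] by (auto simp: eventually_nhds_metric dist_real_def)
    show ?thesis
    proof (rule second_derivative_nonneg_at_min[OF d(1)])
      show "((\<lambda>s. f (z + of_real s * dir i)) has_real_derivative pd i f (z + of_real s * dir i)) (at s)"
        if "\<bar>s\<bar> < d" for s
      proof -
        \<comment> \<open>\<open>C2\<close> speaks of derivatives at parameter 0 only; the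
          derivative at \<open>s\<close> is obtained by moving the base point along the
          line.\<close>
        have "((\<lambda>u. f (z + of_real s * dir i + of_real u * dir i)) has_real_derivative
            pd i f (z + of_real s * dir i)) (at 0)"
          using f d(2)[OF that] by (auto simp: C2_def)
        then have "((\<lambda>u. f (z + of_real (u + s) * dir i)) has_real_derivative
            pd i f (z + of_real s * dir i)) (at 0)"
          by (simp add: algebra_simps)
        then show ?thesis
          using DERIV_shift[of "\<lambda>s. f (z + of_real s * dir i)" _ 0 s] by simp
      qed
      show "((\<lambda>s. pd i f (z + of_real s * dir i)) has_real_derivative pd i (pd i f) z) (at 0)"
        using f z by (auto simp: C2_def)
    qed (use d min in auto)
  qed
  then show ?thesis by (simp add: lap_def)
qed

section \<open>Conformal flows as solutions of the logarithmic diffusion equation\<close>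

definition cdom :: "'a coord \<Rightarrow> complex set" where
  "cdom c = snd c ` fst c"

text \<open>Time derivatives are taken within \<open>I\<close>, which admits the closed initial time
  of the truncated flows. Joint continuity of \<open>lap (ln e)\<close> is recorded for
  differentiation under the integral and for bounds by compactness.\<close>

definition log_diffusion :: "complex set \<Rightarrow> real set \<Rightarrow> (complex \<Rightarrow> real \<Rightarrow> real) \<Rightarrow> bool" where
  "log_diffusion V I e \<longleftrightarrow>
     continuous_on (V \<times> I) (\<lambda>(z, t). e z t) \<and> (\<forall>z\<in>V. \<forall>t\<in>I. e z t > 0) \<and>
     (\<forall>t\<in>I. C2 V (\<lambda>z. e z t)) \<and>
     continuous_on (V \<times> I) (\<lambda>(z, t). lap (\<lambda>w. ln (e w t)) z) \<and>
     (\<forall>z\<in>V. \<forall>t\<in>I. (e z has_real_derivative lap (\<lambda>w. ln (e w t)) z) (at t within I))"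

text \<open>The transformation law of the coefficient in \<open>e |dz|^2\<close>. It is also that of
  an area density, so integrals of such families are independent of the coordinate.\<close>

definition conf_density :: "'a coord set \<Rightarrow> ('a coord \<Rightarrow> complex \<Rightarrow> real) \<Rightarrow> bool" where
  "conf_density A e \<longleftrightarrow> (\<forall>c\<in>A. \<forall>d\<in>A. \<forall>p\<in>fst c \<inter> fst d.
     e c (snd c p) = e d (snd d p) * (norm (deriv (transition c d) (snd c p)))\<^sup>2)"

definition conf_flow :: "'a coord set \<Rightarrow> real set \<Rightarrow> ('a coord \<Rightarrow> complex \<Rightarrow> real \<Rightarrow> real) \<Rightarrow> bool" where
  "conf_flow A I e \<longleftrightarrow>
     (\<forall>c\<in>A. log_diffusion (cdom c) I (e c)) \<and> (\<forall>t\<in>I. conf_density A (\<lambda>c z. e c z t))"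

lemma log_diffusionD:
  assumes "log_diffusion V I e"
  shows "continuous_on (V \<times> I) (\<lambda>(z, t). e z t)"
    and "z \<in> V \<Longrightarrow> t \<in> I \<Longrightarrow> e z t > 0"
    and "t \<in> I \<Longrightarrow> C2 V (\<lambda>z. e z t)"
    and "continuous_on (V \<times> I) (\<lambda>(z, t). lap (\<lambda>w. ln (e w t)) z)"
    and "z \<in> V \<Longrightarrow> t \<in> I \<Longrightarrow> (e z has_real_derivative lap (\<lambda>w. ln (e w t)) z) (at t within I)"
  using assms by (auto simp: log_diffusion_def)

lemma log_diffusion_subset:
  assumes e: "log_diffusion V I e" and J: "J \<subseteq> I"
  shows "log_diffusion V J e"
  unfolding log_diffusion_def
proof (intro conjI ballI)
  have VJ: "V \<times> J \<subseteq> V \<times> I" using J by auto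
  show "continuous_on (V \<times> J) (\<lambda>(z, t). e z t)"
    "continuous_on (V \<times> J) (\<lambda>(z, t). lap (\<lambda>w. ln (e w t)) z)"
    using continuous_on_subset[OF _ VJ] log_diffusionD[OF e] by blast+
  show "(e z has_real_derivative lap (\<lambda>w. ln (e w t)) z) (at t within J)" if "z \<in> V" "t \<in> J" for z t
    using log_diffusionD(5)[OF e that(1), of t] that J by (meson has_field_derivative_subset subsetD)
qed (use log_diffusionD[OF e] J in auto)

lemma conf_flow_subset: "conf_flow A I e \<Longrightarrow> J \<subseteq> I \<Longrightarrow> conf_flow A J e"
  unfolding conf_flow_def using log_diffusion_subset by blast

text \<open>The factor coming from the transition map cancels, so the quotient of two conformal
  metrics is a function on the surface, to which a maximum principle can be applied across
  charts.\<close>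

lemma conf_density_ratio:
  assumes "conf_density A e" "conf_density A f" "c \<in> A" "d \<in> A" "p \<in> fst c" "p \<in> fst d"
    and "f c (snd c p) > 0"
  shows "e c (snd c p) / f c (snd c p) = e d (snd d p) / (f d (snd d p) :: real)"
proof -
  let ?r = "(norm (deriv (transition c d) (snd c p)))\<^sup>2"
  have "e c (snd c p) = e d (snd d p) * ?r" "f c (snd c p) = f d (snd d p) * ?r"
    using assms unfolding conf_density_def by blast+
  moreover from this have "?r \<noteq> 0" using assms(7) by auto
  ultimately show ?thesis by simp
qed

text \<open>A square of half side \<open>r\<close>, preferred to a disc because integration by parts
  is done one real variable at a time.\<close>

definition sq :: "complex \<Rightarrow> real \<Rightarrow> complex set" where
  "sq z r = cbox (z - Complex r r) (z + Complex r r)"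

lemma compact_sq [simp]: "compact (sq z r)"
  by (simp add: sq_def)

lemma mem_sq: "w \<in> sq z r \<longleftrightarrow> \<bar>Re w - Re z\<bar> \<le> r \<and> \<bar>Im w - Im z\<bar> \<le> r"
  by (auto simp: sq_def in_cbox_complex_iff)

lemma riemann_surface_chart:
  assumes "riemann_surface X A" "c \<in> A"
  shows "open (cdom c)" "inj_on (snd c) (fst c)" "fst c \<subseteq> topspace X" "openin X (fst c)"
proof -
  have c: "is_chart X c" using assms by (auto simp: riemann_surface_def)
  then show "open (cdom c)" "openin X (fst c)" by (auto simp: is_chart_def cdom_def)
  then show sub: "fst c \<subseteq> topspace X" by (simp add: openin_subset)
  then show "inj_on (snd c) (fst c)"
    using homeomorphic_imp_injective_map[of "subtopology X (fst c)" "top_of_set (snd c ` fst c)" "snd c"] c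
    by (auto simp: is_chart_def topspace_subtopology Int_absorb1)
qed

lemma finite_argmax:
  fixes m :: "'a \<Rightarrow> real"
  assumes "finite J" "J \<noteq> {}"
  obtains k where "k \<in> J" "\<And>j. j \<in> J \<Longrightarrow> m j \<le> m k"
proof -
  have "Max (m ` J) \<in> m ` J" using assms by (intro Max_in) auto
  then obtain k where "k \<in> J" "Max (m ` J) = m k" by blast
  moreover have "m j \<le> Max (m ` J)" if "j \<in> J" for j using that assms by simp
  ultimately show thesis using that by simp
qed

text \<open>The margin between \<open>rad j / 2\<close> and \<open>rad j\<close> is the point:
  weights may vanish at the edges of the full squares and still be bounded below on the half
  squares, which cover.\<close>

locale boxed_surface =
  fixes X :: "'a topology" and A :: "'a coord set" and J :: "'a set"
    and ch :: "'a \<Rightarrow> 'a coord" and ctr :: "'a \<Rightarrow> complex" and rad :: "'a \<Rightarrow> real"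
  assumes surf: "riemann_surface X A" and fin: "finite J"
    and ch: "\<And>j. j \<in> J \<Longrightarrow> ch j \<in> A" and rad: "\<And>j. j \<in> J \<Longrightarrow> rad j > 0"
    and box_sub: "\<And>j. j \<in> J \<Longrightarrow> sq (ctr j) (rad j) \<subseteq> cdom (ch j)"
    and cover: "\<And>p. p \<in> topspace X \<Longrightarrow>
        \<exists>j\<in>J. p \<in> fst (ch j) \<and> snd (ch j) p \<in> sq (ctr j) (rad j / 2)"
begin

abbreviation box_of :: "'a \<Rightarrow> complex set" where
  "box_of j \<equiv> sq (ctr j) (rad j)"

lemma half_box_sub: "j \<in> J \<Longrightarrow> sq (ctr j) (rad j / 2) \<subseteq> box_of j"
  using rad[of j] by (auto simp: mem_sq)

lemma open_cdom: "j \<in> J \<Longrightarrow> open (cdom (ch j))"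
  using riemann_surface_chart(1)[OF surf ch] .

lemma cover_box:
  assumes "j \<in> J" "z \<in> cdom (ch j)"
  obtains i p where "i \<in> J" "p \<in> fst (ch i)" "p \<in> fst (ch j)" "snd (ch j) p = z" "snd (ch i) p \<in> box_of i"
proof -
  obtain p where p: "p \<in> fst (ch j)" "snd (ch j) p = z" using assms by (auto simp: cdom_def)
  then have "p \<in> topspace X" using riemann_surface_chart(3)[OF surf ch] assms by blast
  then obtain i where "i \<in> J" "p \<in> fst (ch i)" "snd (ch i) p \<in> sq (ctr i) (rad i / 2)"
    using cover by blast
  then show ?thesis using that p half_box_sub by blast
qed

text \<open>At a space-time maximum of the damped quantity \<open>?\<Phi>\<close> above
  \<open>\<eta>\<close>, the function \<open>ln e2 - ln e1\<close> has a spatial minimum, so the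
  Laplacian of \<open>ln e2\<close> is at least that of \<open>ln e1\<close>. What is left is
  controlled by \<open>B\<close>, which amounts to an upper curvature bound \<open>B / 2\<close> for
  \<open>e1\<close>.\<close>

lemma comparison_from_time:
  fixes \<eta> B a b :: real
  assumes e1: "conf_flow A {a..b} e1" and e2: "conf_flow A {a..b} e2" and \<eta>: "\<eta> \<ge> 0"
    and B: "\<And>j z t. j \<in> J \<Longrightarrow> z \<in> box_of j \<Longrightarrow> t \<in> {a..b} \<Longrightarrow>
        lap (\<lambda>w. ln (e1 (ch j) w t)) z \<ge> - B * e1 (ch j) z t"
    and init: "\<And>j z. j \<in> J \<Longrightarrow> z \<in> box_of j \<Longrightarrow> e1 (ch j) z a - e2 (ch j) z a \<le> \<eta> * e1 (ch j) z a"
    and j: "j \<in> J" and z: "z \<in> box_of j" and t: "t \<in> {a..b}"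
  shows "e1 (ch j) z t - e2 (ch j) z t \<le> \<eta> * exp ((B + 1) * (t - a)) * e1 (ch j) z t"
proof -
  let ?\<Phi> = "\<lambda>j z t. (1 - e2 (ch j) z t / e1 (ch j) z t) * exp (- (B + 1) * (t - a))"
  have ld: "log_diffusion (cdom (ch j)) {a..b} (e1 (ch j))" "log_diffusion (cdom (ch j)) {a..b} (e2 (ch j))"
    if "j \<in> J" for j
    using e1 e2 ch that by (auto simp: conf_flow_def)
  have pos: "e1 (ch j) z t > 0" "e2 (ch j) z t > 0" if "j \<in> J" "z \<in> cdom (ch j)" "t \<in> {a..b}" for j z t
    using ld[OF that(1)] that log_diffusionD(2) by blast+
  have "\<exists>x. \<forall>j\<in>J. x j \<in> box_of j \<times> {a..b} \<and>
      (\<forall>y\<in>box_of j \<times> {a..b}. ?\<Phi> j (fst y) (snd y) \<le> ?\<Phi> j (fst (x j)) (snd (x j)))"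
  proof (rule bchoice, rule ballI)
    fix j assume j: "j \<in> J"
    have sub: "box_of j \<times> {a..b} \<subseteq> cdom (ch j) \<times> {a..b}" using box_sub[OF j] by auto
    have c: "continuous_on (box_of j \<times> {a..b}) (\<lambda>y. e1 (ch j) (fst y) (snd y))"
      "continuous_on (box_of j \<times> {a..b}) (\<lambda>y. e2 (ch j) (fst y) (snd y))"
      using log_diffusionD(1)[OF ld(1)[OF j]] log_diffusionD(1)[OF ld(2)[OF j]]
        continuous_on_subset[OF _ sub] by (auto simp: case_prod_beta)
    have nz: "\<forall>y\<in>box_of j \<times> {a..b}. e1 (ch j) (fst y) (snd y) \<noteq> 0"
      using pos(1)[OF j] sub by fastforce
    have "continuous_on (box_of j \<times> {a..b}) (\<lambda>y. ?\<Phi> j (fst y) (snd y))"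
      using c nz by (intro continuous_intros) auto
    moreover have "compact (box_of j \<times> {a..b})" by (simp add: compact_Times)
    moreover have "(ctr j, t) \<in> box_of j \<times> {a..b}" using t rad[OF j] by (auto simp: mem_sq)
    then have "box_of j \<times> {a..b} \<noteq> {}" by blast
    ultimately have "\<exists>x\<in>box_of j \<times> {a..b}.
      \<forall>y\<in>box_of j \<times> {a..b}. ?\<Phi> j (fst y) (snd y) \<le> ?\<Phi> j (fst x) (snd x)"
      by (intro continuous_attains_sup)
    then show "\<exists>x. x \<in> box_of j \<times> {a..b} \<and>
      (\<forall>y\<in>box_of j \<times> {a..b}. ?\<Phi> j (fst y) (snd y) \<le> ?\<Phi> j (fst x) (snd x))"
      by (simp only: Bex_def)
  qed
  then obtain x where x: "\<And>j. j \<in> J \<Longrightarrow> x j \<in> box_of j \<times> {a..b}"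
    and xm: "\<And>j y. j \<in> J \<Longrightarrow> y \<in> box_of j \<times> {a..b} \<Longrightarrow> ?\<Phi> j (fst y) (snd y) \<le> ?\<Phi> j (fst (x j)) (snd (x j))"
    by blast
  obtain k where k: "k \<in> J" "\<And>j. j \<in> J \<Longrightarrow> ?\<Phi> j (fst (x j)) (snd (x j)) \<le> ?\<Phi> k (fst (x k)) (snd (x k))"
    using finite_argmax[OF fin, of "\<lambda>j. ?\<Phi> j (fst (x j)) (snd (x j))"] j by blast
  obtain w s where ws: "x k = (w, s)" by force
  have w: "w \<in> box_of k" and s: "s \<in> {a..b}" using x[OF k(1)] ws by auto
  have wc: "w \<in> cdom (ch k)" using w box_sub[OF k(1)] by auto
  have max: "?\<Phi> j z t \<le> ?\<Phi> k w s" if "j \<in> J" "z \<in> box_of j" "t \<in> {a..b}" for j z t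
    using xm[OF that(1), of "(z, t)"] k(2)[OF that(1)] that ws by auto
  have "?\<Phi> k w s \<le> \<eta>"
  proof (rule ccontr)
    assume "\<not> ?\<Phi> k w s \<le> \<eta>"
    then have big: "?\<Phi> k w s > \<eta>" by simp
    have p1: "e1 (ch k) w s > 0" and p2: "e2 (ch k) w s > 0" using pos[OF k(1) wc s] by auto
    have sa: "s > a"
    proof (rule ccontr)
      assume "\<not> s > a"
      then have "s = a" using s by auto
      then have "?\<Phi> k w s = (e1 (ch k) w a - e2 (ch k) w a) / e1 (ch k) w a"
        using p1 by (simp add: field_simps)
      also have "\<dots> \<le> \<eta>" using init[OF k(1) w] p1 \<open>s = a\<close> by (simp add: field_simps)
      finally show False using big by simp
    qed
    have q: "1 - e2 (ch k) w s / e1 (ch k) w s > 0"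
    proof -
      have "0 < ?\<Phi> k w s" using big \<eta> by linarith
      then show ?thesis by (simp add: zero_less_mult_iff)
    qed
    \<comment> \<open>\<open>w\<close> may lie on the edge of its square. But every point of the
      chart lies in some square, and the quotient is independent of the chart, so \<open>w\<close>
      is a minimum over the whole open chart domain and the second derivative test applies.\<close>
    have global: "e2 (ch k) w s / e1 (ch k) w s \<le> e2 (ch k) z s / e1 (ch k) z s" if zc: "z \<in> cdom (ch k)" for z
    proof -
      obtain i p where ip: "i \<in> J" "p \<in> fst (ch i)" "p \<in> fst (ch k)" "snd (ch k) p = z" "snd (ch i) p \<in> box_of i"
        using cover_box[OF k(1) zc] .
      have "e2 (ch k) z s / e1 (ch k) z s = e2 (ch i) (snd (ch i) p) s / e1 (ch i) (snd (ch i) p) s"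
        using conf_density_ratio[of A "\<lambda>c z. e2 c z s" "\<lambda>c z. e1 c z s" "ch k" "ch i" p]
          e1 e2 s ch ip k(1) pos(1)[OF k(1) zc s] by (auto simp: conf_flow_def)
      moreover have "?\<Phi> i (snd (ch i) p) s \<le> ?\<Phi> k w s" using max ip s by blast
      ultimately show ?thesis by simp
    qed
    let ?V = "cdom (ch k)" and ?f1 = "\<lambda>z. ln (e1 (ch k) z s)" and ?f2 = "\<lambda>z. ln (e2 (ch k) z s)"
    have V: "open ?V" using open_cdom k by auto
    have c2: "C2 ?V ?f1" "C2 ?V ?f2"
      using C2_ln(1)[OF V log_diffusionD(3)[OF ld(1)[OF k(1)] s]] C2_ln(1)[OF V log_diffusionD(3)[OF ld(2)[OF k(1)] s]]
        pos[OF k(1) _ s] by auto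
    have "lap (\<lambda>z. ?f2 z - ?f1 z) w \<ge> 0"
    proof (rule lap_nonneg_at_min[OF V C2_diff(1)[OF V c2(2,1)] wc])
      show "?f2 w - ?f1 w \<le> ?f2 z - ?f1 z" if "z \<in> ?V" for z
        using global[OF that] pos[OF k(1) that s] p1 p2 by (simp add: ln_divide_pos[symmetric])
    qed
    then have lap: "lap ?f2 w \<ge> lap ?f1 w" using C2_diff(2)[OF V c2(2,1) wc] by simp
    let ?D1 = "lap ?f1 w" and ?D2 = "lap ?f2 w" and ?E1 = "e1 (ch k) w s" and ?E2 = "e2 (ch k) w s"
    let ?d = "- ((?D2 * ?E1 - ?E2 * ?D1) / (?E1 * ?E1)) * exp (- (B + 1) * (s - a))
        + (1 - ?E2 / ?E1) * (- (B + 1) * exp (- (B + 1) * (s - a)))"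
    have "((\<lambda>t. ?\<Phi> k w t) has_real_derivative ?d) (at s within {a..b})"
    proof -
      have r: "((\<lambda>t. e2 (ch k) w t / e1 (ch k) w t) has_real_derivative (?D2 * ?E1 - ?E2 * ?D1) / (?E1 * ?E1))
          (at s within {a..b})"
        using p1 by (intro DERIV_divide log_diffusionD(5)[OF ld(1)[OF k(1)] wc s]
              log_diffusionD(5)[OF ld(2)[OF k(1)] wc s]) auto
      have "((\<lambda>t. 1 - e2 (ch k) w t / e1 (ch k) w t) has_real_derivative
          0 - (?D2 * ?E1 - ?E2 * ?D1) / (?E1 * ?E1)) (at s within {a..b})"
        by (rule DERIV_diff[OF DERIV_const r])
      moreover have "((\<lambda>t. exp (- (B + 1) * (t - a))) has_real_derivative
          - (B + 1) * exp (- (B + 1) * (s - a))) (at s within {a..b})"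
        by (auto intro!: derivative_eq_intros)
      ultimately show ?thesis
        by (rule DERIV_cong[OF DERIV_mult]) (simp add: mult.commute)
    qed
    \<comment> \<open>At this point \<open>1 - e2 / e1\<close> grows at rate at most
      \<open>B\<close> relative to itself; the additional 1 in the damping exponent makes the
      inequality strict.\<close>
    moreover have "?d < 0"
    proof -
      have "?D1 * (?E1 - ?E2) \<ge> - B * ?E1 * (?E1 - ?E2)"
        using B[OF k(1) w s] q p1 by (intro mult_right_mono) (auto simp: field_simps)
      moreover have "?D2 * ?E1 \<ge> ?D1 * ?E1" using lap p1 by simp
      ultimately have "?D2 * ?E1 - ?E2 * ?D1 \<ge> - B * ?E1 * (?E1 - ?E2)" by (simp add: algebra_simps)
      then have "- (?D2 * ?E1 - ?E2 * ?D1) \<le> (B * (1 - ?E2 / ?E1)) * (?E1 * ?E1)"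
        using p1 by (simp add: algebra_simps)
      then have "- ((?D2 * ?E1 - ?E2 * ?D1) / (?E1 * ?E1)) \<le> B * (1 - ?E2 / ?E1)"
        using p1 by (simp add: minus_divide_left pos_divide_le_eq)
      then have "?d \<le> B * (1 - ?E2 / ?E1) * exp (- (B + 1) * (s - a))
        + (1 - ?E2 / ?E1) * (- (B + 1) * exp (- (B + 1) * (s - a)))"
        by (intro add_right_mono mult_right_mono) auto
      also have "\<dots> = - ((1 - ?E2 / ?E1) * exp (- (B + 1) * (s - a)))" by (simp add: algebra_simps)
      also have "\<dots> < 0" using q by simp
      finally show ?thesis .
    qed
    \<comment> \<open>The derivative is taken within \<open>{a..b}\<close>, so \<open>s = b\<close>
      is allowed; since \<open>s > a\<close>, there are earlier times with a larger value.\<close>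
    ultimately obtain d where d: "d > 0" "\<And>h. h > 0 \<Longrightarrow> s - h \<in> {a..b} \<Longrightarrow> h < d \<Longrightarrow> ?\<Phi> k w s < ?\<Phi> k w (s - h)"
      using has_real_derivative_neg_dec_left by meson
    let ?h = "min (d / 2) (s - a)"
    have "?h > 0" "?h < d" "s - ?h \<in> {a..b}" using d(1) sa s by auto
    then have "?\<Phi> k w s < ?\<Phi> k w (s - ?h)" using d(2) by blast
    moreover have "?\<Phi> k w (s - ?h) \<le> ?\<Phi> k w s" using max k(1) w \<open>s - ?h \<in> {a..b}\<close> by blast
    ultimately show False by simp
  qed
  then have "?\<Phi> j z t \<le> \<eta>" using max[OF j z t] by linarith
  from mult_right_mono[OF this, of "exp ((B + 1) * (t - a))"]
  have "(1 - e2 (ch j) z t / e1 (ch j) z t) * (exp (- (B + 1) * (t - a)) * exp ((B + 1) * (t - a)))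
      \<le> \<eta> * exp ((B + 1) * (t - a))"
    by (simp only: mult.assoc exp_ge_zero simp_thms)
  moreover have "exp (- (B + 1) * (t - a)) * exp ((B + 1) * (t - a)) = 1"
    unfolding exp_add[symmetric] by (simp add: algebra_simps)
  ultimately have "1 - e2 (ch j) z t / e1 (ch j) z t \<le> \<eta> * exp ((B + 1) * (t - a))"
    by (simp only: mult_1_right)
  then have "(1 - e2 (ch j) z t / e1 (ch j) z t) * e1 (ch j) z t \<le> \<eta> * exp ((B + 1) * (t - a)) * e1 (ch j) z t"
    using pos(1)[OF j _ t, of z] z box_sub[OF j] by (intro mult_right_mono) auto
  then show ?thesis using pos(1)[OF j _ t, of z] z box_sub[OF j] by (auto simp: left_diff_distrib)
qed

text \<open>\<open>e2\<close> has no value at time 0, so the comparison starts at small times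
  \<open>a\<close> at which the relative defect is at most \<open>\<eta>\<close>. The defect is
  amplified by a factor bounded independently of \<open>a\<close>, and \<open>\<eta>\<close> is
  arbitrary.\<close>

lemma comparison:
  fixes B b :: real
  assumes e1: "conf_flow A {0..b} e1" and e2: "conf_flow A {0<..b} e2"
    and B: "\<And>j z t. j \<in> J \<Longrightarrow> z \<in> box_of j \<Longrightarrow> t \<in> {0..b} \<Longrightarrow>
        lap (\<lambda>w. ln (e1 (ch j) w t)) z \<ge> - B * e1 (ch j) z t"
    and init: "\<And>\<eta> \<tau>. \<eta> > 0 \<Longrightarrow> \<tau> > 0 \<Longrightarrow> \<exists>a\<in>{0<..<\<tau>}. \<forall>j\<in>J. \<forall>z\<in>box_of j.
        e1 (ch j) z a - e2 (ch j) z a \<le> \<eta> * e1 (ch j) z a"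
    and j: "j \<in> J" and z: "z \<in> box_of j" and t: "t \<in> {0<..b}"
  shows "e1 (ch j) z t \<le> e2 (ch j) z t"
proof -
  have zc: "z \<in> cdom (ch j)" using z box_sub j by blast
  have p1: "e1 (ch j) z t > 0"
    using e1 ch[OF j] log_diffusionD(2)[of "cdom (ch j)" "{0..b}" "e1 (ch j)" z t] zc t by (auto simp: conf_flow_def)
  \<comment> \<open>Bounds the amplification for every starting time \<open>a\<close>; the absolute
    value covers a negative \<open>B + 1\<close>.\<close>
  define C where "C = exp (\<bar>B + 1\<bar> * t) * e1 (ch j) z t"
  have C: "C > 0" using p1 by (simp add: C_def)
  have "e1 (ch j) z t - e2 (ch j) z t \<le> \<epsilon>" if "\<epsilon> > 0" for \<epsilon>
  proof -
    have "\<epsilon> / C > 0" using that C by simp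
    then obtain a where a: "a \<in> {0<..<t}" and i: "\<And>j z. j \<in> J \<Longrightarrow> z \<in> box_of j \<Longrightarrow>
        e1 (ch j) z a - e2 (ch j) z a \<le> \<epsilon> / C * e1 (ch j) z a"
      using init[of "\<epsilon> / C" t] t by auto
    have sub: "{a..b} \<subseteq> {0..b}" "{a..b} \<subseteq> {0<..b}" "t \<in> {a..b}" using a t by auto
    have "e1 (ch j) z t - e2 (ch j) z t \<le> \<epsilon> / C * exp ((B + 1) * (t - a)) * e1 (ch j) z t"
      by (rule comparison_from_time[OF conf_flow_subset[OF e1 sub(1)] conf_flow_subset[OF e2 sub(2)]
           less_imp_le[OF \<open>\<epsilon> / C > 0\<close>] B i j z sub(3)]) (use sub in auto)
    also have "\<dots> \<le> \<epsilon> / C * exp (\<bar>B + 1\<bar> * t) * e1 (ch j) z t"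
    proof -
      have "(B + 1) * (t - a) \<le> \<bar>B + 1\<bar> * t" using a by (intro mult_mono) auto
      then show ?thesis using \<open>\<epsilon> / C > 0\<close> p1 by (intro mult_right_mono mult_left_mono) auto
    qed
    also have "\<dots> = \<epsilon>" using C p1 by (simp add: C_def)
    finally show ?thesis .
  qed
  then show ?thesis by (metis diff_le_0_iff_le field_le_epsilon add_0)
qed

end

section \<open>Integration in the plane\<close>

text \<open>For an absolutely integrable function on a Borel set the gauge integral is a Lebesgue
  integral, which can be transported along a map that preserves \<open>lborel\<close>.\<close>

lemma integral_measure_iso:
  fixes \<phi> :: "'a::euclidean_space \<Rightarrow> 'b::euclidean_space" and f :: "'b \<Rightarrow> real"
  assumes \<phi>: "\<phi> \<in> borel_measurable borel" and distr: "distr lborel borel \<phi> = lborel"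
    and S: "S \<in> sets borel" and f: "set_integrable lborel S f"
  shows "integral S f = integral (\<phi> -` S) (\<lambda>x. f (\<phi> x))"
    and "set_integrable lborel (\<phi> -` S) (\<lambda>x. f (\<phi> x))"
proof -
  let ?g = "\<lambda>x. indicator S x *\<^sub>R f x"
  have g: "integrable lborel ?g" using f by (simp add: set_integrable_def)
  then have m: "?g \<in> borel_measurable borel" by auto
  have ind: "?g (\<phi> x) = indicator (\<phi> -` S) x *\<^sub>R f (\<phi> x)" for x
    by (simp add: indicator_def)
  have "integrable (distr lborel borel \<phi>) ?g" using g distr by simp
  then have "integrable lborel (\<lambda>x. ?g (\<phi> x))"
    using integrable_distr_eq[of \<phi> lborel borel ?g] \<phi> m by simp
  then show i: "set_integrable lborel (\<phi> -` S) (\<lambda>x. f (\<phi> x))"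
    unfolding set_integrable_def ind .
  have "integral S f = (LINT x|lborel. ?g x)"
    using set_borel_integral_eq_integral(2)[OF f] by (simp add: set_lebesgue_integral_def)
  also have "\<dots> = (LINT x|distr lborel borel \<phi>. ?g x)" by (simp only: distr)
  also have "\<dots> = (LINT x|lborel. ?g (\<phi> x))"
    using \<phi> m by (intro integral_distr) auto
  also have "\<dots> = integral (\<phi> -` S) (\<lambda>x. f (\<phi> x))"
    using set_borel_integral_eq_integral(2)[OF i] unfolding set_lebesgue_integral_def ind .
  finally show "integral S f = integral (\<phi> -` S) (\<lambda>x. f (\<phi> x))" .
qed

text \<open>Identifies the plane with \<open>real \<times> real\<close>, where Fubini is applied.
  Lebesgue measure is determined by its values on boxes.\<close>

lemma lborel_complex_prod: "distr lborel borel (\<lambda>p. Complex (fst p) (snd p)) = lborel"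
proof (rule lborel_eqI[symmetric])
  have m: "(\<lambda>p. Complex (fst p) (snd p)) \<in> borel_measurable (borel :: (real \<times> real) measure)"
    by (intro borel_measurable_continuous_onI continuous_intros)
  fix l u :: complex
  assume lu: "\<And>b. b \<in> Basis \<Longrightarrow> l \<bullet> b \<le> u \<bullet> b"
  have v: "(\<lambda>p. Complex (fst p) (snd p)) -` box l u = box (Re l, Im l) (Re u, Im u)"
  proof -
    have "p \<in> box (Re l, Im l) (Re u, Im u) \<longleftrightarrow>
        Re l < fst p \<and> fst p < Re u \<and> Im l < snd p \<and> snd p < Im u" for p :: "real \<times> real"
      by (cases p) (auto simp: box_def Basis_prod_def)
    then show ?thesis by (auto simp: in_box_complex_iff)
  qed
  have "Re l \<le> Re u" "Im l \<le> Im u" using lu[of 1] lu[of \<i>] by (auto simp: Basis_complex_def)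
  then show "emeasure (distr lborel borel (\<lambda>p. Complex (fst p) (snd p))) (box l u) = ennreal (\<Prod>b\<in>Basis. (u - l) \<bullet> b)"
    using m v by (simp add: emeasure_distr emeasure_lborel_box_eq Basis_prod_def
        Basis_complex_def prod.union_disjoint prod.reindex inj_on_def)
qed simp

text \<open>The corresponding identification with \<open>real^2\<close>, where the change of
  variables is carried out.\<close>

lemma lborel_complex_vec: "distr lborel borel (\<lambda>v :: real^2. Complex (v $ 1) (v $ 2)) = lborel"
proof (rule lborel_eqI[symmetric])
  have m: "(\<lambda>v :: real^2. Complex (v $ 1) (v $ 2)) \<in> borel_measurable borel"
    by (intro borel_measurable_continuous_onI continuous_intros)
  fix l u :: complex
  assume lu: "\<And>b. b \<in> Basis \<Longrightarrow> l \<bullet> b \<le> u \<bullet> b"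
  have v: "(\<lambda>v :: real^2. Complex (v $ 1) (v $ 2)) -` box l u = box (vector [Re l, Im l]) (vector [Re u, Im u])"
    by (auto simp: in_box_complex_iff mem_box_cart forall_2 vector_2)
  have le: "Re l \<le> Re u" "Im l \<le> Im u" using lu[of 1] lu[of \<i>] by (auto simp: Basis_complex_def)
  have "emeasure lborel (box (vector [Re l, Im l]) (vector [Re u, Im u]) :: (real^2) set)
      = ennreal (\<Prod>b\<in>Basis. (vector [Re u, Im u] - vector [Re l, Im l] :: real^2) \<bullet> b)"
    by (rule emeasure_lborel_box) (use le in \<open>auto simp: Basis_vec_def inner_axis forall_2 vector_2 UNIV_2\<close>)
  also have "(Basis :: (real^2) set) = {axis 1 1, axis 2 1}"
    by (auto simp: Basis_vec_def UNIV_2)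
  finally show "emeasure (distr lborel borel (\<lambda>v :: real^2. Complex (v $ 1) (v $ 2))) (box l u) = ennreal (\<Prod>b\<in>Basis. (u - l) \<bullet> b)"
    using m v by (simp add: emeasure_distr Basis_complex_def inner_axis vector_2 axis_eq_axis)
qed simp

lemma set_integrable_continuous_compact:
  fixes f :: "'a::euclidean_space \<Rightarrow> real"
  assumes "compact S" "continuous_on S f"
  shows "set_integrable lborel S f"
  using borel_integrable_compact[OF assms] by (simp add: set_integrable_def indicator_def of_bool_def if_distrib cong: if_cong)

lemma integral_complex_prod:
  fixes F :: "complex \<Rightarrow> real"
  assumes F: "continuous_on (cbox a b) F"
  shows "integral (cbox a b) F = integral (cbox (Re a, Im a) (Re b, Im b)) (\<lambda>p. F (Complex (fst p) (snd p)))"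
proof -
  have "(\<lambda>p. Complex (fst p) (snd p)) \<in> borel_measurable (borel :: (real \<times> real) measure)"
    by (intro borel_measurable_continuous_onI continuous_intros)
  moreover have "(\<lambda>p. Complex (fst p) (snd p)) -` cbox a b = cbox (Re a, Im a) (Re b, Im b)"
    by (auto simp: in_cbox_complex_iff)
  ultimately show ?thesis
    using integral_measure_iso(1)[OF _ lborel_complex_prod, of "cbox a b" F]
      set_integrable_continuous_compact[OF _ F] by simp
qed

lemma integral_complex_iterated:
  fixes F :: "complex \<Rightarrow> real"
  assumes F: "continuous_on (cbox a b) F"
  shows "integral (cbox a b) F = integral {Re a..Re b} (\<lambda>x. integral {Im a..Im b} (\<lambda>y. F (Complex x y)))"
    and "integral (cbox a b) F = integral {Im a..Im b} (\<lambda>y. integral {Re a..Re b} (\<lambda>x. F (Complex x y)))"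
proof -
  have c: "continuous_on (cbox (Re a, Im a) (Re b, Im b)) (\<lambda>p. F (Complex (fst p) (snd p)))"
    by (rule continuous_on_compose2[OF F]) (auto intro!: continuous_intros simp: in_cbox_complex_iff)
  show 1: "integral (cbox a b) F = integral {Re a..Re b} (\<lambda>x. integral {Im a..Im b} (\<lambda>y. F (Complex x y)))"
    using integral_prod_continuous[OF c] integral_complex_prod[OF F] by (simp add: case_prod_beta)
  have "continuous_on (cbox (Re a, Im a) (Re b, Im b)) (\<lambda>(x, y). F (Complex x y))"
    using c by (simp add: case_prod_beta)
  from integral_swap_continuous[OF this]
  have "integral {Re a..Re b} (\<lambda>x. integral {Im a..Im b} (\<lambda>y. F (Complex x y))) =
      integral {Im a..Im b} (\<lambda>y. integral {Re a..Re b} (\<lambda>x. F (Complex x y)))" by simp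
  then show "integral (cbox a b) F = integral {Im a..Im b} (\<lambda>y. integral {Re a..Re b} (\<lambda>x. F (Complex x y)))"
    using 1 by simp
qed

text \<open>The Jacobian of a holomorphic map: multiplication by \<open>c\<close> is a rotation
  followed by scaling with the modulus of \<open>c\<close>.\<close>

lemma det_complex_mult:
  "det (matrix (\<lambda>v :: real^2. vector [Re (c * Complex (v $ 1) (v $ 2)), Im (c * Complex (v $ 1) (v $ 2))] :: real^2))
     = (norm c)\<^sup>2"
  unfolding cmod_power2 by (simp add: det_2 matrix_def axis_def vector_2 power2_eq_square)

text \<open>The map is conjugated to \<open>real^2\<close>, where its derivative is the matrix of
  multiplication by \<open>T'\<close>. The set \<open>S\<close> is only compact, hence derivatives
  within \<open>S\<close>.\<close>

lemma integral_holomorphic_change_of_variables: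
  fixes f :: "complex \<Rightarrow> real"
  assumes S: "compact S" and T: "\<And>z. z \<in> S \<Longrightarrow> (T has_field_derivative T' z) (at z within S)"
    and T': "continuous_on S T'" and inj: "inj_on T S" and f: "continuous_on (T ` S) f"
  shows "integral (T ` S) f = integral S (\<lambda>z. (norm (T' z))\<^sup>2 * f (T z))"
    and "(\<lambda>z. (norm (T' z))\<^sup>2 * f (T z)) integrable_on S"
proof -
  let ?v = "\<lambda>v :: real^2. Complex (v $ 1) (v $ 2)"
  let ?w = "\<lambda>z. vector [Re z, Im z] :: real^2"
  have vw: "?v (?w z) = z" "?w (?v x) = x" for z x
    by (auto simp: vector_2 vec_eq_iff forall_2)
  have vm: "?v \<in> borel_measurable borel"
    by (intro borel_measurable_continuous_onI continuous_intros)
  have wd: "(?w has_derivative ?w) (at z within U)" for z U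
  proof -
    have "linear ?w"
      by (rule linearI) (auto simp: vec_eq_iff forall_2 vector_2)
    then show ?thesis by (rule linear_imp_has_derivative)
  qed
  have vd: "(?v has_derivative ?v) (at z within U)" for z U
  proof -
    have "linear ?v"
      by (rule linearI) (auto simp: complex_eq_iff)
    then show ?thesis by (rule linear_imp_has_derivative)
  qed
  have vS: "?v -` U = ?w ` U" for U
  proof
    show "?v -` U \<subseteq> ?w ` U"
      using vw(2) by (metis (no_types, lifting) imageI subsetI vimage_eq)
    show "?w ` U \<subseteq> ?v -` U" using vw(1) by auto
  qed
  have cT: "continuous_on S T"
    using T by (meson continuous_on_eq_continuous_within DERIV_continuous)
  have TS: "compact (T ` S)" using compact_continuous_image[OF cT S] .
  have cw: "continuous_on U ?w" for U
    by (rule has_derivative_continuous_on[OF wd])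
  let ?S = "?v -` S"
  have cS: "compact ?S" unfolding vS by (rule compact_continuous_image[OF cw S])
  let ?g = "\<lambda>x. ?w (T (?v x))"
  have img: "?g ` ?S = ?v -` (T ` S)"
    unfolding vS by (auto simp: image_image vw)
  have d: "(?g has_derivative (\<lambda>h. ?w (T' (?v x) * ?v h))) (at x within ?S)" if "x \<in> ?S" for x
  proof -
    have "(T has_derivative (*) (T' (?v x))) (at (?v x) within S)"
      using T[of "?v x"] that by (simp add: has_field_derivative_def)
    then have "(T has_derivative (*) (T' (?v x))) (at (?v x) within ?v ` ?S)"
      by (rule has_derivative_subset) auto
    from has_derivative_in_compose[OF vd this]
    have "((\<lambda>x. T (?v x)) has_derivative (\<lambda>h. T' (?v x) * ?v h)) (at x within ?S)" .
    then show ?thesis by (rule has_derivative_compose[OF _ wd])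
  qed
  have inj': "inj_on ?g ?S"
  proof (rule inj_onI)
    fix x y assume xy: "x \<in> ?S" "y \<in> ?S" "?g x = ?g y"
    have "T (?v x) = T (?v y)" using arg_cong[OF xy(3), of ?v] by (simp only: vw)
    then have "?v x = ?v y" using inj xy(1,2) by (simp only: vimage_eq inj_on_eq_iff)
    from arg_cong[OF this, of ?w] show "x = y" by (simp only: vw)
  qed
  have fi: "set_integrable lborel (T ` S) f" using set_integrable_continuous_compact[OF TS f] .
  note iso1 = integral_measure_iso[OF vm lborel_complex_vec borel_compact[OF TS] fi]
  define h where "h = (\<lambda>z. (norm (T' z))\<^sup>2 * f (T z))"
  have hc: "continuous_on S h"
    unfolding h_def using T' by (intro continuous_intros continuous_on_compose2[OF f cT]) auto
  have hi: "set_integrable lborel S h" using set_integrable_continuous_compact[OF S hc] .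
  then show "(\<lambda>z. (norm (T' z))\<^sup>2 * f (T z)) integrable_on S"
    unfolding h_def by (rule set_borel_integral_eq_integral(1))
  note iso2 = integral_measure_iso[OF vm lborel_complex_vec borel_compact[OF S] hi]
  \<comment> \<open>The scalar integrand is wrapped as a vector with one entry to fit the
    vector-valued form of the change of variables formula.\<close>
  define F :: "real^2 \<Rightarrow> real^1" where "F = (\<lambda>x. vec (f (?v x)))"
  have "(\<lambda>x. f (?v x)) absolutely_integrable_on (?v -` (T ` S))"
    using set_borel_integral_eq_integral(1)[OF iso1(2)]
      set_borel_integral_eq_integral(1)[OF set_integrable_abs[OF iso1(2)]]
    by (simp add: absolutely_integrable_on_def)
  then have FI: "F absolutely_integrable_on (?g ` ?S)"
    unfolding F_def img absolutely_integrable_on_1_iff by simp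
  have "integral (?g ` ?S) F = integral ?S (\<lambda>x. \<bar>det (matrix (\<lambda>h. ?w (T' (?v x) * ?v h)))\<bar> *\<^sub>R F (?g x))"
    by (rule integral_change_of_variables[OF _ d inj']) (use FI cS in \<open>auto intro: lmeasurable_compact fmeasurableD\<close>)
  also have "\<dots> = integral ?S (\<lambda>x. vec (h (?v x)))"
    unfolding det_complex_mult by (rule integral_cong) (simp only: F_def h_def vw(1), simp add: vec_eq_iff)
  finally have "integral (T ` S) f = integral S h"
    unfolding img F_def integral_on_1_eq iso1(1) iso2(1) by (simp add: vec_eq_iff)
  then show "integral (T ` S) f = integral S (\<lambda>z. (norm (T' z))\<^sup>2 * f (T z))" by (simp add: h_def)
qed


section \<open>Polynomial bump functions and integration by parts on a square\<close>

definition bump1 :: "real \<Rightarrow> real \<Rightarrow> real" where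
  "bump1 r s = (r\<^sup>2 - s\<^sup>2)\<^sup>2"

definition bump1_dd :: "real \<Rightarrow> real \<Rightarrow> real" where
  "bump1_dd r s = 12 * s\<^sup>2 - 4 * r\<^sup>2"

text \<open>Each factor vanishes together with its first derivative at the edges, so two
  integrations by parts leave no boundary terms, although the polynomial does not vanish outside the
  square.\<close>

definition bump :: "complex \<Rightarrow> real \<Rightarrow> complex \<Rightarrow> real" where
  "bump z0 r z = bump1 r (Re z - Re z0) * bump1 r (Im z - Im z0)"

definition bump_lap :: "complex \<Rightarrow> real \<Rightarrow> complex \<Rightarrow> real" where
  "bump_lap z0 r z = bump1_dd r (Re z - Re z0) * bump1 r (Im z - Im z0)
     + bump1 r (Re z - Re z0) * bump1_dd r (Im z - Im z0)"

lemma continuous_on_bump [continuous_intros]: "continuous_on S (bump z0 r)" "continuous_on S (bump_lap z0 r)"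
  unfolding bump_def bump_lap_def bump1_def bump1_dd_def by (intro continuous_intros)+

lemma bump_nonneg: "0 \<le> bump z0 r z"
  by (simp add: bump_def bump1_def)

lemma bump_ge_half:
  assumes "z \<in> sq z0 (r / 2)"
  shows "bump z0 r z \<ge> (r\<^sup>2 / 2) ^ 4"
proof -
  have "bump1 r s \<ge> (r\<^sup>2 / 2)\<^sup>2" if "\<bar>s\<bar> \<le> r / 2" for s
  proof -
    have "s\<^sup>2 \<le> (r / 2)\<^sup>2" using that by (simp add: abs_le_square_iff[symmetric])
    then have "s\<^sup>2 \<le> r\<^sup>2 / 4" by (simp add: power_divide)
    \<comment> \<open>The difference is in fact at least three quarters of the square of
      \<open>r\<close>; one half is a convenient smaller bound.\<close>
    then have "r\<^sup>2 / 2 \<le> r\<^sup>2 - s\<^sup>2" using zero_le_power2[of s] by linarith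
    then show ?thesis unfolding bump1_def by (intro power_mono) auto
  qed
  then have "bump z0 r z \<ge> (r\<^sup>2 / 2)\<^sup>2 * (r\<^sup>2 / 2)\<^sup>2"
    unfolding bump_def using assms by (intro mult_mono) (auto simp: mem_sq bump1_def)
  then show ?thesis by (simp flip: power_add)
qed

text \<open>With \<open>\<phi>\<close> the bump, the difference of the integrands is the derivative
  of \<open>\<phi> f' - \<phi>' f\<close>, which is zero at both ends.\<close>

lemma integral_bump1:
  fixes f f' f'' :: "real \<Rightarrow> real"
  assumes r: "r \<ge> 0"
    and f': "\<And>x. x \<in> {c - r..c + r} \<Longrightarrow> (f has_real_derivative f' x) (at x)"
    and f'': "\<And>x. x \<in> {c - r..c + r} \<Longrightarrow> (f' has_real_derivative f'' x) (at x)"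
    and cont: "continuous_on {c - r..c + r} f''"
  shows "integral {c - r..c + r} (\<lambda>x. bump1 r (x - c) * f'' x) = integral {c - r..c + r} (\<lambda>x. bump1_dd r (x - c) * f x)"
proof -
  let ?I = "{c - r..c + r}"
  let ?G = "\<lambda>x. bump1 r (x - c) * f' x + 4 * (x - c) * (r\<^sup>2 - (x - c)\<^sup>2) * f x"
  have "((\<lambda>x. bump1 r (x - c) * f'' x - bump1_dd r (x - c) * f x) has_integral ?G (c + r) - ?G (c - r)) ?I"
  proof (rule fundamental_theorem_of_calculus)
    show "(?G has_vector_derivative bump1 r (x - c) * f'' x - bump1_dd r (x - c) * f x) (at x within ?I)"
      if "x \<in> ?I" for x
      unfolding has_real_derivative_iff_has_vector_derivative[symmetric] bump1_def bump1_dd_def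
      by (rule derivative_eq_intros DERIV_subset[OF f'[OF that]] DERIV_subset[OF f''[OF that]] refl subset_UNIV)+
        (simp add: algebra_simps power2_eq_square)
  qed (use r in simp)
  then have 0: "integral ?I (\<lambda>x. bump1 r (x - c) * f'' x - bump1_dd r (x - c) * f x) = 0"
    by (simp add: bump1_def integral_unique)
  have "continuous_on ?I f"
    using f' by (meson DERIV_isCont continuous_at_imp_continuous_on)
  then have "(\<lambda>x. bump1 r (x - c) * f'' x) integrable_on ?I" "(\<lambda>x. bump1_dd r (x - c) * f x) integrable_on ?I"
    unfolding bump1_def bump1_dd_def
    using cont by (auto intro!: integrable_continuous_real continuous_intros)
  from integral_diff[OF this] 0 show ?thesis by simp
qed

lemma C2_lines:
  assumes "C2 V f" "Complex x y \<in> V"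
  shows "((\<lambda>x. f (Complex x y)) has_real_derivative pd 1 f (Complex x y)) (at x)"
    and "((\<lambda>x. pd 1 f (Complex x y)) has_real_derivative pd 1 (pd 1 f) (Complex x y)) (at x)"
    and "((\<lambda>y. f (Complex x y)) has_real_derivative pd 2 f (Complex x y)) (at y)"
    and "((\<lambda>y. pd 2 f (Complex x y)) has_real_derivative pd 2 (pd 2 f) (Complex x y)) (at y)"
proof -
  have 1: "Complex x y + of_real s * dir 1 = Complex (s + x) y" for s
    by (simp add: dir_def complex_eq_iff)
  have 2: "Complex x y + of_real s * dir 2 = Complex x (s + y)" for s
    by (simp add: dir_def complex_eq_iff)
  have d: "((\<lambda>s. f (Complex x y + of_real s * dir i)) has_real_derivative pd i f (Complex x y)) (at 0)"
    "((\<lambda>s. pd i f (Complex x y + of_real s * dir i)) has_real_derivative pd i (pd i f) (Complex x y)) (at 0)" for i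
    using assms by (auto simp: C2_def)
  show "((\<lambda>x. f (Complex x y)) has_real_derivative pd 1 f (Complex x y)) (at x)"
    using d(1)[of 1] DERIV_shift[of "\<lambda>x. f (Complex x y)" _ 0 x] unfolding 1 by simp
  show "((\<lambda>x. pd 1 f (Complex x y)) has_real_derivative pd 1 (pd 1 f) (Complex x y)) (at x)"
    using d(2)[of 1] DERIV_shift[of "\<lambda>x. pd 1 f (Complex x y)" _ 0 x] unfolding 1 by simp
  show "((\<lambda>y. f (Complex x y)) has_real_derivative pd 2 f (Complex x y)) (at y)"
    using d(1)[of 2] DERIV_shift[of "\<lambda>y. f (Complex x y)" _ 0 y] unfolding 2 by simp
  show "((\<lambda>y. pd 2 f (Complex x y)) has_real_derivative pd 2 (pd 2 f) (Complex x y)) (at y)"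
    using d(2)[of 2] DERIV_shift[of "\<lambda>y. pd 2 f (Complex x y)" _ 0 y] unfolding 2 by simp
qed

text \<open>Green's formula without boundary terms: for each of the two second partials the
  integration order is chosen so that its own variable is innermost, and the other bump factor is
  then a constant.\<close>

lemma integral_bump_lap:
  assumes r: "r \<ge> 0" and sub: "sq z0 r \<subseteq> V" and f: "C2 V f"
  shows "integral (sq z0 r) (\<lambda>z. bump z0 r z * lap f z) = integral (sq z0 r) (\<lambda>z. bump_lap z0 r z * f z)"
proof -
  let ?a = "z0 - Complex r r" and ?b = "z0 + Complex r r"
  let ?\<xi> = "\<lambda>z. bump1 r (Re z - Re z0)" and ?\<eta> = "\<lambda>z. bump1 r (Im z - Im z0)"
  let ?\<xi>2 = "\<lambda>z. bump1_dd r (Re z - Re z0)" and ?\<eta>2 = "\<lambda>z. bump1_dd r (Im z - Im z0)"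
  have "continuous_on V f" "continuous_on V (pd i (pd i f))" for i using f by (auto simp: C2_def)
  then have c [continuous_intros]: "continuous_on (cbox ?a ?b) f" "continuous_on (cbox ?a ?b) (pd i (pd i f))" for i
    using sub continuous_on_subset unfolding sq_def by blast+
  have cb [continuous_intros]: "continuous_on S ?\<xi>" "continuous_on S ?\<eta>" "continuous_on S ?\<xi>2" "continuous_on S ?\<eta>2" for S
    unfolding bump1_def bump1_dd_def by (intro continuous_intros)+
  have mem: "Complex x y \<in> cbox ?a ?b \<longleftrightarrow> x \<in> {Re z0 - r..Re z0 + r} \<and> y \<in> {Im z0 - r..Im z0 + r}" for x y
    by (auto simp: in_cbox_complex_iff)
  have V: "Complex x y \<in> V" if "x \<in> {Re z0 - r..Re z0 + r}" "y \<in> {Im z0 - r..Im z0 + r}" for x y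
    using sub mem that unfolding sq_def by blast
  have lx: "continuous_on {Re z0 - r..Re z0 + r} (\<lambda>x. pd i (pd i f) (Complex x y))" if "y \<in> {Im z0 - r..Im z0 + r}" for i y
    by (rule continuous_on_compose2[OF c(2)]) (use mem that in \<open>auto intro!: continuous_intros\<close>)
  have ly: "continuous_on {Im z0 - r..Im z0 + r} (\<lambda>y. pd i (pd i f) (Complex x y))" if "x \<in> {Re z0 - r..Re z0 + r}" for i x
    by (rule continuous_on_compose2[OF c(2)]) (use mem that in \<open>auto intro!: continuous_intros\<close>)
  have 1: "integral (cbox ?a ?b) (\<lambda>z. ?\<eta> z * (?\<xi> z * pd 1 (pd 1 f) z)) = integral (cbox ?a ?b) (\<lambda>z. ?\<eta> z * (?\<xi>2 z * f z))"
  proof -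
    have "integral {Im z0 - r..Im z0 + r} (\<lambda>y. integral {Re z0 - r..Re z0 + r} (\<lambda>x. bump1 r (y - Im z0) * (bump1 r (x - Re z0) * pd 1 (pd 1 f) (Complex x y))))
      = integral {Im z0 - r..Im z0 + r} (\<lambda>y. integral {Re z0 - r..Re z0 + r} (\<lambda>x. bump1 r (y - Im z0) * (bump1_dd r (x - Re z0) * f (Complex x y))))"
    proof (rule integral_cong)
      fix y assume y: "y \<in> {Im z0 - r..Im z0 + r}"
      show "integral {Re z0 - r..Re z0 + r} (\<lambda>x. bump1 r (y - Im z0) * (bump1 r (x - Re z0) * pd 1 (pd 1 f) (Complex x y)))
        = integral {Re z0 - r..Re z0 + r} (\<lambda>x. bump1 r (y - Im z0) * (bump1_dd r (x - Re z0) * f (Complex x y)))"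
        using integral_bump1[OF r C2_lines(1,2)[OF f V[OF _ y]] lx[OF y]] by simp
    qed
    then show ?thesis
      by (subst (1 2) integral_complex_iterated(2)) (auto intro!: continuous_intros)
  qed
  have 2: "integral (cbox ?a ?b) (\<lambda>z. ?\<xi> z * (?\<eta> z * pd 2 (pd 2 f) z)) = integral (cbox ?a ?b) (\<lambda>z. ?\<xi> z * (?\<eta>2 z * f z))"
  proof -
    have "integral {Re z0 - r..Re z0 + r} (\<lambda>x. integral {Im z0 - r..Im z0 + r} (\<lambda>y. bump1 r (x - Re z0) * (bump1 r (y - Im z0) * pd 2 (pd 2 f) (Complex x y))))
      = integral {Re z0 - r..Re z0 + r} (\<lambda>x. integral {Im z0 - r..Im z0 + r} (\<lambda>y. bump1 r (x - Re z0) * (bump1_dd r (y - Im z0) * f (Complex x y))))"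
    proof (rule integral_cong)
      fix x assume x: "x \<in> {Re z0 - r..Re z0 + r}"
      show "integral {Im z0 - r..Im z0 + r} (\<lambda>y. bump1 r (x - Re z0) * (bump1 r (y - Im z0) * pd 2 (pd 2 f) (Complex x y)))
        = integral {Im z0 - r..Im z0 + r} (\<lambda>y. bump1 r (x - Re z0) * (bump1_dd r (y - Im z0) * f (Complex x y)))"
        using integral_bump1[OF r C2_lines(3,4)[OF f V[OF x]] ly[OF x]] by simp
    qed
    then show ?thesis
      by (subst (1 2) integral_complex_iterated(1)) (auto intro!: continuous_intros)
  qed
  have "integral (cbox ?a ?b) (\<lambda>z. bump z0 r z * lap f z) =
      integral (cbox ?a ?b) (\<lambda>z. ?\<eta> z * (?\<xi> z * pd 1 (pd 1 f) z) + ?\<xi> z * (?\<eta> z * pd 2 (pd 2 f) z))"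
    by (simp add: bump_def lap_def algebra_simps)
  also have "\<dots> = integral (cbox ?a ?b) (\<lambda>z. ?\<eta> z * (?\<xi> z * pd 1 (pd 1 f) z)) + integral (cbox ?a ?b) (\<lambda>z. ?\<xi> z * (?\<eta> z * pd 2 (pd 2 f) z))"
    by (rule integral_add) (intro integrable_continuous continuous_intros)+
  also have "\<dots> = integral (cbox ?a ?b) (\<lambda>z. ?\<eta> z * (?\<xi>2 z * f z)) + integral (cbox ?a ?b) (\<lambda>z. ?\<xi> z * (?\<eta>2 z * f z))"
    unfolding 1 2 ..
  also have "\<dots> = integral (cbox ?a ?b) (\<lambda>z. ?\<eta> z * (?\<xi>2 z * f z) + ?\<xi> z * (?\<eta>2 z * f z))"
    by (rule integral_add[symmetric]) (intro integrable_continuous continuous_intros)+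
  also have "\<dots> = integral (cbox ?a ?b) (\<lambda>z. bump_lap z0 r z * f z)"
    by (simp add: bump_lap_def algebra_simps)
  finally show ?thesis by (simp add: sq_def)
qed

section \<open>Domination of the truncated flows\<close>

text \<open>Here \<open>e0\<close> is the initial density, \<open>e'\<close> the competitor,
  \<open>e\<close> the constructed flow and \<open>G k\<close> the truncated flows. By
  \<open>bad\<close> a puncture can meet a square only at its centre, so that removing a small ball
  leaves a compact set on which convergence to \<open>e0\<close> is uniform. \<open>e'_curv\<close>
  expresses that the curvature of \<open>e'\<close> is at least \<open>- B / 2\<close>.\<close>

locale cusp_flows = boxed_surface X A J ch ctr rad
  for X :: "'a topology" and A J ch ctr rad +
  fixes P :: "'a set" and e0 :: "'a coord \<Rightarrow> complex \<Rightarrow> real"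
    and e' e :: "'a coord \<Rightarrow> complex \<Rightarrow> real \<Rightarrow> real"
    and G :: "nat \<Rightarrow> 'a coord \<Rightarrow> complex \<Rightarrow> real \<Rightarrow> real"
    and \<delta> T B :: real
  assumes bad: "\<And>j. j \<in> J \<Longrightarrow> snd (ch j) ` (fst (ch j) \<inter> P) \<inter> box_of j \<subseteq> {ctr j}"
    and e0_cont: "\<And>j. j \<in> J \<Longrightarrow> continuous_on (cdom (ch j) - snd (ch j) ` (fst (ch j) \<inter> P)) (e0 (ch j))"
    and e0_cusp: "\<And>j. j \<in> J \<Longrightarrow> ctr j \<in> snd (ch j) ` (fst (ch j) \<inter> P) \<Longrightarrow> filterlim (e0 (ch j)) at_top (at (ctr j))"
    and \<delta>: "0 < \<delta>" "\<delta> \<le> T"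
    and e'_flow: "conf_flow A {0<..<\<delta>} e'"
    and e'_lim: "\<And>j K. j \<in> J \<Longrightarrow> compact K \<Longrightarrow> K \<subseteq> cdom (ch j) - snd (ch j) ` (fst (ch j) \<inter> P) \<Longrightarrow>
        uniform_limit K (\<lambda>t z. e' (ch j) z t) (e0 (ch j)) (at_right 0)"
    and B: "B > 0" and e'_curv: "\<And>j z t. j \<in> J \<Longrightarrow> z \<in> cdom (ch j) \<Longrightarrow> t \<in> {0<..<\<delta>} \<Longrightarrow>
        lap (\<lambda>w. ln (e' (ch j) w t)) z \<le> B * e' (ch j) z t"
    and e_flow: "conf_flow A {0<..T} e"
    and e_lim: "\<And>j K. j \<in> J \<Longrightarrow> compact K \<Longrightarrow> K \<subseteq> cdom (ch j) - snd (ch j) ` (fst (ch j) \<inter> P) \<Longrightarrow>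
        uniform_limit K (\<lambda>t z. e (ch j) z t) (e0 (ch j)) (at_right 0)"
    and G_flow: "\<And>k. k \<ge> 1 \<Longrightarrow> conf_flow A {0..T} (G k)"
    and G_init: "\<And>k j z. k \<ge> 1 \<Longrightarrow> j \<in> J \<Longrightarrow> z \<in> cdom (ch j) - snd (ch j) ` (fst (ch j) \<inter> P) \<Longrightarrow>
        G k (ch j) z 0 \<le> e0 (ch j) z"
    and G_mono: "\<And>k j z. k \<ge> 1 \<Longrightarrow> j \<in> J \<Longrightarrow> z \<in> cdom (ch j) \<Longrightarrow> G 1 (ch j) z 0 \<le> G k (ch j) z 0"
    and G_lim: "\<And>j z t. j \<in> J \<Longrightarrow> z \<in> cdom (ch j) \<Longrightarrow> t \<in> {0<..T} \<Longrightarrow> (\<lambda>k. G k (ch j) z t) \<longlonglongrightarrow> e (ch j) z t"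
begin

definition cusps :: "'a \<Rightarrow> complex set" where
  "cusps j = snd (ch j) ` (fst (ch j) \<inter> P)"

abbreviation regular :: "'a \<Rightarrow> complex set" where
  "regular j \<equiv> cdom (ch j) - cusps j"

lemma box_minus_ball_regular:
  assumes "j \<in> J" "\<rho> > 0"
  shows "box_of j - ball (ctr j) \<rho> \<subseteq> regular j"
  using bad[OF assms(1)] box_sub[OF assms(1)] assms(2) by (force simp: cusps_def)

lemma e'_log: "j \<in> J \<Longrightarrow> log_diffusion (cdom (ch j)) {0<..<\<delta>} (e' (ch j))"
  using e'_flow ch by (auto simp: conf_flow_def)

lemma e_log: "j \<in> J \<Longrightarrow> log_diffusion (cdom (ch j)) {0<..T} (e (ch j))"
  using e_flow ch by (auto simp: conf_flow_def)

lemma G_log: "k \<ge> 1 \<Longrightarrow> j \<in> J \<Longrightarrow> log_diffusion (cdom (ch j)) {0..T} (G k (ch j))"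
  using G_flow ch by (auto simp: conf_flow_def)

lemma e'_pos: "j \<in> J \<Longrightarrow> z \<in> cdom (ch j) \<Longrightarrow> t \<in> {0<..<\<delta>} \<Longrightarrow> e' (ch j) z t > 0"
  using log_diffusionD(2)[OF e'_log] .

lemma cball_box:
  assumes "j \<in> J" "\<rho> \<le> rad j"
  shows "cball (ctr j) \<rho> \<subseteq> box_of j"
proof
  fix z assume "z \<in> cball (ctr j) \<rho>"
  then have n: "norm (z - ctr j) \<le> \<rho>" by (simp add: dist_norm norm_minus_commute)
  have "\<bar>Re (z - ctr j)\<bar> \<le> norm (z - ctr j)" "\<bar>Im (z - ctr j)\<bar> \<le> norm (z - ctr j)"
    by (rule abs_Re_le_cmod, rule abs_Im_le_cmod)
  then show "z \<in> box_of j" using n assms(2) by (simp add: mem_sq)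
qed

text \<open>The barrier is \<open>M exp (\<alpha> |z|\<^sup>2)\<close> with \<open>\<alpha> = B M\<close>: by the curvature bound the density exceeds \<open>4 M\<close>
  at an interior minimum of the quotient.\<close>

lemma large_near_cusp:
  assumes j: "j \<in> J" and c: "ctr j \<in> cusps j" and M: "M > 0"
  obtains \<rho> \<tau> where "\<rho> > 0" "\<tau> > 0" "\<tau> \<le> \<delta>"
    "\<And>z t. z \<in> ball (ctr j) \<rho> \<Longrightarrow> t \<in> {0<..<\<tau>} \<Longrightarrow> e' (ch j) z t \<ge> M"
proof -
  let ?z0 = "ctr j" and ?V = "cdom (ch j)"
  define \<alpha> where "\<alpha> = B * M"
  have \<alpha>: "\<alpha> > 0" using B M by (simp add: \<alpha>_def)
  have "\<forall>\<^sub>F z in at ?z0. e0 (ch j) z \<ge> 5 * M"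
    using e0_cusp[OF j] c by (auto simp: filterlim_at_top cusps_def)
  \<comment> \<open>The level \<open>5 * M\<close> leaves a margin \<open>M\<close> for the
    convergence to \<open>e0\<close>: on the bounding circle \<open>e'\<close> is still at least
    \<open>4 * M\<close>.\<close>
  then obtain d where d: "d > 0" "\<And>z. z \<noteq> ?z0 \<Longrightarrow> dist z ?z0 < d \<Longrightarrow> e0 (ch j) z \<ge> 5 * M"
    by (auto simp: eventually_at)
  \<comment> \<open>The square root ensures \<open>\<alpha> |z|^2 \<le> 1\<close>, so that the
    barrier is at most \<open>4 * M\<close> on the disc; the other bounds keep the disc inside the
    square and \<open>e0\<close> large on its boundary.\<close>
  define \<rho> where "\<rho> = min (min (d / 2) (rad j)) (sqrt (1 / \<alpha>))"
  have \<rho>: "\<rho> > 0" "\<rho> < d" "\<rho> \<le> rad j" "\<alpha> * \<rho>\<^sup>2 \<le> 1"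
  proof -
    show p: "\<rho> > 0" "\<rho> < d" "\<rho> \<le> rad j" using d rad[OF j] \<alpha> by (auto simp: \<rho>_def)
    have "\<rho> \<le> sqrt (1 / \<alpha>)" by (simp add: \<rho>_def)
    then have "\<rho>\<^sup>2 \<le> 1 / \<alpha>" using p(1) \<alpha> by (metis less_eq_real_def real_le_rsqrt real_sqrt_le_iff real_sqrt_pow2_iff real_sqrt_unique sqrt_le_D zero_le_divide_1_iff)
    then show "\<alpha> * \<rho>\<^sup>2 \<le> 1" using \<alpha> by (simp add: field_simps)
  qed
  have exp3: "exp (\<alpha> * (norm (z - ?z0))\<^sup>2) \<le> 4" if "norm (z - ?z0) \<le> \<rho>" for z
  proof -
    have "(norm (z - ?z0))\<^sup>2 \<le> \<rho>\<^sup>2" using that by (intro power_mono) auto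
    then have "\<alpha> * (norm (z - ?z0))\<^sup>2 \<le> \<alpha> * \<rho>\<^sup>2" using \<alpha> by (intro mult_left_mono) auto
    then have "exp (\<alpha> * (norm (z - ?z0))\<^sup>2) \<le> exp 1" using \<rho>(4) by (simp only: exp_le_cancel_iff)
    then show ?thesis using exp_le by linarith
  qed
  have cb: "cball ?z0 \<rho> \<subseteq> ?V" using cball_box[OF j \<rho>(3)] box_sub[OF j] by blast
  have "sphere ?z0 \<rho> \<subseteq> box_of j - ball ?z0 \<rho>"
    using cball_box[OF j \<rho>(3)] by auto
  then have K: "sphere ?z0 \<rho> \<subseteq> regular j"
    using box_minus_ball_regular[OF j \<rho>(1)] by blast
  have "\<forall>\<^sub>F t in at_right 0. \<forall>z\<in>sphere ?z0 \<rho>. dist (e' (ch j) z t) (e0 (ch j) z) < M"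
    using uniform_limitD[OF e'_lim[OF j compact_sphere K[unfolded cusps_def]] M] .
  then obtain b where b: "b > 0" "\<And>t z. 0 < t \<Longrightarrow> t < b \<Longrightarrow> z \<in> sphere ?z0 \<rho> \<Longrightarrow> dist (e' (ch j) z t) (e0 (ch j) z) < M"
    by (auto simp: eventually_at_right_field)
  have main: "e' (ch j) z t \<ge> M" if z: "z \<in> ball ?z0 \<rho>" and t: "t \<in> {0<..<min b \<delta>}" for z t
  proof -
    have t': "t \<in> {0<..<\<delta>}" using t by auto
    have pos: "e' (ch j) z t > 0" if "z \<in> ?V" for z using e'_pos[OF j that t'] .
    let ?f = "\<lambda>z. ln (e' (ch j) z t)" and ?v = "\<lambda>z. ln M + \<alpha> * (norm (z - ?z0))\<^sup>2"
    let ?\<phi> = "\<lambda>z. ?f z - ?v z"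
    have f: "C2 ?V ?f" using C2_ln(1)[OF open_cdom[OF j] log_diffusionD(3)[OF e'_log[OF j] t']] pos by blast
    have v: "C2 ?V ?v" using C2_mono[OF C2_quadratic(1)] by blast
    have \<phi>: "C2 ?V ?\<phi>" using C2_diff(1)[OF open_cdom[OF j] f v] .
    then have "continuous_on (cball ?z0 \<rho>) ?\<phi>" using cb continuous_on_subset by (auto simp: C2_def)
    moreover have "cball ?z0 \<rho> \<noteq> {}" using \<rho> by auto
    ultimately obtain w where w: "w \<in> cball ?z0 \<rho>" and min: "\<And>z. z \<in> cball ?z0 \<rho> \<Longrightarrow> ?\<phi> w \<le> ?\<phi> z"
      using continuous_attains_inf[OF compact_cball, of ?z0 \<rho> ?\<phi>] by blast
    have wV: "w \<in> ?V" using w cb by auto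
    have "e' (ch j) w t \<ge> 4 * M"
    proof (cases "w \<in> ball ?z0 \<rho>")
      case True
      have "lap ?\<phi> w \<ge> 0"
        by (rule lap_nonneg_at_min[OF open_ball C2_mono[OF \<phi>] True]) (use cb min in auto)
      then have "lap ?f w \<ge> 4 * \<alpha>"
        using C2_diff(2)[OF open_cdom[OF j] f v wV] C2_quadratic(2) by simp
      then have "4 * (B * M) \<le> B * e' (ch j) w t" using e'_curv[OF j wV t'] by (simp add: \<alpha>_def)
      then show ?thesis using B by (simp add: mult.left_commute)
    next
      case False
      then have ws: "w \<in> sphere ?z0 \<rho>" using w by auto
      then have "e0 (ch j) w \<ge> 5 * M" using d(2)[of w] \<rho> by (auto simp: dist_commute)
      moreover have "dist (e' (ch j) w t) (e0 (ch j) w) < M" using b(2)[OF _ _ ws] t by auto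
      ultimately show ?thesis by (simp add: dist_real_def abs_if split: if_splits)
    qed
    moreover have "M * exp (\<alpha> * (norm (w - ?z0))\<^sup>2) \<le> M * 4"
      using exp3[of w] w M by (intro mult_left_mono) (auto simp: dist_norm norm_minus_commute)
    ultimately have "M * exp (\<alpha> * (norm (w - ?z0))\<^sup>2) \<le> e' (ch j) w t" by simp
    then have "ln (M * exp (\<alpha> * (norm (w - ?z0))\<^sup>2)) \<le> ?f w" using M pos[OF wV] by simp
    then have "?\<phi> w \<ge> 0" using M by (simp add: ln_mult)
    then have "?\<phi> z \<ge> 0" using min[of z] z by auto
    then have "ln M \<le> ?f z" using \<alpha> by (smt (verit) mult_nonneg_nonneg zero_le_power2)
    moreover have "z \<in> ?V" using z cb by auto
    ultimately show ?thesis using M pos[of z] by simp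
  qed
  show thesis
    by (rule that[of \<rho> "min b \<delta>", OF \<rho>(1) _ _ main]) (use b \<delta> in auto)
qed

lemma e'_decay:
  assumes j: "j \<in> J" and z: "z \<in> cdom (ch j)" and st: "0 < s" "s \<le> t" "t < \<delta>"
  shows "e' (ch j) z t * exp (- B * t) \<le> e' (ch j) z s * exp (- B * s)"
proof -
  let ?h = "\<lambda>t. e' (ch j) z t * exp (- B * t)"
  have "\<exists>y. (?h has_real_derivative y) (at u) \<and> y \<le> 0" if "s \<le> u" "u \<le> t" for u
  proof -
    have u: "u \<in> {0<..<\<delta>}" using that st by auto
    have "(e' (ch j) z has_real_derivative lap (\<lambda>w. ln (e' (ch j) w u)) z) (at u)"
      using log_diffusionD(5)[OF e'_log[OF j] z u] u at_within_open[of u "{0<..<\<delta>}"] by auto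
    then have "(?h has_real_derivative lap (\<lambda>w. ln (e' (ch j) w u)) z * exp (- B * u)
        + (- B * exp (- B * u)) * e' (ch j) z u) (at u)"
      by (intro DERIV_mult) (auto intro!: derivative_eq_intros)
    moreover have "lap (\<lambda>w. ln (e' (ch j) w u)) z * exp (- B * u) + (- B * exp (- B * u)) * e' (ch j) z u
        = (lap (\<lambda>w. ln (e' (ch j) w u)) z - B * e' (ch j) z u) * exp (- B * u)"
      by (simp add: algebra_simps)
    moreover have "\<dots> \<le> 0" using e'_curv[OF j z u] by (intro mult_nonpos_nonneg) auto
    ultimately show ?thesis by metis
  qed
  from DERIV_nonpos_imp_nonincreasing[OF st(2), of ?h] this show ?thesis by blast
qed

lemma pointwise_limit:
  assumes "j \<in> J" "z \<in> regular j"
  shows "((\<lambda>t. e' (ch j) z t) \<longlongrightarrow> e0 (ch j) z) (at_right 0)" "((\<lambda>t. e (ch j) z t) \<longlongrightarrow> e0 (ch j) z) (at_right 0)"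
  using tendsto_uniform_limitI[OF e'_lim[OF assms(1), of "{z}"], of z]
    tendsto_uniform_limitI[OF e_lim[OF assms(1), of "{z}"], of z] assms(2) by (auto simp: cusps_def)

text \<open>The limit \<open>s \<down> 0\<close> in \<open>e'_decay\<close>, available only where
  \<open>e'\<close> converges to \<open>e0\<close>.\<close>

lemma e'_le_initial:
  assumes j: "j \<in> J" and z: "z \<in> regular j" and t: "t \<in> {0<..<\<delta>}"
  shows "e' (ch j) z t * exp (- B * t) \<le> e0 (ch j) z"
proof (rule tendsto_lowerbound)
  show "((\<lambda>s. e' (ch j) z s * exp (- B * s)) \<longlongrightarrow> e0 (ch j) z) (at_right 0)"
  proof -
    have "((\<lambda>s. exp (- B * s)) \<longlongrightarrow> exp (- B * 0)) (at_right 0)" by (intro tendsto_intros)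
    from tendsto_mult[OF pointwise_limit(1)[OF j z] this] show ?thesis by simp
  qed
  show "\<forall>\<^sub>F s in at_right 0. e' (ch j) z t * exp (- B * t) \<le> e' (ch j) z s * exp (- B * s)"
    unfolding eventually_at_right_field
    using e'_decay[OF j, of z] z t by (intro exI[of _ t]) auto
qed simp

lemma uniform_at_start:
  assumes k: "k \<ge> 1" and j: "j \<in> J" and \<epsilon>: "\<epsilon> > 0"
  obtains \<tau> where "\<tau> > 0" "\<And>a z. a \<in> {0..T} \<Longrightarrow> a < \<tau> \<Longrightarrow> z \<in> box_of j \<Longrightarrow> \<bar>G k (ch j) z a - G k (ch j) z 0\<bar> < \<epsilon>"
proof -
  let ?S = "box_of j \<times> {0..T}"
  have "continuous_on ?S (\<lambda>(z, t). G k (ch j) z t)"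
    using log_diffusionD(1)[OF G_log[OF k j]] by (rule continuous_on_subset) (use box_sub[OF j] in auto)
  then have "uniformly_continuous_on ?S (\<lambda>(z, t). G k (ch j) z t)"
    by (rule compact_uniformly_continuous) (simp add: compact_Times)
  from this[unfolded uniformly_continuous_on_def, rule_format, OF \<epsilon>]
  obtain d where d: "d > 0" "\<And>x x'. x \<in> ?S \<Longrightarrow> x' \<in> ?S \<Longrightarrow> dist x' x < d \<Longrightarrow>
      dist ((\<lambda>(z, t). G k (ch j) z t) x') ((\<lambda>(z, t). G k (ch j) z t) x) < \<epsilon>" by blast
  show thesis
  proof (rule that[OF d(1)])
    fix a z assume "a \<in> {0..T}" "a < d" "z \<in> box_of j"
    then show "\<bar>G k (ch j) z a - G k (ch j) z 0\<bar> < \<epsilon>"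
      using d(2)[of "(z, 0)" "(z, a)"] by (auto simp: dist_Pair_Pair dist_real_def)
  qed
qed

text \<open>A single truncated flow is continuous up to time 0 on compact squares. The constants
  depend on \<open>k\<close>, which is harmless because each comparison concerns a fixed
  \<open>k\<close>.\<close>

lemma G_bounds:
  assumes k: "k \<ge> 1"
  shows "\<exists>m>0. \<exists>M>0. \<forall>j\<in>J. \<forall>z\<in>box_of j. \<forall>t\<in>{0..T}.
     m \<le> G k (ch j) z t \<and> G k (ch j) z t \<le> M \<and> lap (\<lambda>w. ln (G k (ch j) w t)) z \<ge> - M * G k (ch j) z t"
proof -
  have "\<exists>n::nat. \<forall>y\<in>box_of j \<times> {0..T}. 1 / real (Suc n) \<le> G k (ch j) (fst y) (snd y) \<and>
      G k (ch j) (fst y) (snd y) \<le> real (Suc n) \<and>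
      lap (\<lambda>w. ln (G k (ch j) w (snd y))) (fst y) \<ge> - real (Suc n) * G k (ch j) (fst y) (snd y)" if j: "j \<in> J" for j
  proof -
    let ?S = "box_of j \<times> {0..T}" and ?g = "\<lambda>y. G k (ch j) (fst y) (snd y)"
      and ?l = "\<lambda>y. lap (\<lambda>w. ln (G k (ch j) w (snd y))) (fst y)"
    have sub: "?S \<subseteq> cdom (ch j) \<times> {0..T}" using box_sub[OF j] by auto
    have cS: "compact ?S" by (simp add: compact_Times)
    have g: "continuous_on ?S ?g" and l: "continuous_on ?S ?l"
      using log_diffusionD(1,4)[OF G_log[OF k j]] continuous_on_subset[OF _ sub] by (auto simp: case_prod_beta)
    have pos: "?g y > 0" if "y \<in> ?S" for y
      using log_diffusionD(2)[OF G_log[OF k j], of "fst y" "snd y"] that sub by auto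
    have "\<forall>y\<in>?S. ?g y \<noteq> 0" using pos by force
    \<comment> \<open>A bound for this sum of nonnegative terms bounds all three quantities at
      once.\<close>
    then have "continuous_on ?S (\<lambda>y. 1 / ?g y + ?g y + \<bar>?l y / ?g y\<bar>)"
      using g l by (intro continuous_intros) auto
    then have "bounded ((\<lambda>y. 1 / ?g y + ?g y + \<bar>?l y / ?g y\<bar>) ` ?S)"
      using cS by (meson compact_continuous_image compact_imp_bounded)
    then obtain C where C0: "\<forall>x\<in>(\<lambda>y. 1 / ?g y + ?g y + \<bar>?l y / ?g y\<bar>) ` ?S. norm x \<le> C"
      unfolding bounded_iff by blast
    have C: "\<bar>1 / ?g y + ?g y + \<bar>?l y / ?g y\<bar>\<bar> \<le> C" if "y \<in> ?S" for y
      using bspec[OF C0 imageI[OF that]] unfolding real_norm_def .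
    obtain n :: nat where n: "C \<le> real n" using real_arch_simple by blast
    show ?thesis
    proof (intro exI[of _ n] ballI)
      fix y assume y: "y \<in> ?S"
      have gp: "?g y > 0" using pos[OF y] .
      then have "1 / ?g y > 0" by simp
      with C[OF y] n gp have "1 / ?g y \<le> real (Suc n)" "?g y \<le> real (Suc n)" "\<bar>?l y / ?g y\<bar> \<le> real (Suc n)"
        by linarith+
      then show "1 / real (Suc n) \<le> ?g y \<and> ?g y \<le> real (Suc n) \<and> ?l y \<ge> - real (Suc n) * ?g y"
        using gp by (auto simp: field_simps abs_le_iff)
    qed
  qed
  then obtain n where n: "\<And>j y. j \<in> J \<Longrightarrow> y \<in> box_of j \<times> {0..T} \<Longrightarrow> 1 / real (Suc (n j)) \<le> G k (ch j) (fst y) (snd y) \<and>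
      G k (ch j) (fst y) (snd y) \<le> real (Suc (n j)) \<and>
      lap (\<lambda>w. ln (G k (ch j) w (snd y))) (fst y) \<ge> - real (Suc (n j)) * G k (ch j) (fst y) (snd y)" by metis
  \<comment> \<open>The sum dominates every \<open>n j\<close> and makes sense for empty
    \<open>J\<close> as well.\<close>
  define N where "N = Suc (\<Sum>j\<in>J. n j)"
  have N: "real (Suc (n j)) \<le> real N" if "j \<in> J" for j
    using member_le_sum[of j J n] fin that by (simp add: N_def flip: of_nat_sum)
  have N0: "real N > 0" unfolding N_def of_nat_0_less_iff by simp
  show ?thesis
  proof (rule exI[of _ "1 / real N"], rule conjI, use N0 in simp, intro exI[of _ "real N"] conjI ballI)
    fix j z t assume j: "j \<in> J" and z: "z \<in> box_of j" and t: "t \<in> {0..T}"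
    have *: "1 / real (Suc (n j)) \<le> G k (ch j) z t" "G k (ch j) z t \<le> real (Suc (n j))"
      "lap (\<lambda>w. ln (G k (ch j) w t)) z \<ge> - real (Suc (n j)) * G k (ch j) z t"
      using n[OF j, of "(z, t)"] z t by auto
    have "1 / real N \<le> 1 / real (Suc (n j))" using N[OF j] by (intro divide_left_mono) (auto simp: N0)
    moreover have "G k (ch j) z t > 0" using *(1) by (smt (verit) divide_pos_pos of_nat_0_less_iff zero_less_Suc)
    then have "real (Suc (n j)) * G k (ch j) z t \<le> real N * G k (ch j) z t" using N[OF j] by (intro mult_right_mono) auto
    ultimately show "1 / real N \<le> G k (ch j) z t" "G k (ch j) z t \<le> real N"
        "lap (\<lambda>w. ln (G k (ch j) w t)) z \<ge> - real N * G k (ch j) z t"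
      using * N[OF j] by linarith+
  qed (use N0 in auto)
qed

lemma compare_from_boxes:
  assumes "\<And>j. j \<in> J \<Longrightarrow> \<exists>\<tau>>0. \<forall>a. 0 < a \<and> a < \<tau> \<longrightarrow> (\<forall>z\<in>box_of j. Q j z a)"
    and "\<tau> > (0::real)"
  shows "\<exists>a\<in>{0<..<\<tau>}. \<forall>j\<in>J. \<forall>z\<in>box_of j. Q j z a"
proof -
  have "\<forall>j\<in>J. \<forall>\<^sub>F a in at_right 0. \<forall>z\<in>box_of j. Q j z a"
  proof
    fix j assume "j \<in> J"
    then obtain \<tau> where "\<tau> > 0" "\<And>a. 0 < a \<Longrightarrow> a < \<tau> \<Longrightarrow> \<forall>z\<in>box_of j. Q j z a"
      using assms(1) by blast
    then show "\<forall>\<^sub>F a in at_right 0. \<forall>z\<in>box_of j. Q j z a"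
      unfolding eventually_at_right_field by blast
  qed
  then have "\<forall>\<^sub>F a in at_right 0. \<forall>j\<in>J. \<forall>z\<in>box_of j. Q j z a"
    by (simp add: eventually_ball_finite_distrib fin)
  moreover have "\<forall>\<^sub>F a in at_right 0. a \<in> {0<..<\<tau>}"
    using assms(2) by (auto simp: eventually_at_right_field)
  ultimately have "\<forall>\<^sub>F a in at_right 0. (\<forall>j\<in>J. \<forall>z\<in>box_of j. Q j z a) \<and> a \<in> {0<..<\<tau>}"
    by (rule eventually_conj)
  from eventually_happens[OF this] show ?thesis
    by (metis trivial_limit_at_right_real)
qed

text \<open>The initial condition of \<open>comparison\<close> has two sources: near a puncture
  \<open>e'\<close> exceeds the upper bound \<open>M\<close> of \<open>G k\<close>, and elsewhere
  \<open>G k\<close> starts below \<open>e0\<close>, to which \<open>e'\<close> converges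
  uniformly.\<close>

lemma G_le_e':
  assumes k: "k \<ge> 1" and j: "j \<in> J" and z: "z \<in> box_of j" and t: "t \<in> {0<..<\<delta>}"
  shows "G k (ch j) z t \<le> e' (ch j) z t"
proof -
  obtain m M where m: "0 < m" and M: "0 < M" and bd: "\<And>j z t. j \<in> J \<Longrightarrow> z \<in> box_of j \<Longrightarrow> t \<in> {0..T} \<Longrightarrow>
     m \<le> G k (ch j) z t \<and> G k (ch j) z t \<le> M \<and> lap (\<lambda>w. ln (G k (ch j) w t)) z \<ge> - M * G k (ch j) z t"
    using G_bounds[OF k] by blast
  have tT: "{0..t} \<subseteq> {0..T}" using t \<delta> by auto
  show ?thesis
  proof (rule comparison[OF conf_flow_subset[OF G_flow[OF k] tT], of e' M])
    show "conf_flow A {0<..t} e'" by (rule conf_flow_subset[OF e'_flow]) (use t in auto)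
    show "- M * G k (ch j) z s \<le> lap (\<lambda>w. ln (G k (ch j) w s)) z" if "j \<in> J" "z \<in> box_of j" "s \<in> {0..t}" for j z s
      using bd that tT by blast
    fix \<eta> \<tau> :: real assume \<eta>: "\<eta> > 0" and \<tau>: "\<tau> > 0"
    show "\<exists>a\<in>{0<..<\<tau>}. \<forall>j\<in>J. \<forall>z\<in>box_of j. G k (ch j) z a - e' (ch j) z a \<le> \<eta> * G k (ch j) z a"
    proof (rule compare_from_boxes[OF _ \<tau>])
      fix j assume j: "j \<in> J"
      \<comment> \<open>Half of the tolerance is for the motion of \<open>G k\<close> away from its
        initial value, half for the distance of \<open>e'\<close> from \<open>e0\<close>; the sum
        \<open>\<eta> * m\<close> is at most \<open>\<eta> * G k\<close>.\<close>
      have \<epsilon>: "\<eta> * m / 2 > 0" using \<eta> m by simp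
      obtain \<tau>1 where \<tau>1: "\<tau>1 > 0" "\<And>a z. a \<in> {0..T} \<Longrightarrow> a < \<tau>1 \<Longrightarrow> z \<in> box_of j \<Longrightarrow>
          \<bar>G k (ch j) z a - G k (ch j) z 0\<bar> < \<eta> * m / 2"
        using uniform_at_start[OF k j \<epsilon>] by blast
      \<comment> \<open>\<open>U\<close> is the ball about the puncture on which \<open>e'\<close>
        is large, and empty in a square without punctures, where the time \<open>1\<close> is
        arbitrary.\<close>
      obtain U \<tau>2 where U: "open U" and \<tau>2: "\<tau>2 > 0"
        and e'U: "\<And>z t. z \<in> box_of j \<inter> U \<Longrightarrow> t \<in> {0<..<\<tau>2} \<Longrightarrow> e' (ch j) z t \<ge> M"
        and reg: "box_of j - U \<subseteq> regular j"
      proof (cases "ctr j \<in> cusps j")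
        case True
        obtain \<rho> \<tau>' where "\<rho> > 0" "\<tau>' > 0" "\<And>z t. z \<in> ball (ctr j) \<rho> \<Longrightarrow> t \<in> {0<..<\<tau>'} \<Longrightarrow> e' (ch j) z t \<ge> M"
          using large_near_cusp[OF j True M] by metis
        then show thesis using that[of "ball (ctr j) \<rho>" \<tau>'] box_minus_ball_regular[OF j] by auto
      next
        case False
        moreover have "cusps j \<inter> box_of j \<subseteq> {ctr j}" using bad[OF j] by (simp only: cusps_def)
        ultimately have "box_of j - {} \<subseteq> regular j" using box_sub[OF j] by fast
        then show thesis by (intro that[of "{}" 1]) simp_all
      qed
      have K: "compact (box_of j - U)" using U by (intro compact_diff) auto
      have "\<forall>\<^sub>F s in at_right 0. \<forall>z\<in>box_of j - U. dist (e' (ch j) z s) (e0 (ch j) z) < \<eta> * m / 2"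
        using uniform_limitD[OF e'_lim[OF j K reg[unfolded cusps_def]] \<epsilon>] .
      then obtain \<tau>3 where \<tau>3: "\<tau>3 > 0" "\<And>s z. 0 < s \<Longrightarrow> s < \<tau>3 \<Longrightarrow> z \<in> box_of j - U \<Longrightarrow>
          dist (e' (ch j) z s) (e0 (ch j) z) < \<eta> * m / 2"
        by (auto simp: eventually_at_right_field)
      show "\<exists>\<tau>>0. \<forall>a. 0 < a \<and> a < \<tau> \<longrightarrow> (\<forall>z\<in>box_of j. G k (ch j) z a - e' (ch j) z a \<le> \<eta> * G k (ch j) z a)"
      proof (intro exI[of _ "min (min \<tau>1 \<tau>2) (min \<tau>3 T)"] conjI allI impI ballI)
        show "0 < min (min \<tau>1 \<tau>2) (min \<tau>3 T)" using \<tau>1 \<tau>2 \<tau>3 \<delta> by auto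
        fix a z assume a: "0 < a \<and> a < min (min \<tau>1 \<tau>2) (min \<tau>3 T)" and z: "z \<in> box_of j"
        have aT: "a \<in> {0..T}" using a by auto
        have G: "m \<le> G k (ch j) z a" "G k (ch j) z a \<le> M" using bd[OF j z aT] by auto
        have \<eta>m: "\<eta> * m \<le> \<eta> * G k (ch j) z a" using G \<eta> by (intro mult_left_mono) auto
        show "G k (ch j) z a - e' (ch j) z a \<le> \<eta> * G k (ch j) z a"
        proof (cases "z \<in> U")
          case True
          then have "e' (ch j) z a \<ge> M" using e'U a z by auto
          moreover have "\<eta> * m > 0" using \<eta> m by simp
          ultimately show ?thesis using G \<eta>m by linarith
        next
          case False
          have "dist (e' (ch j) z a) (e0 (ch j) z) < \<eta> * m / 2" using \<tau>3(2)[of a z] a z False by auto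
          moreover have "\<bar>G k (ch j) z a - G k (ch j) z 0\<bar> < \<eta> * m / 2" using \<tau>1(2)[OF aT _ z] a by auto
          moreover have "G k (ch j) z 0 \<le> e0 (ch j) z" using G_init[OF k j] reg z False by (auto simp: cusps_def)
          ultimately show ?thesis using \<eta>m unfolding dist_real_def by linarith
        qed
      qed
    qed
  qed (use j z t in auto)
qed

text \<open>Serves to give all truncated flows, and hence their limit, one common positive lower
  bound.\<close>

lemma G1_le_G:
  assumes k: "k \<ge> 1" and j: "j \<in> J" and z: "z \<in> box_of j" and t: "t \<in> {0<..T}"
  shows "G 1 (ch j) z t \<le> G k (ch j) z t"
proof -
  obtain m M where m: "0 < m" and bd: "\<And>j z t. j \<in> J \<Longrightarrow> z \<in> box_of j \<Longrightarrow> t \<in> {0..T} \<Longrightarrow>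
     m \<le> G 1 (ch j) z t \<and> G 1 (ch j) z t \<le> M \<and> lap (\<lambda>w. ln (G 1 (ch j) w t)) z \<ge> - M * G 1 (ch j) z t"
    using G_bounds[OF order_refl] by blast
  show ?thesis
  proof (rule comparison[OF G_flow[of 1], of "G k" M])
    show "conf_flow A {0<..T} (G k)" by (rule conf_flow_subset[OF G_flow[OF k]]) auto
    fix \<eta> \<tau> :: real assume \<eta>: "\<eta> > 0" and \<tau>: "\<tau> > 0"
    show "\<exists>a\<in>{0<..<\<tau>}. \<forall>j\<in>J. \<forall>z\<in>box_of j. G 1 (ch j) z a - G k (ch j) z a \<le> \<eta> * G 1 (ch j) z a"
    proof (rule compare_from_boxes[OF _ \<tau>])
      fix j assume j: "j \<in> J"
      have \<epsilon>: "\<eta> * m / 2 > 0" using \<eta> m by simp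
      obtain \<tau>1 where \<tau>1: "\<tau>1 > 0" "\<And>a z. a \<in> {0..T} \<Longrightarrow> a < \<tau>1 \<Longrightarrow> z \<in> box_of j \<Longrightarrow>
          \<bar>G 1 (ch j) z a - G 1 (ch j) z 0\<bar> < \<eta> * m / 2"
        using uniform_at_start[OF order_refl j \<epsilon>] by blast
      obtain \<tau>2 where \<tau>2: "\<tau>2 > 0" "\<And>a z. a \<in> {0..T} \<Longrightarrow> a < \<tau>2 \<Longrightarrow> z \<in> box_of j \<Longrightarrow>
          \<bar>G k (ch j) z a - G k (ch j) z 0\<bar> < \<eta> * m / 2"
        using uniform_at_start[OF k j \<epsilon>] by blast
      show "\<exists>\<tau>>0. \<forall>a. 0 < a \<and> a < \<tau> \<longrightarrow> (\<forall>z\<in>box_of j. G 1 (ch j) z a - G k (ch j) z a \<le> \<eta> * G 1 (ch j) z a)"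
      proof (intro exI[of _ "min (min \<tau>1 \<tau>2) T"] conjI allI impI ballI)
        show "0 < min (min \<tau>1 \<tau>2) T" using \<tau>1 \<tau>2 \<delta> by auto
        fix a z assume a: "0 < a \<and> a < min (min \<tau>1 \<tau>2) T" and z: "z \<in> box_of j"
        have aT: "a \<in> {0..T}" using a by auto
        have "\<eta> * m \<le> \<eta> * G 1 (ch j) z a" using bd[OF j z aT] \<eta> by (intro mult_left_mono) auto
        moreover have "\<bar>G 1 (ch j) z a - G 1 (ch j) z 0\<bar> < \<eta> * m / 2" using \<tau>1(2)[OF aT _ z] a by auto
        moreover have "\<bar>G k (ch j) z a - G k (ch j) z 0\<bar> < \<eta> * m / 2" using \<tau>2(2)[OF aT _ z] a by auto
        moreover have "G 1 (ch j) z 0 \<le> G k (ch j) z 0" using G_mono[OF k j] z box_sub[OF j] by auto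
        ultimately show "G 1 (ch j) z a - G k (ch j) z a \<le> \<eta> * G 1 (ch j) z a" by linarith
      qed
    qed
  qed (use j z t bd in auto)
qed

lemma e_le_e':
  assumes j: "j \<in> J" and z: "z \<in> box_of j" and t: "t \<in> {0<..<\<delta>}"
  shows "e (ch j) z t \<le> e' (ch j) z t"
proof (rule LIMSEQ_le_const2)
  show "(\<lambda>k. G k (ch j) z t) \<longlonglongrightarrow> e (ch j) z t"
    using G_lim[OF j] z box_sub[OF j] t \<delta> by auto
  show "\<exists>N. \<forall>k\<ge>N. G k (ch j) z t \<le> e' (ch j) z t"
    using G_le_e'[OF _ j z t] by blast
qed

text \<open>The bound is that of \<open>G 1\<close> on the closed time interval, so it does not
  degenerate as \<open>t \<down> 0\<close>. It later makes the logarithm Lipschitz.\<close>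

lemma e_lower_bound:
  obtains m where "m > 0" "\<And>j z t. j \<in> J \<Longrightarrow> z \<in> box_of j \<Longrightarrow> t \<in> {0<..T} \<Longrightarrow> m \<le> e (ch j) z t"
proof -
  obtain m M where m: "0 < m" and bd: "\<And>j z t. j \<in> J \<Longrightarrow> z \<in> box_of j \<Longrightarrow> t \<in> {0..T} \<Longrightarrow>
     m \<le> G 1 (ch j) z t \<and> G 1 (ch j) z t \<le> M \<and> lap (\<lambda>w. ln (G 1 (ch j) w t)) z \<ge> - M * G 1 (ch j) z t"
    using G_bounds[OF order_refl] by blast
  show thesis
  proof (rule that[OF m])
    fix j z t assume j: "j \<in> J" and z: "z \<in> box_of j" and t: "t \<in> {0<..T}"
    show "m \<le> e (ch j) z t"
    proof (rule LIMSEQ_le_const)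
      show "(\<lambda>k. G k (ch j) z t) \<longlonglongrightarrow> e (ch j) z t"
        using G_lim[OF j] z box_sub[OF j] t by auto
      have "m \<le> G 1 (ch j) z t" using bd[OF j z, of t] t by auto
      then show "\<exists>N. \<forall>k\<ge>N. m \<le> G k (ch j) z t"
        using G1_le_G[OF _ j z t] order_trans by blast
    qed
  qed
qed

end

section \<open>Equality from the evolution of area\<close>

text \<open>Green's formula moves the Laplacian onto the bump, so the rate of change of weighted
  area involves only \<open>ln e\<close> and no derivatives of \<open>e\<close>.\<close>

lemma integral_bump_deriv:
  assumes r: "r \<ge> 0" and sub: "sq z0 r \<subseteq> V" and V: "open V"
    and e: "log_diffusion V I e" and I: "convex I" and t: "t \<in> I"
  shows "((\<lambda>t. integral (sq z0 r) (\<lambda>z. bump z0 r z * e z t)) has_real_derivative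
           integral (sq z0 r) (\<lambda>z. bump_lap z0 r z * ln (e z t))) (at t within I)"
proof -
  let ?D = "\<lambda>t z. lap (\<lambda>w. ln (e w t)) z"
  have c: "continuous_on (sq z0 r) (\<lambda>z. e z s)" if "s \<in> I" for s
    using log_diffusionD(3)[OF e that] sub continuous_on_subset by (auto simp: C2_def)
  have "continuous_on (I \<times> sq z0 r) (\<lambda>x. (snd x, fst x))" by (intro continuous_intros)
  moreover have "(\<lambda>x. (snd x, fst x)) ` (I \<times> sq z0 r) \<subseteq> V \<times> I" using sub by auto
  ultimately have D: "continuous_on (I \<times> sq z0 r) (\<lambda>x. ?D (fst x) (snd x))"
    using continuous_on_compose2[OF log_diffusionD(4)[OF e]] by (fastforce simp: case_prod_beta)
  have bc: "continuous_on (I \<times> sq z0 r) (\<lambda>x. bump z0 r (snd x))"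
    by (rule continuous_on_compose2[OF continuous_on_bump(1)[of UNIV]]) (auto intro: continuous_intros)
  have "((\<lambda>t. integral (sq z0 r) (\<lambda>z. bump z0 r z * e z t)) has_real_derivative
           integral (sq z0 r) (\<lambda>z. bump z0 r z * ?D t z)) (at t within I)"
    unfolding sq_def
  proof (rule leibniz_rule_field_derivative[OF _ _ _ t I])
    show "((\<lambda>x. bump z0 r z * e z x) has_real_derivative bump z0 r z * ?D x z) (at x within I)"
      if "x \<in> I" "z \<in> cbox (z0 - Complex r r) (z0 + Complex r r)" for x z
      using that sub by (intro DERIV_cmult log_diffusionD(5)[OF e]) (auto simp: sq_def)
    show "(\<lambda>z. bump z0 r z * e z x) integrable_on cbox (z0 - Complex r r) (z0 + Complex r r)" if "x \<in> I" for x
      using c[OF that] unfolding sq_def by (intro integrable_continuous continuous_intros)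
    show "continuous_on (I \<times> cbox (z0 - Complex r r) (z0 + Complex r r)) (\<lambda>(x, z). bump z0 r z * ?D x z)"
      using D bc unfolding sq_def case_prod_beta by (intro continuous_intros)
  qed
  moreover have "C2 V (\<lambda>w. ln (e w t))"
    using C2_ln(1)[OF V log_diffusionD(3)[OF e t]] log_diffusionD(2)[OF e _ t] by blast
  ultimately show ?thesis using integral_bump_lap[OF r sub] by simp
qed

lemma continuous_on_sq_integrable:
  fixes f :: "complex \<Rightarrow> real"
  shows "continuous_on (sq z r) f \<Longrightarrow> f integrable_on sq z r"
  unfolding sq_def by (rule integrable_continuous)

section \<open>Comparison of areas in overlapping charts\<close>

lemma transition_eq:
  assumes "riemann_surface X A" "c \<in> A" "p \<in> fst c"
  shows "transition c d (snd c p) = snd d p"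
  using riemann_surface_chart(2)[OF assms(1,2)] assms(3) by (simp add: transition_def)

lemma open_overlap:
  assumes X: "riemann_surface X A" and c: "c \<in> A" and d: "d \<in> A"
  shows "open (snd c ` (fst c \<inter> fst d))"
proof -
  have hom: "homeomorphic_map (subtopology X (fst c)) (top_of_set (snd c ` fst c)) (snd c)" and o: "open (snd c ` fst c)"
    using X c by (auto simp: riemann_surface_def is_chart_def)
  have "openin (subtopology X (fst c)) (fst c \<inter> fst d)"
    using riemann_surface_chart(4)[OF X d] by (simp add: openin_subtopology_Int2)
  then have "openin (top_of_set (snd c ` fst c)) (snd c ` (fst c \<inter> fst d))"
    using homeomorphic_imp_open_map[OF hom] by (simp add: open_map_def)
  then show ?thesis using o openin_open_trans by blast
qed

text \<open>The points of the second chart over \<open>L\<close> form a compact and hence, the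
  surface being Hausdorff, closed set. Its trace on the first chart is relatively closed, and
  meeting it with \<open>K\<close> gives compactness.\<close>

lemma compact_overlap:
  assumes X: "riemann_surface X A" and c: "c \<in> A" and d: "d \<in> A"
    and K: "compact K" "K \<subseteq> cdom c" and L: "compact L" "L \<subseteq> cdom d"
  shows "compact {z \<in> K. \<exists>p\<in>fst c \<inter> fst d. snd c p = z \<and> snd d p \<in> L}"
proof -
  have hom: "homeomorphic_map (subtopology X (fst c)) (top_of_set (snd c ` fst c)) (snd c)"
    "homeomorphic_map (subtopology X (fst d)) (top_of_set (snd d ` fst d)) (snd d)"
    using X c d by (auto simp: riemann_surface_def is_chart_def)
  let ?U = "{p \<in> fst d. snd d p \<in> L}"
  have "snd d ` ?U = L" using L(2) by (auto simp: cdom_def)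
  moreover have "?U \<subseteq> topspace (subtopology X (fst d))"
    using riemann_surface_chart(3)[OF X d] by auto
  moreover have "compactin (top_of_set (snd d ` fst d)) L"
    using L by (simp add: compactin_subtopology cdom_def)
  ultimately have "compactin (subtopology X (fst d)) ?U"
    using homeomorphic_map_compactness[OF hom(2), of ?U] by simp
  then have "compactin X ?U" by (simp add: compactin_subtopology)
  then have "closedin X ?U" using X compactin_imp_closedin by (auto simp: riemann_surface_def)
  then have "closedin (subtopology X (fst c)) (fst c \<inter> ?U)"
    by (rule closedin_subtopology_Int_closed)
  then have "closedin (top_of_set (snd c ` fst c)) (snd c ` (fst c \<inter> ?U))"
    using homeomorphic_imp_closed_map[OF hom(1)] by (simp add: closed_map_def)
  then obtain D where D: "closed D" "snd c ` (fst c \<inter> ?U) = snd c ` fst c \<inter> D"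
    by (auto simp: closedin_closed)
  have "{z \<in> K. \<exists>p\<in>fst c \<inter> fst d. snd c p = z \<and> snd d p \<in> L} = K \<inter> (snd c ` (fst c \<inter> ?U))"
    by auto
  also have "\<dots> = K \<inter> D" unfolding D(2) using K(2) by (auto simp: cdom_def)
  finally show ?thesis using K(1) D(1) by (simp add: compact_Int_closed)
qed

text \<open>The square of \<open>i\<close> is cut into the pieces \<open>S j\<close> lying over the
  half squares. On each piece the transition map is an injective holomorphic change of variables
  under which the density keeps its integral.\<close>

lemma (in boxed_surface) integral_box_le:
  assumes f: "conf_density A f" and cont: "\<And>j. j \<in> J \<Longrightarrow> continuous_on (cdom (ch j)) (f (ch j))"
    and nonneg: "\<And>j z. j \<in> J \<Longrightarrow> z \<in> box_of j \<Longrightarrow> f (ch j) z \<ge> 0" and i: "i \<in> J"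
  shows "integral (box_of i) (f (ch i)) \<le> (\<Sum>j\<in>J. integral (sq (ctr j) (rad j / 2)) (f (ch j)))"
proof -
  define S where "S j = {z \<in> box_of i. \<exists>p\<in>fst (ch i) \<inter> fst (ch j). snd (ch i) p = z \<and> snd (ch j) p \<in> sq (ctr j) (rad j / 2)}" for j
  let ?F = "f (ch i)"
  have half: "sq (ctr j) (rad j / 2) \<subseteq> cdom (ch j)" if "j \<in> J" for j
    using half_box_sub box_sub that by blast
  have cS: "compact (S j)" if "j \<in> J" for j
    unfolding S_def using compact_overlap[OF surf ch[OF i] ch[OF that] compact_sq box_sub[OF i] compact_sq half[OF that]] .
  have SI: "S j \<subseteq> box_of i" for j by (auto simp: S_def)
  have Fc: "continuous_on (box_of i) ?F" using continuous_on_subset[OF cont[OF i] box_sub[OF i]] .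
  have FS: "?F integrable_on S j" if "j \<in> J" for j
    using set_borel_integral_eq_integral(1)[OF set_integrable_continuous_compact[OF cS[OF that] continuous_on_subset[OF Fc SI]]] .
  have le: "integral (S j) ?F \<le> integral (sq (ctr j) (rad j / 2)) (f (ch j))" if j: "j \<in> J" for j
  proof -
    let ?T = "transition (ch i) (ch j)" and ?W = "snd (ch i) ` (fst (ch i) \<inter> fst (ch j))"
    have W: "open ?W" using open_overlap[OF surf ch[OF i] ch[OF j]] .
    have T: "?T holomorphic_on ?W" using surf ch[OF i] ch[OF j] by (auto simp: riemann_surface_def compatible_def)
    have SW: "S j \<subseteq> ?W" by (auto simp: S_def)
    have TS: "?T ` S j \<subseteq> sq (ctr j) (rad j / 2)"
      using transition_eq[OF surf ch[OF i], of _ "ch j"] by (auto simp: S_def)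
    have inj: "inj_on ?T (S j)"
    proof (rule inj_onI)
      fix z w assume "z \<in> S j" "w \<in> S j" and eq: "?T z = ?T w"
      then obtain p q where pq: "p \<in> fst (ch i) \<inter> fst (ch j)" "snd (ch i) p = z"
        "q \<in> fst (ch i) \<inter> fst (ch j)" "snd (ch i) q = w" by (auto simp: S_def)
      then have "snd (ch j) p = snd (ch j) q"
        using eq transition_eq[OF surf ch[OF i], of _ "ch j"] by auto
      then have "p = q" using riemann_surface_chart(2)[OF surf ch[OF j]] pq by (auto dest: inj_onD)
      then show "z = w" using pq by simp
    qed
    have fc: "continuous_on (sq (ctr j) (rad j / 2)) (f (ch j))"
      using continuous_on_subset[OF cont[OF j] half[OF j]] .
    have d: "(?T has_field_derivative deriv ?T z) (at z within S j)" if "z \<in> S j" for z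
      using holomorphic_derivI[OF T W] SW that by blast
    have dc: "continuous_on (S j) (deriv ?T)"
      using continuous_on_subset[OF holomorphic_on_imp_continuous_on[OF holomorphic_deriv[OF T W]] SW] .
    have "integral (S j) ?F = integral (S j) (\<lambda>z. (norm (deriv ?T z))\<^sup>2 * f (ch j) (?T z))"
    proof (rule integral_cong)
      fix z assume "z \<in> S j"
      then obtain p where p: "p \<in> fst (ch i) \<inter> fst (ch j)" "snd (ch i) p = z" by (auto simp: S_def)
      then have "?F z = f (ch j) (snd (ch j) p) * (norm (deriv ?T z))\<^sup>2"
        using f[unfolded conf_density_def, rule_format, OF ch[OF i] ch[OF j] p(1)] by simp
      moreover have "?T z = snd (ch j) p" using transition_eq[OF surf ch[OF i], of p "ch j"] p by simp
      ultimately show "?F z = (norm (deriv ?T z))\<^sup>2 * f (ch j) (?T z)" by simp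
    qed
    also have "\<dots> = integral (?T ` S j) (f (ch j))"
      using integral_holomorphic_change_of_variables(1)[OF cS[OF j] d dc inj continuous_on_subset[OF fc TS]] by simp
    also have "\<dots> \<le> integral (sq (ctr j) (rad j / 2)) (f (ch j))"
    proof (rule integral_subset_le[OF TS])
      have "continuous_on (S j) ?T" using holomorphic_on_imp_continuous_on[OF T] SW continuous_on_subset by blast
      then have "compact (?T ` S j)" using cS[OF j] compact_continuous_image by blast
      then show "f (ch j) integrable_on ?T ` S j"
        using set_borel_integral_eq_integral(1)[OF set_integrable_continuous_compact[OF _ continuous_on_subset[OF fc TS]]] by blast
      show "f (ch j) integrable_on sq (ctr j) (rad j / 2)" using continuous_on_sq_integrable[OF fc] .
      show "\<forall>z\<in>sq (ctr j) (rad j / 2). 0 \<le> f (ch j) z" using nonneg[OF j] half_box_sub[OF j] by blast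
    qed
    finally show ?thesis .
  qed
  have r: "(\<lambda>z. if z \<in> S j then ?F z else 0) integrable_on box_of i"
    "integral (box_of i) (\<lambda>z. if z \<in> S j then ?F z else 0) = integral (S j) ?F" if "j \<in> J" for j
    using FS[OF that] SI[of j] by (simp_all add: integrable_restrict_Int integral_restrict_Int Int_absorb2)
  have "integral (box_of i) ?F \<le> integral (box_of i) (\<lambda>z. \<Sum>j\<in>J. if z \<in> S j then ?F z else 0)"
  proof (rule integral_le)
    show "?F integrable_on box_of i" using continuous_on_sq_integrable[OF Fc] .
    show "(\<lambda>z. \<Sum>j\<in>J. if z \<in> S j then ?F z else 0) integrable_on box_of i"
      using r(1) fin by (intro integrable_sum)
    fix z assume z: "z \<in> box_of i"
    obtain p where p: "p \<in> fst (ch i)" "snd (ch i) p = z" using box_sub[OF i] z by (auto simp: cdom_def)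
    then obtain k where k: "k \<in> J" "p \<in> fst (ch k)" "snd (ch k) p \<in> sq (ctr k) (rad k / 2)"
      using cover riemann_surface_chart(3)[OF surf ch[OF i]] by blast
    then have "z \<in> S k" using p z by (auto simp: S_def)
    then have "?F z = (if z \<in> S k then ?F z else 0)" by simp
    \<comment> \<open>One summand already equals \<open>?F z\<close>; overlaps only add nonnegative
      terms.\<close>
    also have "\<dots> \<le> (\<Sum>j\<in>J. if z \<in> S j then ?F z else 0)"
      by (rule member_le_sum[OF k(1) _ fin]) (use nonneg[OF i z] in auto)
    finally show "?F z \<le> (\<Sum>j\<in>J. if z \<in> S j then ?F z else 0)" .
  qed
  also have "\<dots> = (\<Sum>j\<in>J. integral (box_of i) (\<lambda>z. if z \<in> S j then ?F z else 0))"
    using r(1) fin by (intro integral_sum)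
  also have "\<dots> \<le> (\<Sum>j\<in>J. integral (sq (ctr j) (rad j / 2)) (f (ch j)))"
    using r(2) le by (intro sum_mono) auto
  finally show ?thesis .
qed

section \<open>Evolution of the weighted area between the two flows\<close>

context cusp_flows
begin

abbreviation \<beta> :: "'a \<Rightarrow> complex \<Rightarrow> real" where
  "\<beta> j \<equiv> bump (ctr j) (rad j)"

lemma cont_box:
  assumes "j \<in> J" "t \<in> {0<..<\<delta>}"
  shows "continuous_on (box_of j) (\<lambda>z. e' (ch j) z t)" "continuous_on (box_of j) (\<lambda>z. e (ch j) z t)"
    "continuous_on (box_of j) (\<lambda>z. ln (e' (ch j) z t))" "continuous_on (box_of j) (\<lambda>z. ln (e (ch j) z t))"
proof -
  have t: "t \<in> {0<..T}" using assms \<delta> by auto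
  show *: "continuous_on (box_of j) (\<lambda>z. e' (ch j) z t)" "continuous_on (box_of j) (\<lambda>z. e (ch j) z t)"
    using log_diffusionD(3)[OF e'_log[OF assms(1)] assms(2)] log_diffusionD(3)[OF e_log[OF assms(1)] t]
      continuous_on_subset[OF _ box_sub[OF assms(1)]] by (auto simp: C2_def)
  have "\<forall>z\<in>box_of j. e' (ch j) z t \<noteq> 0" "\<forall>z\<in>box_of j. e (ch j) z t \<noteq> 0"
    using log_diffusionD(2)[OF e'_log[OF assms(1)] _ assms(2)] log_diffusionD(2)[OF e_log[OF assms(1)] _ t]
      box_sub[OF assms(1)] by force+
  then show "continuous_on (box_of j) (\<lambda>z. ln (e' (ch j) z t))" "continuous_on (box_of j) (\<lambda>z. ln (e (ch j) z t))"
    using * by (auto intro: continuous_on_ln)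
qed

lemma bump_lap_bound:
  obtains C where "C > 0" "\<And>j z. j \<in> J \<Longrightarrow> z \<in> box_of j \<Longrightarrow> \<bar>bump_lap (ctr j) (rad j) z\<bar> \<le> C"
proof -
  have "\<exists>c\<ge>0. \<forall>z\<in>box_of j. \<bar>bump_lap (ctr j) (rad j) z\<bar> \<le> c" for j
  proof -
    have "bounded (bump_lap (ctr j) (rad j) ` box_of j)"
      by (intro compact_imp_bounded compact_continuous_image continuous_on_bump compact_sq)
    then obtain c where c: "\<forall>x\<in>bump_lap (ctr j) (rad j) ` box_of j. norm x \<le> c" unfolding bounded_iff by blast
    then show ?thesis by (intro exI[of _ "max c 0"]) auto
  qed
  then obtain c where c: "\<And>j. c j \<ge> 0" "\<And>j z. z \<in> box_of j \<Longrightarrow> \<bar>bump_lap (ctr j) (rad j) z\<bar> \<le> c j" by metis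
  show thesis
  proof (rule that[of "1 + (\<Sum>j\<in>J. c j)"])
    show "0 < 1 + (\<Sum>j\<in>J. c j)" using sum_nonneg[of J c] c(1) by simp
    fix j z assume "j \<in> J" "z \<in> box_of j"
    then show "\<bar>bump_lap (ctr j) (rad j) z\<bar> \<le> 1 + (\<Sum>j\<in>J. c j)"
      using c(2)[of z j] member_le_sum[of j J c] fin c(1) by fastforce
  qed
qed

lemma has_derivative_e':
  assumes "j \<in> J" "t \<in> {0<..<\<delta>}"
  shows "((\<lambda>t. integral (box_of j) (\<lambda>z. \<beta> j z * e' (ch j) z t)) has_real_derivative
     integral (box_of j) (\<lambda>z. bump_lap (ctr j) (rad j) z * ln (e' (ch j) z t))) (at t)"
  using integral_bump_deriv[OF less_imp_le[OF rad] box_sub open_cdom e'_log, of j t] assms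
  by (simp add: at_within_open[of t "{0<..<\<delta>}"])

lemma has_derivative_e:
  assumes "j \<in> J" "t \<in> {0<..<\<delta>}"
  shows "((\<lambda>t. integral (box_of j) (\<lambda>z. \<beta> j z * e (ch j) z t)) has_real_derivative
     integral (box_of j) (\<lambda>z. bump_lap (ctr j) (rad j) z * ln (e (ch j) z t))) (at t)"
proof -
  have "log_diffusion (cdom (ch j)) {0<..<\<delta>} (e (ch j))"
    by (rule log_diffusion_subset[OF e_log[OF assms(1)]]) (use \<delta> in auto)
  from integral_bump_deriv[OF less_imp_le[OF rad[OF assms(1)]] box_sub[OF assms(1)] open_cdom[OF assms(1)] this _ assms(2)]
  show ?thesis using assms by (simp add: at_within_open[of t "{0<..<\<delta>}"])
qed

text \<open>Near a cusp this bounds the area of \<open>e'(t)\<close> as \<open>t \<down> 0\<close>: away from the centre \<open>e'\<close> is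
  controlled by \<open>e0\<close>, and at the centre \<open>\<beta>\<close> is bounded below.\<close>

lemma bump_lap_ln_lower:
  assumes j: "j \<in> J"
  obtains D where "D > 0" "\<And>t z. t \<in> {0<..<\<delta>} \<Longrightarrow> z \<in> box_of j \<Longrightarrow>
    bump_lap (ctr j) (rad j) z * ln (e' (ch j) z t) \<ge> - D * (1 + \<beta> j z * e' (ch j) z t)"
proof -
  obtain C where C: "C > 0" "\<And>j z. j \<in> J \<Longrightarrow> z \<in> box_of j \<Longrightarrow> \<bar>bump_lap (ctr j) (rad j) z\<bar> \<le> C"
    using bump_lap_bound by blast
  obtain m where m: "m > 0" "\<And>j z t. j \<in> J \<Longrightarrow> z \<in> box_of j \<Longrightarrow> t \<in> {0<..T} \<Longrightarrow> m \<le> e (ch j) z t"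
    using e_lower_bound by blast
  let ?K = "box_of j - ball (ctr j) (rad j / 2)"
  have half: "ball (ctr j) (rad j / 2) \<subseteq> sq (ctr j) (rad j / 2)"
  proof
    fix z assume "z \<in> ball (ctr j) (rad j / 2)"
    then have n: "norm (z - ctr j) \<le> rad j / 2" by (simp add: dist_norm norm_minus_commute)
    have "\<bar>Re (z - ctr j)\<bar> \<le> norm (z - ctr j)" "\<bar>Im (z - ctr j)\<bar> \<le> norm (z - ctr j)"
      by (rule abs_Re_le_cmod, rule abs_Im_le_cmod)
    then show "z \<in> sq (ctr j) (rad j / 2)" using n by (simp add: mem_sq)
  qed
  have K: "?K \<subseteq> regular j" using box_minus_ball_regular[OF j] rad[OF j] by simp
  then have "continuous_on ?K (e0 (ch j))" using e0_cont[OF j] continuous_on_subset unfolding cusps_def by blast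
  moreover have "compact ?K" by (intro compact_diff) auto
  ultimately have "bounded (e0 (ch j) ` ?K)" by (intro compact_imp_bounded compact_continuous_image)
  then obtain M where M: "\<forall>x\<in>e0 (ch j) ` ?K. norm x \<le> M" unfolding bounded_iff by blast
  \<comment> \<open>The bound for \<open>e'\<close> off the central ball, obtained from the bound
    \<open>M\<close> of \<open>e0\<close> there and \<open>e'_le_initial\<close>.\<close>
  define M' where "M' = \<bar>M\<bar> * exp (B * \<delta>)"
  define c where "c = ((rad j)\<^sup>2 / 2) ^ 4"
  have c: "c > 0" using rad[OF j] by (simp add: c_def)
  \<comment> \<open>The first term handles \<open>ln m\<close> and the region where
    \<open>e'\<close> is at most \<open>M'\<close>; the second handles the half square, where
    \<open>c \<le> \<beta>\<close>.\<close>
  define D where "D = C * (\<bar>ln m\<bar> + M') + C / c"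
  have M': "M' \<ge> 0" by (simp add: M'_def)
  have D: "D \<ge> C * (\<bar>ln m\<bar> + M')" "D \<ge> C / c" "D > 0"
    using C(1) c M' by (auto simp: D_def intro: add_nonneg_pos mult_nonneg_nonneg)
  show thesis
  proof (rule that[OF D(3)])
    fix t z assume t: "t \<in> {0<..<\<delta>}" and z: "z \<in> box_of j"
    let ?e = "e' (ch j) z t" and ?b = "bump_lap (ctr j) (rad j) z"
    have "m \<le> e (ch j) z t" using m(2)[OF j z, of t] t \<delta> by auto
    then have me: "m \<le> ?e" using e_le_e'[OF j z t] by linarith
    then have e0: "?e > 0" using m(1) by linarith
    \<comment> \<open>Below, \<open>e' \<ge> e \<ge> m\<close> controls the logarithm; above, it is
      at most its argument.\<close>
    have ln: "\<bar>ln ?e\<bar> \<le> \<bar>ln m\<bar> + ?e"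
    proof -
      have "ln m \<le> ln ?e" using me m(1) by simp
      moreover have "ln ?e \<le> ?e" using ln_bound[OF e0] .
      ultimately show ?thesis using e0 by linarith
    qed
    have "\<bar>?b * ln ?e\<bar> \<le> C * (\<bar>ln m\<bar> + ?e)"
      unfolding abs_mult using C(2)[OF j z] ln C(1) by (intro mult_mono) auto
    also have "\<dots> \<le> D * (1 + \<beta> j z * ?e)"
    proof (cases "z \<in> sq (ctr j) (rad j / 2)")
      case True
      have "c \<le> \<beta> j z" using bump_ge_half[OF True] by (simp add: c_def)
      then have "C * ?e \<le> C / c * (\<beta> j z * ?e)"
        using c C(1) e0 by (simp add: field_simps)
      also have "\<dots> \<le> D * (\<beta> j z * ?e)" using D(2) bump_nonneg e0 by (intro mult_right_mono) auto
      finally have "C * ?e \<le> D * (\<beta> j z * ?e)" .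
      moreover have "C * \<bar>ln m\<bar> \<le> C * (\<bar>ln m\<bar> + M')" using C(1) M' by simp
      ultimately show ?thesis using D(1) by (simp add: algebra_simps)
    next
      case False
      then have zK: "z \<in> ?K" using z half by blast
      have "?e * exp (- B * t) \<le> e0 (ch j) z" using e'_le_initial[OF j _ t] zK K by blast
      also have "\<dots> \<le> \<bar>M\<bar>" using bspec[OF M imageI[OF zK]] by simp
      finally have "?e \<le> \<bar>M\<bar> * exp (B * t)" by (simp add: exp_minus divide_inverse[symmetric] pos_divide_le_eq)
      also have "\<dots> \<le> M'" unfolding M'_def using B t by (intro mult_left_mono) auto
      finally have "C * (\<bar>ln m\<bar> + ?e) \<le> C * (\<bar>ln m\<bar> + M')" using C(1) by simp
      also have "\<dots> \<le> D * 1" using D(1) by simp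
      also have "\<dots> \<le> D * (1 + \<beta> j z * ?e)" using D(3) bump_nonneg[of "ctr j" "rad j" z] e0
        by (intro mult_left_mono) auto
      finally show ?thesis .
    qed
    finally show "- D * (1 + \<beta> j z * ?e) \<le> ?b * ln ?e" by linarith
  qed
qed

text \<open>Gronwall's inequality run backwards: the weighted area cannot fall too quickly, so its
  value at time \<open>\<delta> / 2\<close> bounds all earlier ones.\<close>

lemma area_bounded:
  assumes j: "j \<in> J"
  obtains N where "\<And>t. t \<in> {0<..\<delta> / 2} \<Longrightarrow> integral (box_of j) (\<lambda>z. \<beta> j z * e' (ch j) z t) \<le> N"
proof -
  obtain D where D: "D > 0" "\<And>t z. t \<in> {0<..<\<delta>} \<Longrightarrow> z \<in> box_of j \<Longrightarrow>
    bump_lap (ctr j) (rad j) z * ln (e' (ch j) z t) \<ge> - D * (1 + \<beta> j z * e' (ch j) z t)"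
    using bump_lap_ln_lower[OF j] by blast
  let ?a = "integral (box_of j) (\<lambda>z. 1::real)"
  let ?I = "\<lambda>t. integral (box_of j) (\<lambda>z. \<beta> j z * e' (ch j) z t)"
  \<comment> \<open>The area \<open>?a\<close> of the square absorbs the constant term of the
    differential inequality and makes \<open>?h\<close> nondecreasing.\<close>
  let ?h = "\<lambda>t. (?a + ?I t) * exp (D * t)"
  have a: "?a \<ge> 0" by (intro integral_nonneg continuous_on_sq_integrable) auto
  have h1: "?h s \<le> ?h (\<delta> / 2)" if s: "s \<in> {0<..\<delta> / 2}" for s
  proof (rule DERIV_nonneg_imp_nondecreasing[where f = ?h])
    fix t assume "s \<le> t" "t \<le> \<delta> / 2"
    then have t: "t \<in> {0<..<\<delta>}" using s by auto
    let ?d = "integral (box_of j) (\<lambda>z. bump_lap (ctr j) (rad j) z * ln (e' (ch j) z t))"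
    have "((\<lambda>t. ?a + ?I t) has_real_derivative ?d) (at t)"
      using DERIV_add[OF DERIV_const has_derivative_e'[OF j t], of ?a] by simp
    moreover have "((\<lambda>t. exp (D * t)) has_real_derivative D * exp (D * t)) (at t)"
      by (auto intro!: derivative_eq_intros)
    ultimately have "(?h has_real_derivative ?d * exp (D * t) + D * exp (D * t) * (?a + ?I t)) (at t)"
      by (rule DERIV_mult)
    moreover have "?d \<ge> - D * (?a + ?I t)"
    proof -
      have i: "(\<lambda>z. \<beta> j z * e' (ch j) z t) integrable_on box_of j" "(\<lambda>z. 1::real) integrable_on box_of j"
        using cont_box[OF j t] by (auto intro!: continuous_on_sq_integrable continuous_intros)
      have "- D * (?a + ?I t) = integral (box_of j) (\<lambda>z. - D * (1 + \<beta> j z * e' (ch j) z t))"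
        using integral_add[OF i(2,1)] by simp
      also have "\<dots> \<le> ?d"
        by (rule integral_le)
          (use cont_box[OF j t] D(2)[OF t] in \<open>auto intro!: continuous_on_sq_integrable continuous_intros simp del: minus_mult_left\<close>)
      finally show ?thesis .
    qed
    then have "(?d + D * (?a + ?I t)) * exp (D * t) \<ge> 0" by simp
    ultimately show "\<exists>y. (?h has_real_derivative y) (at t) \<and> 0 \<le> y"
      by (intro exI[of _ "?d * exp (D * t) + D * exp (D * t) * (?a + ?I t)"]) (simp add: algebra_simps)
  qed (use s in auto)
  have h2: "?I s \<le> ?h s" if s: "s \<in> {0<..\<delta> / 2}" for s
  proof -
    have t: "s \<in> {0<..<\<delta>}" using s by auto
    have "0 \<le> e' (ch j) z s" if "z \<in> box_of j" for z
      using e'_pos[OF j _ t, of z] box_sub[OF j] that by (auto intro: less_imp_le)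
    then have I: "?I s \<ge> 0"
      using cont_box[OF j t]
      by (intro integral_nonneg) (auto intro!: continuous_on_sq_integrable continuous_intros mult_nonneg_nonneg bump_nonneg)
    have "?I s * 1 \<le> (?a + ?I s) * exp (D * s)" using a I D(1) t by (intro mult_mono) auto
    then show ?thesis by simp
  qed
  show thesis by (rule that, rule order_trans[OF h2 h1])
qed

text \<open>Both flows converge to \<open>e0\<close> off the centre of the square, and
  \<open>\<beta> e0\<close> times a constant dominates the difference. That this dominating function
  is integrable at a cusp is the real content.\<close>

lemma area_difference_vanishes:
  assumes j: "j \<in> J"
  shows "(\<lambda>n. integral (box_of j) (\<lambda>z. \<beta> j z * (e' (ch j) z (\<delta> / real (n + 2)) - e (ch j) z (\<delta> / real (n + 2))))) \<longlonglongrightarrow> 0"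
proof -
  \<comment> \<open>The offset 2 places the whole sequence in the range of
    \<open>area_bounded\<close>.\<close>
  define \<tau> where "\<tau> n = \<delta> / real (n + 2)" for n
  have \<tau>: "\<tau> n \<in> {0<..\<delta> / 2}" "\<tau> n \<in> {0<..<\<delta>}" for n
    using \<delta>(1) by (auto simp: \<tau>_def field_simps add_pos_nonneg)
  have dec: "\<tau> (Suc n) \<le> \<tau> n" for n
    using \<delta>(1) by (auto simp: \<tau>_def intro!: divide_left_mono)
  have lim0: "\<tau> \<longlonglongrightarrow> 0"
    unfolding \<tau>_def by (rule LIMSEQ_ignore_initial_segment[OF lim_const_over_n])
  have lim: "filterlim \<tau> (at_right 0) sequentially"
    using lim0 \<tau>(2) by (auto intro!: tendsto_imp_filterlim_at_right)
  let ?S = "box_of j - {ctr j}"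
  have S: "?S \<subseteq> regular j" using bad[OF j] box_sub[OF j] by (auto simp: cusps_def)
  have neg: "negligible ((box_of j - ?S) \<union> (?S - box_of j))"
    by (rule negligible_subset[of "{ctr j}"]) auto
  have eqS1: "integral (box_of j) f = integral ?S f" for f :: "complex \<Rightarrow> real"
    by (rule integral_spike_set; rule negligible_subset[of "{ctr j}"]) auto
  have eqS2: "f integrable_on box_of j \<longleftrightarrow> f integrable_on ?S" for f :: "complex \<Rightarrow> real"
    by (rule integrable_spike_set_eq[OF neg])
  have lim': "(\<lambda>n. e' (ch j) z (\<tau> n)) \<longlonglongrightarrow> e0 (ch j) z" "(\<lambda>n. e (ch j) z (\<tau> n)) \<longlonglongrightarrow> e0 (ch j) z" if "z \<in> ?S" for z
    using filterlim_compose[OF pointwise_limit(1)[OF j subsetD[OF S that]] lim]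
      filterlim_compose[OF pointwise_limit(2)[OF j subsetD[OF S that]] lim] .
  have pos: "0 \<le> e' (ch j) z (\<tau> n)" if "z \<in> box_of j" for z n
    using e'_pos[OF j _ \<tau>(2)] that box_sub[OF j] by (auto intro: less_imp_le)
  have i: "(\<lambda>z. \<beta> j z * (e' (ch j) z (\<tau> n) * exp (- B * \<tau> n))) integrable_on box_of j" for n
    using cont_box[OF j \<tau>(2)] by (auto intro!: continuous_on_sq_integrable continuous_intros)
  obtain N where N: "\<And>t. t \<in> {0<..\<delta> / 2} \<Longrightarrow> integral (box_of j) (\<lambda>z. \<beta> j z * e' (ch j) z t) \<le> N"
    using area_bounded[OF j] by blast
  \<comment> \<open>By \<open>e'_decay\<close> the exponential factor makes the sequence increasing
    in \<open>n\<close>, while \<open>area_bounded\<close> bounds its integrals; monotone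
    convergence then shows that the limit is integrable.\<close>
  have h: "(\<lambda>z. \<beta> j z * (e0 (ch j) z * exp (- B * 0))) integrable_on ?S"
  proof (rule conjunct1[OF monotone_convergence_increasing])
    show "(\<lambda>z. \<beta> j z * (e' (ch j) z (\<tau> n) * exp (- B * \<tau> n))) integrable_on ?S" for n using i eqS2 by blast
    show "\<beta> j z * (e' (ch j) z (\<tau> n) * exp (- B * \<tau> n)) \<le> \<beta> j z * (e' (ch j) z (\<tau> (Suc n)) * exp (- B * \<tau> (Suc n)))"
      if "z \<in> ?S" for n z
      using e'_decay[OF j, of z "\<tau> (Suc n)" "\<tau> n"] that box_sub[OF j] \<tau>[of n] \<tau>[of "Suc n"] dec[of n]
      by (intro mult_left_mono bump_nonneg) auto
    show "(\<lambda>n. \<beta> j z * (e' (ch j) z (\<tau> n) * exp (- B * \<tau> n))) \<longlonglongrightarrow> \<beta> j z * (e0 (ch j) z * exp (- B * 0))" if "z \<in> ?S" for z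
      by (intro tendsto_intros lim'(1)[OF that] lim0)
    have "\<bar>integral ?S (\<lambda>z. \<beta> j z * (e' (ch j) z (\<tau> n) * exp (- B * \<tau> n)))\<bar> \<le> N" for n
    proof -
      have "0 \<le> integral (box_of j) (\<lambda>z. \<beta> j z * (e' (ch j) z (\<tau> n) * exp (- B * \<tau> n)))"
        using i pos bump_nonneg by (intro integral_nonneg) auto
      moreover have "integral (box_of j) (\<lambda>z. \<beta> j z * (e' (ch j) z (\<tau> n) * exp (- B * \<tau> n)))
          \<le> integral (box_of j) (\<lambda>z. \<beta> j z * e' (ch j) z (\<tau> n))"
      proof (rule integral_le[OF i])
        show "(\<lambda>z. \<beta> j z * e' (ch j) z (\<tau> n)) integrable_on box_of j"
          using cont_box[OF j \<tau>(2)] by (auto intro!: continuous_on_sq_integrable continuous_intros)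
        fix z assume z: "z \<in> box_of j"
        have "exp (- B * \<tau> n) \<le> 1" using B \<tau>(2)[of n] by simp
        then show "\<beta> j z * (e' (ch j) z (\<tau> n) * exp (- B * \<tau> n)) \<le> \<beta> j z * e' (ch j) z (\<tau> n)"
          using pos[OF z] by (intro mult_left_mono bump_nonneg mult_left_le)
      qed
      ultimately show ?thesis using N[OF \<tau>(1)] eqS1 by (metis abs_of_nonneg order_trans)
    qed
    then show "bounded (range (\<lambda>n. integral ?S (\<lambda>z. \<beta> j z * (e' (ch j) z (\<tau> n) * exp (- B * \<tau> n)))))"
      unfolding bounded_iff by (intro exI[of _ N]) auto
  qed
  \<comment> \<open>Domination uses \<open>0 < e \<le> e'\<close>, so that the difference is at most
    \<open>e'\<close>, which is at most \<open>exp (B * \<delta>)\<close> times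
    \<open>e0\<close>.\<close>
  have "(\<lambda>n. integral ?S (\<lambda>z. \<beta> j z * (e' (ch j) z (\<tau> n) - e (ch j) z (\<tau> n)))) \<longlonglongrightarrow> integral ?S (\<lambda>z. \<beta> j z * (e0 (ch j) z - e0 (ch j) z))"
  proof (rule dominated_convergence(2))
    show "(\<lambda>z. \<beta> j z * (e' (ch j) z (\<tau> n) - e (ch j) z (\<tau> n))) integrable_on ?S" for n
      using cont_box[OF j \<tau>(2)] unfolding eqS2[symmetric] by (auto intro!: continuous_on_sq_integrable continuous_intros)
    show "(\<lambda>z. exp (B * \<delta>) * (\<beta> j z * (e0 (ch j) z * exp (- B * 0)))) integrable_on ?S"
      using h by (rule integrable_on_mult_right)
    show "norm (\<beta> j z * (e' (ch j) z (\<tau> n) - e (ch j) z (\<tau> n))) \<le> exp (B * \<delta>) * (\<beta> j z * (e0 (ch j) z * exp (- B * 0)))"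
      if z: "z \<in> ?S" for n z
    proof -
      have zb: "z \<in> box_of j" using z by auto
      have "0 \<le> e' (ch j) z (\<tau> n) - e (ch j) z (\<tau> n)" using e_le_e'[OF j zb \<tau>(2)] by simp
      moreover have "e (ch j) z (\<tau> n) > 0"
        using log_diffusionD(2)[OF e_log[OF j], of z "\<tau> n"] zb box_sub[OF j] \<tau>(2)[of n] \<delta> by auto
      moreover have "e' (ch j) z (\<tau> n) \<le> exp (B * \<delta>) * e0 (ch j) z"
      proof -
        have *: "e' (ch j) z (\<tau> n) * exp (- B * \<tau> n) \<le> e0 (ch j) z" using e'_le_initial[OF j _ \<tau>(2)] S z by blast
        then have "e' (ch j) z (\<tau> n) \<le> e0 (ch j) z * exp (B * \<tau> n)" by (simp add: exp_minus divide_inverse[symmetric] pos_divide_le_eq)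
        also have "\<dots> \<le> e0 (ch j) z * exp (B * \<delta>)"
        proof (rule mult_left_mono)
          show "exp (B * \<tau> n) \<le> exp (B * \<delta>)" using B \<tau>(2)[of n] by simp
          show "0 \<le> e0 (ch j) z" using * pos[OF zb, of n] by (smt (verit) exp_ge_zero mult_nonneg_nonneg)
        qed
        finally show ?thesis by (simp add: mult.commute)
      qed
      ultimately have "\<beta> j z * \<bar>e' (ch j) z (\<tau> n) - e (ch j) z (\<tau> n)\<bar> \<le> \<beta> j z * (exp (B * \<delta>) * e0 (ch j) z)"
        by (intro mult_left_mono bump_nonneg) auto
      then show ?thesis using bump_nonneg[of "ctr j" "rad j" z] by (simp add: abs_mult mult.left_commute)
    qed
    show "(\<lambda>n. \<beta> j z * (e' (ch j) z (\<tau> n) - e (ch j) z (\<tau> n))) \<longlonglongrightarrow> \<beta> j z * (e0 (ch j) z - e0 (ch j) z)" if "z \<in> ?S" for z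
      by (intro tendsto_intros lim'[OF that])
  qed
  then show ?thesis unfolding eqS1 \<tau>_def by simp
qed

text \<open>The total weighted area difference \<open>I\<close> is nonnegative, satisfies
  \<open>I' \<le> L I\<close> and tends to 0 along a sequence of times decreasing to 0. It therefore
  vanishes, and so does the nonnegative continuous integrand on the half squares, where
  \<open>\<beta>\<close> is positive.\<close>

lemma flows_agree:
  assumes t: "t \<in> {0<..<\<delta>}" and j: "j \<in> J" and z: "z \<in> sq (ctr j) (rad j / 2)"
  shows "e' (ch j) z t = e (ch j) z t"
proof -
  obtain C where C: "C > 0" "\<And>j z. j \<in> J \<Longrightarrow> z \<in> box_of j \<Longrightarrow> \<bar>bump_lap (ctr j) (rad j) z\<bar> \<le> C"
    using bump_lap_bound by blast
  obtain m where m: "m > 0" "\<And>j z t. j \<in> J \<Longrightarrow> z \<in> box_of j \<Longrightarrow> t \<in> {0<..T} \<Longrightarrow> m \<le> e (ch j) z t"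
    using e_lower_bound by blast
  let ?half = "\<lambda>j. sq (ctr j) (rad j / 2)"
  let ?F = "\<lambda>j t z. e' (ch j) z t - e (ch j) z t"
  define c where "c = Min ((\<lambda>j. ((rad j)\<^sup>2 / 2) ^ 4) ` J)"
  have c: "c > 0" "\<And>j. j \<in> J \<Longrightarrow> c \<le> ((rad j)\<^sup>2 / 2) ^ 4"
  proof -
    have "(\<lambda>j. ((rad j)\<^sup>2 / 2) ^ 4) ` J \<noteq> {}" using j by auto
    then show "c > 0" unfolding c_def using fin rad by (subst Min_gr_iff) force+
    show "c \<le> ((rad j)\<^sup>2 / 2) ^ 4" if "j \<in> J" for j unfolding c_def using fin that by simp
  qed
  define I where "I t = (\<Sum>j\<in>J. integral (box_of j) (\<lambda>z. \<beta> j z * ?F j t z))" for t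
  have F: "?F j t z \<ge> 0" if "j \<in> J" "z \<in> box_of j" "t \<in> {0<..<\<delta>}" for j z t
    using e_le_e'[OF that] by simp
  have Fi: "(?F j t) integrable_on box_of j" "(\<lambda>z. \<beta> j z * ?F j t z) integrable_on box_of j"
    "(?F j t) integrable_on ?half j" "(\<lambda>z. \<beta> j z * ?F j t z) integrable_on ?half j" if "j \<in> J" "t \<in> {0<..<\<delta>}" for j t
    using cont_box[OF that] continuous_on_subset[OF _ half_box_sub[OF that(1)]]
    by (auto intro!: continuous_on_sq_integrable continuous_intros)
  have half_le: "c * integral (?half j) (?F j t) \<le> integral (box_of j) (\<lambda>z. \<beta> j z * ?F j t z)"
    if j: "j \<in> J" and t: "t \<in> {0<..<\<delta>}" for j t
  proof -
    have "c * integral (?half j) (?F j t) = integral (?half j) (\<lambda>z. c * ?F j t z)" by simp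
    also have "\<dots> \<le> integral (?half j) (\<lambda>z. \<beta> j z * ?F j t z)"
    proof (rule integral_le)
      show "(\<lambda>z. c * ?F j t z) integrable_on ?half j" using Fi(3)[OF j t] by (rule integrable_on_mult_right)
      show "c * ?F j t z \<le> \<beta> j z * ?F j t z" if "z \<in> ?half j" for z
        using bump_ge_half[OF that] c(2)[OF j] F[OF j _ t] half_box_sub[OF j] that
        by (intro mult_right_mono) auto
    qed (rule Fi(4)[OF j t])
    also have "\<dots> \<le> integral (box_of j) (\<lambda>z. \<beta> j z * ?F j t z)"
      using Fi(2,4)[OF j t] half_box_sub[OF j] F[OF j _ t] bump_nonneg by (intro integral_subset_le) auto
    finally show ?thesis .
  qed
  \<comment> \<open>\<open>C\<close> bounds the Laplacian of the bumps and \<open>1 / m\<close> is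
    the Lipschitz constant of the logarithm; \<open>card J / c\<close> is the price of bounding all
    unweighted integrals over full squares by \<open>I\<close>.\<close>
  define L where "L = C / m * (real (card J) / c)"
  have L: "L \<ge> 0" using C(1) m(1) c(1) by (simp add: L_def)
  let ?dI = "\<lambda>t. \<Sum>j\<in>J. integral (box_of j) (\<lambda>z. bump_lap (ctr j) (rad j) z * ln (e' (ch j) z t))
      - integral (box_of j) (\<lambda>z. bump_lap (ctr j) (rad j) z * ln (e (ch j) z t))"
  have dI: "(I has_real_derivative ?dI s) (at s)" if s: "s \<in> {0<..<\<delta>}" for s
  proof -
    have "I t = (\<Sum>j\<in>J. integral (box_of j) (\<lambda>z. \<beta> j z * e' (ch j) z t) - integral (box_of j) (\<lambda>z. \<beta> j z * e (ch j) z t))"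
      if "t \<in> {0<..<\<delta>}" for t
      unfolding I_def
    proof (rule sum.cong[OF refl])
      fix j assume "j \<in> J"
      then have "(\<lambda>z. \<beta> j z * e' (ch j) z t) integrable_on box_of j" "(\<lambda>z. \<beta> j z * e (ch j) z t) integrable_on box_of j"
        using cont_box[OF _ that] by (auto intro!: continuous_on_sq_integrable continuous_intros)
      from integral_diff[OF this] show "integral (box_of j) (\<lambda>z. \<beta> j z * ?F j t z) =
        integral (box_of j) (\<lambda>z. \<beta> j z * e' (ch j) z t) - integral (box_of j) (\<lambda>z. \<beta> j z * e (ch j) z t)"
        by (simp add: right_diff_distrib)
    qed
    moreover have "((\<lambda>t. \<Sum>j\<in>J. integral (box_of j) (\<lambda>z. \<beta> j z * e' (ch j) z t) - integral (box_of j) (\<lambda>z. \<beta> j z * e (ch j) z t))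
        has_real_derivative ?dI s) (at s)"
      by (intro DERIV_sum DERIV_diff has_derivative_e' has_derivative_e s)
    ultimately show ?thesis
      using has_field_derivative_transform_within_open[of _ _ s "{0<..<\<delta>}" I] s by simp
  qed
  have dI_le: "?dI s \<le> L * I s" if s: "s \<in> {0<..<\<delta>}" for s
  proof -
    have "integral (box_of j) (\<lambda>z. bump_lap (ctr j) (rad j) z * ln (e' (ch j) z s))
      - integral (box_of j) (\<lambda>z. bump_lap (ctr j) (rad j) z * ln (e (ch j) z s)) \<le> C / m * integral (box_of j) (?F j s)"
      if j: "j \<in> J" for j
    proof -
      have i: "(\<lambda>z. bump_lap (ctr j) (rad j) z * ln (e' (ch j) z s)) integrable_on box_of j"
        "(\<lambda>z. bump_lap (ctr j) (rad j) z * ln (e (ch j) z s)) integrable_on box_of j"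
        using cont_box[OF j s] by (auto intro!: continuous_on_sq_integrable continuous_intros)
      have "integral (box_of j) (\<lambda>z. bump_lap (ctr j) (rad j) z * ln (e' (ch j) z s))
        - integral (box_of j) (\<lambda>z. bump_lap (ctr j) (rad j) z * ln (e (ch j) z s))
        = integral (box_of j) (\<lambda>z. bump_lap (ctr j) (rad j) z * ln (e' (ch j) z s) - bump_lap (ctr j) (rad j) z * ln (e (ch j) z s))"
        using integral_diff[OF i] by simp
      also have "\<dots> \<le> integral (box_of j) (\<lambda>z. C / m * ?F j s z)"
      proof (rule integral_le[OF integrable_diff[OF i] integrable_on_mult_right[OF Fi(1)[OF j s]]])
        fix z assume z: "z \<in> box_of j"
        let ?x = "e' (ch j) z s" and ?y = "e (ch j) z s"
        have y: "m \<le> ?y" using m(2)[OF j z, of s] s \<delta> by auto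
        have yx: "?y \<le> ?x" using e_le_e'[OF j z s] .
        have "ln ?x - ln ?y = ln (?x / ?y)" using y yx m(1) by (simp add: ln_divide_pos)
        also have "\<dots> \<le> ?x / ?y - 1" using y yx m(1) by (intro ln_le_minus_one) auto
        also have "\<dots> = ?F j s z / ?y" using y m(1) by (simp add: field_simps)
        also have "\<dots> \<le> ?F j s z / m" using y yx m(1) by (intro divide_left_mono) auto
        finally have "ln ?x - ln ?y \<le> ?F j s z / m" .
        \<comment> \<open>The Laplacian of the bump changes sign, but as it multiplies a nonnegative
          quantity its upper bound \<open>C\<close> suffices.\<close>
        moreover have "0 \<le> ln ?x - ln ?y" using y yx m(1) by simp
        moreover have "bump_lap (ctr j) (rad j) z \<le> C" using C(2)[OF j z] by simp
        ultimately have "bump_lap (ctr j) (rad j) z * (ln ?x - ln ?y) \<le> C * (?F j s z / m)"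
          using C(1) by (intro order_trans[OF mult_right_mono mult_left_mono]) auto
        then show "bump_lap (ctr j) (rad j) z * ln ?x - bump_lap (ctr j) (rad j) z * ln ?y \<le> C / m * ?F j s z"
          by (simp add: right_diff_distrib diff_divide_distrib)
      qed
      also have "\<dots> = C / m * integral (box_of j) (?F j s)" by simp
      finally show ?thesis .
    qed
    then have "?dI s \<le> (\<Sum>j\<in>J. C / m * integral (box_of j) (?F j s))" by (intro sum_mono)
    \<comment> \<open>The unweighted integral over a full square is not controlled by its own bump
      near the edge; it is replaced by integrals over half squares, each controlled by the bump of
      its own square.\<close>
    also have "\<dots> \<le> (\<Sum>j\<in>J. C / m * (I s / c))"
    proof (rule sum_mono)
      fix i assume i: "i \<in> J"
      have s': "s \<in> {0<..T}" using s \<delta> by auto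
      have "conf_density A (\<lambda>c z. e' c z s)" "conf_density A (\<lambda>c z. e c z s)"
        using e'_flow e_flow s s' by (auto simp: conf_flow_def)
      then have "conf_density A (\<lambda>c z. e' c z s - e c z s)"
        unfolding conf_density_def by (metis (no_types, lifting) left_diff_distrib)
      moreover have "continuous_on (cdom (ch j)) (?F j s)" if "j \<in> J" for j
        using log_diffusionD(3)[OF e'_log[OF that] s] log_diffusionD(3)[OF e_log[OF that] s']
        by (auto simp: C2_def intro!: continuous_intros)
      ultimately have "integral (box_of i) (?F i s) \<le> (\<Sum>j\<in>J. integral (?half j) (?F j s))"
        using integral_box_le[of "\<lambda>c z. e' c z s - e c z s" i] F[OF _ _ s] i by blast
      also have "\<dots> \<le> (\<Sum>j\<in>J. integral (box_of j) (\<lambda>z. \<beta> j z * ?F j s z) / c)"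
        using half_le[OF _ s] c(1) by (intro sum_mono) (simp add: pos_le_divide_eq mult.commute)
      also have "\<dots> = I s / c" by (simp add: I_def sum_divide_distrib)
      finally show "C / m * integral (box_of i) (?F i s) \<le> C / m * (I s / c)"
        using C(1) m(1) by (intro mult_left_mono) auto
    qed
    also have "\<dots> = L * I s" by (simp add: L_def)
    finally show ?thesis .
  qed
  let ?h = "\<lambda>t. I t * exp (- L * t)"
  have dec: "?h t \<le> ?h s" if "0 < s" "s \<le> t" for s
  proof (rule DERIV_nonpos_imp_nonincreasing[where f = ?h, OF that(2)])
    fix u assume "s \<le> u" "u \<le> t"
    then have u: "u \<in> {0<..<\<delta>}" using that t by auto
    have "(?h has_real_derivative ?dI u * exp (- L * u) + (- L * exp (- L * u)) * I u) (at u)"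
      by (intro DERIV_mult dI[OF u]) (auto intro!: derivative_eq_intros)
    moreover have "(?dI u - L * I u) * exp (- L * u) \<le> 0"
      using dI_le[OF u] by (intro mult_nonpos_nonneg) auto
    ultimately show "\<exists>y. (?h has_real_derivative y) (at u) \<and> y \<le> 0"
      by (intro exI[of _ "?dI u * exp (- L * u) + (- L * exp (- L * u)) * I u"]) (simp add: algebra_simps)
  qed
  have I0: "(\<lambda>n. I (\<delta> / real (n + 2))) \<longlonglongrightarrow> 0"
    unfolding I_def using tendsto_sum[of J, OF area_difference_vanishes] by simp
  have "?h t \<le> 0"
  proof (rule LIMSEQ_le_const)
    have "(\<lambda>n. \<delta> / real (n + 2)) \<longlonglongrightarrow> 0" by (rule LIMSEQ_ignore_initial_segment[OF lim_const_over_n])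
    then have "(\<lambda>n. exp (- L * (\<delta> / real (n + 2)))) \<longlonglongrightarrow> exp (- L * 0)" by (intro tendsto_intros)
    from tendsto_mult[OF I0 this] show "(\<lambda>n. ?h (\<delta> / real (n + 2))) \<longlonglongrightarrow> 0" by simp
    have "\<forall>\<^sub>F n in sequentially. \<delta> / real (n + 2) < t"
      using order_tendstoD(2)[OF \<open>(\<lambda>n. \<delta> / real (n + 2)) \<longlonglongrightarrow> 0\<close>] t by auto
    then obtain N where "\<And>n. n \<ge> N \<Longrightarrow> \<delta> / real (n + 2) < t" by (auto simp: eventually_sequentially)
    then show "\<exists>N. \<forall>n\<ge>N. ?h t \<le> ?h (\<delta> / real (n + 2))"
      using dec \<delta>(1) by (intro exI[of _ N] allI impI dec) (auto intro: less_imp_le)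
  qed
  then have "I t \<le> 0" by (simp add: mult_le_0_iff)
  moreover have "integral (box_of j) (\<lambda>z. \<beta> j z * ?F j t z) \<le> I t"
    unfolding I_def
    using F t bump_nonneg Fi by (intro member_le_sum[OF j _ fin] integral_nonneg) auto
  ultimately have "c * integral (?half j) (?F j t) \<le> 0" using half_le[OF j t] by linarith
  then have "integral (?half j) (?F j t) \<le> 0" using c(1) by (simp add: mult_le_0_iff)
  moreover have Fh: "?F j t z \<ge> 0" if "z \<in> ?half j" for z using F[OF j _ t] half_box_sub[OF j] that by blast
  then have "integral (?half j) (?F j t) \<ge> 0" by (intro integral_nonneg Fi(3)[OF j t]) auto
  ultimately have "integral (?half j) (?F j t) = 0" by simp
  moreover have "continuous_on (?half j) (?F j t)"
    using cont_box[OF j t] continuous_on_subset[OF _ half_box_sub[OF j]] by (auto intro!: continuous_intros)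
  moreover have "box (ctr j - Complex (rad j / 2) (rad j / 2)) (ctr j + Complex (rad j / 2) (rad j / 2)) \<noteq> {}"
  proof -
    have "ctr j \<in> box (ctr j - Complex (rad j / 2) (rad j / 2)) (ctr j + Complex (rad j / 2) (rad j / 2))"
      using rad[OF j] by (simp add: in_box_complex_iff)
    then show ?thesis by blast
  qed
  ultimately have "\<forall>z\<in>?half j. ?F j t z = 0"
    using integral_cbox_eq_0_iff[of _ _ "?F j t"] Fh unfolding sq_def by blast
  then show ?thesis using z by simp
qed

end

section \<open>Ricci flows as conformal logarithmic diffusions\<close>

text \<open>\<open>conformal\<close> without positivity, with the factor read off as
  \<open>g c p 1 1\<close>. In this form it is an equation between components, which passes to
  limits and along the flow.\<close>

definition isothermal :: "'a coord set \<Rightarrow> 'a set \<Rightarrow> 'a metric_tensor \<Rightarrow> bool" where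
  "isothermal A N g \<longleftrightarrow> (\<forall>c\<in>A. \<forall>p\<in>fst c \<inter> N. \<forall>v w. g c p v w = g c p 1 1 * (v \<bullet> w))"

lemma conformal_isothermal:
  assumes "conformal A N g"
  shows "isothermal A N g" and "c \<in> A \<Longrightarrow> p \<in> fst c \<inter> N \<Longrightarrow> g c p 1 1 > 0"
proof -
  have *: "\<exists>u. \<forall>v w. g c p v w = exp (2 * u) * (v \<bullet> w)" if "c \<in> A" "p \<in> fst c \<inter> N" for c p
    using assms that by (auto simp: conformal_def)
  then show "c \<in> A \<Longrightarrow> p \<in> fst c \<inter> N \<Longrightarrow> g c p 1 1 > 0" by fastforce
  show "isothermal A N g"
    unfolding isothermal_def
  proof (intro ballI allI)
    fix c p v w assume "c \<in> A" "p \<in> fst c \<inter> N"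
    then obtain u where u: "\<And>v w. g c p v w = exp (2 * u) * (v \<bullet> w)" using * by blast
    show "g c p v w = g c p 1 1 * (v \<bullet> w)" unfolding u by simp
  qed
qed

lemma smooth_on_continuous: "smooth_on S f \<Longrightarrow> continuous_on S f"
  unfolding smooth_on_def by (metis Ck_on.simps(1))

lemma coeff_chart:
  assumes "riemann_surface X A" "c \<in> A" "p \<in> fst c"
  shows "coeff g c v w (snd c p) = g c p v w"
  using riemann_surface_chart(2)[OF assms(1,2)] assms(3) by (simp add: coeff_def)

lemma mem_cdomE:
  assumes "z \<in> cdom c"
  obtains p where "p \<in> fst c" "snd c p = z"
  using assms by (auto simp: cdom_def)

lemma cdom_minus:
  assumes "riemann_surface X A" "c \<in> A"
  shows "cdom c - snd c ` (fst c \<inter> P) = snd c ` (fst c \<inter> (topspace X - P))"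
proof -
  note i = riemann_surface_chart(2,3)[OF assms]
  have "fst c \<inter> (topspace X - P) = fst c - fst c \<inter> P" using i(2) by blast
  then show ?thesis using inj_on_image_set_diff[OF i(1), of "fst c" "fst c \<inter> P"] by (simp add: cdom_def)
qed

lemma ricci_flowD:
  assumes "ricci_flow X A I g"
  shows "t \<in> I \<Longrightarrow> riemannian_metric A (topspace X) (g t)"
    and "c \<in> A \<Longrightarrow> smooth_on (cdom c \<times> I) (\<lambda>(z, t). coeff (g t) c v w z)"
    and "t \<in> I \<Longrightarrow> c \<in> A \<Longrightarrow> p \<in> fst c \<Longrightarrow> ((\<lambda>s. g s c p v w) has_real_derivative
           - 2 * gauss_curvature (g t) c p * g t c p v w) (at t within I)"
proof -
  note * = assms[unfolded ricci_flow_def]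
  show "t \<in> I \<Longrightarrow> riemannian_metric A (topspace X) (g t)"
    by (rule bspec[OF conjunct1[OF *]])
  show "c \<in> A \<Longrightarrow> smooth_on (cdom c \<times> I) (\<lambda>(z, t). coeff (g t) c v w z)"
    unfolding cdom_def by (rule conjunct1[OF conjunct2[OF *], rule_format])
  show "t \<in> I \<Longrightarrow> c \<in> A \<Longrightarrow> p \<in> fst c \<Longrightarrow> ((\<lambda>s. g s c p v w) has_real_derivative
           - 2 * gauss_curvature (g t) c p * g t c p v w) (at t within I)"
    by (rule conjunct2[OF conjunct2[OF *], rule_format])
qed

lemma riemannian_metric_pos:
  assumes g: "riemannian_metric A N g" and c: "c \<in> A" and p: "p \<in> fst c \<inter> N"
  shows "g c p 1 1 > 0"
  using bspec[OF bspec[OF conjunct1[OF g[unfolded riemannian_metric_def]] c] p] by simp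

text \<open>At a fixed point all components solve the same linear equation, with coefficient
  \<open>- 2 K\<close>, whether or not the metric is conformal.\<close>

lemma ricci_flow_ratio_constant:
  assumes X: "riemann_surface X A" and g: "ricci_flow X A I g" and I: "convex I" and c: "c \<in> A" and p: "p \<in> fst c"
  shows "\<exists>k. \<forall>t\<in>I. g t c p v w = k * g t c p 1 1"
proof -
  have pos: "g t c p 1 1 > 0" if "t \<in> I" for t
    using riemannian_metric_pos[OF ricci_flowD(1)[OF g that] c] p riemann_surface_chart(3)[OF X c] by blast
  have "((\<lambda>t. g t c p v w / g t c p 1 1) has_derivative (\<lambda>h. 0)) (at t within I)" if t: "t \<in> I" for t
  proof -
    let ?K = "gauss_curvature (g t) c p"
    have "((\<lambda>t. g t c p v w / g t c p 1 1) has_real_derivative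
       ((- 2 * ?K * g t c p v w) * g t c p 1 1 - g t c p v w * (- 2 * ?K * g t c p 1 1)) / (g t c p 1 1 * g t c p 1 1)) (at t within I)"
      by (rule DERIV_divide[OF ricci_flowD(3)[OF g t c p] ricci_flowD(3)[OF g t c p]]) (use pos[OF t] in simp)
    then have "((\<lambda>t. g t c p v w / g t c p 1 1) has_real_derivative 0) (at t within I)" by simp
    moreover have "(*) (0::real) = (\<lambda>h. 0)" by auto
    ultimately show ?thesis by (simp only: has_field_derivative_def)
  qed
  from has_derivative_zero_constant[OF I this]
  obtain k where k: "\<forall>t\<in>I. g t c p v w / g t c p 1 1 = k" ..
  show ?thesis
  proof (intro exI[of _ k] ballI)
    fix t assume t: "t \<in> I"
    have "g t c p v w / g t c p 1 1 = k" using k t by blast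
    then show "g t c p v w = k * g t c p 1 1" using pos[OF t] by (simp add: divide_eq_eq)
  qed
qed

lemma ricci_flow_isothermal:
  assumes X: "riemann_surface X A" and g: "ricci_flow X A I g" and I: "convex I"
    and s: "s \<in> I" and iso: "isothermal A (topspace X) (g s)" and t: "t \<in> I"
  shows "isothermal A (topspace X) (g t)"
  unfolding isothermal_def
proof (intro ballI allI)
  fix c p v w assume c: "c \<in> A" and p: "p \<in> fst c \<inter> topspace X"
  obtain k where k: "\<forall>t\<in>I. g t c p v w = k * g t c p 1 1"
    using ricci_flow_ratio_constant[OF X g I c IntD1[OF p], of v w] ..
  have "g s c p v w = g s c p 1 1 * (v \<bullet> w)" using iso[unfolded isothermal_def, rule_format, OF c p] .
  moreover have "g s c p 1 1 > 0" using riemannian_metric_pos[OF ricci_flowD(1)[OF g s] c p] .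
  ultimately have "k = v \<bullet> w" using bspec[OF k s] by simp
  then show "g t c p v w = g t c p 1 1 * (v \<bullet> w)" using bspec[OF k t] by simp
qed

text \<open>At a regular point the constant ratio is identified by its limit in \<open>g0\<close> as
  \<open>t \<down> 0\<close>. The punctures are isolated, so the identity extends to them by
  continuity of \<open>g t\<close>.\<close>

lemma ricci_flow_isothermal_limit:
  assumes X: "riemann_surface X A" and g: "ricci_flow X A I g" and I: "convex I"
    and \<epsilon>: "\<epsilon> > 0" "{0<..<\<epsilon>} \<subseteq> I" and fin: "finite P"
    and g0: "conformal A (topspace X - P) g0" and lim: "converges_smoothly_locally A (topspace X - P) g g0"
    and t: "t \<in> I"
  shows "isothermal A (topspace X) (g t)"
  unfolding isothermal_def
proof (intro ballI allI)
  fix c q v w assume c: "c \<in> A" and q: "q \<in> fst c \<inter> topspace X"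
  note chart = riemann_surface_chart[OF X c]
  have regular: "g t c p v w = g t c p 1 1 * (v \<bullet> w)" if p: "p \<in> fst c" "p \<notin> P" for p
  proof -
    have pN: "p \<in> fst c \<inter> (topspace X - P)" using p chart(3) by blast
    have tend: "((\<lambda>s. g s c p v w) \<longlongrightarrow> g0 c p v w) (at_right 0)" for v w
    proof -
      have "compact {snd c p} \<and> {snd c p} \<subseteq> snd c ` (fst c \<inter> (topspace X - P))" using pN by auto
      from lim[unfolded converges_smoothly_locally_def, rule_format, OF c this, of "[]" v w]
      have "uniform_limit {snd c p} (\<lambda>s. foldr pd [] (coeff (g s) c v w)) (foldr pd [] (coeff g0 c v w)) (at_right 0)" .
      from tendsto_uniform_limitI[OF this, of "snd c p"] show ?thesis
        by (simp add: coeff_chart[OF X c p(1)])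
    qed
    obtain k where k: "\<forall>s\<in>I. g s c p v w = k * g s c p 1 1"
      using ricci_flow_ratio_constant[OF X g I c p(1), of v w] ..
    have "\<forall>\<^sub>F s in at_right 0. g s c p v w = k * g s c p 1 1"
      unfolding eventually_at_right_field using \<epsilon> k by (intro exI[of _ \<epsilon>]) auto
    then have "((\<lambda>s. k * g s c p 1 1) \<longlongrightarrow> g0 c p v w) (at_right 0)"
      using tend[of v w] tendsto_cong by force
    moreover have "((\<lambda>s. k * g s c p 1 1) \<longlongrightarrow> k * g0 c p 1 1) (at_right 0)"
      by (intro tendsto_intros tend)
    ultimately have "g0 c p v w = k * g0 c p 1 1" by (rule tendsto_unique[rotated]) simp
    moreover have "g0 c p v w = g0 c p 1 1 * (v \<bullet> w)"
      using conformal_isothermal(1)[OF g0] c pN unfolding isothermal_def by blast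
    moreover have "g0 c p 1 1 > 0" using conformal_isothermal(2)[OF g0 c pN] .
    ultimately have "k = v \<bullet> w" by simp
    then show ?thesis using bspec[OF k t] by simp
  qed
  let ?D = "\<lambda>z. coeff (g t) c v w z - coeff (g t) c 1 1 z * (v \<bullet> w)"
  let ?z = "snd c q"
  have z: "?z \<in> cdom c" using q by (simp add: cdom_def)
  have "snd c ` (fst c \<inter> topspace X) = cdom c" using chart(3) by (simp add: cdom_def Int_absorb2)
  then have sm: "continuous_on (cdom c) (coeff (g t) c v w)" for v w
    using ricci_flowD(1)[OF g t] c smooth_on_continuous unfolding riemannian_metric_def by metis
  then have "continuous_on (cdom c) ?D" by (intro continuous_intros)
  then have "isCont ?D ?z" using chart(1) z continuous_on_eq_continuous_at by blast
  then have lim1: "(?D \<longlongrightarrow> ?D ?z) (at ?z)" by (simp add: isCont_def)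
  \<comment> \<open>The other punctures are removed, so that every point of \<open>?U\<close> except
    possibly \<open>q\<close> itself is regular.\<close>
  let ?U = "cdom c - snd c ` (fst c \<inter> P - {q})"
  have "open ?U" using chart(1) fin by (intro open_Diff finite_imp_closed) auto
  moreover have "?z \<in> ?U" using z q inj_onD[OF chart(2)] by auto
  ultimately have "\<forall>\<^sub>F w in at ?z. w \<in> ?U - {?z}" by (rule eventually_at_in_open)
  then have "\<forall>\<^sub>F z in at ?z. ?D z = 0"
  proof eventually_elim
    case (elim y)
    then have "y \<in> cdom c" by blast
    then obtain p where p: "p \<in> fst c" "snd c p = y" by (rule mem_cdomE)
    have "p \<notin> P" using elim p by blast
    then show ?case using regular[OF p(1)] coeff_chart[OF X c p(1)] p(2) by auto
  qed
  then have "(?D \<longlongrightarrow> 0) (at ?z)" by (rule tendsto_eventually)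
  then have "?D ?z = 0" using tendsto_unique[OF at_neq_bot lim1] by blast
  then show "g t c q v w = g t c q 1 1 * (v \<bullet> w)" using coeff_chart[OF X c] q by simp
qed

text \<open>The candidate is the total derivative in the direction \<open>(0, 1)\<close>. Its joint
  continuity in space and time is what \<open>log_diffusion\<close> requires.\<close>

lemma smooth_on_time_derivative:
  fixes f :: "complex \<times> real \<Rightarrow> real"
  assumes f: "smooth_on (V \<times> I) f"
  obtains D where "continuous_on (V \<times> I) D"
    "\<And>z t. z \<in> V \<Longrightarrow> t \<in> I \<Longrightarrow> ((\<lambda>s. f (z, s)) has_real_derivative D (z, t)) (at t within I)"
proof -
  have "Ck_on (Suc 0) (V \<times> I) f" using f by (simp only: smooth_on_def)
  then obtain f' where f': "\<And>x. x \<in> V \<times> I \<Longrightarrow> (f has_derivative f' x) (at x within V \<times> I)"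
    and c: "\<And>v. continuous_on (V \<times> I) (\<lambda>x. f' x v)" by auto
  show thesis
  proof (rule that[of "\<lambda>x. f' x (0, 1)"])
    show "continuous_on (V \<times> I) (\<lambda>x. f' x (0, 1))" by (rule c)
    fix z t assume z: "z \<in> V" and t: "t \<in> I"
    have d: "(Pair z has_derivative (\<lambda>h. (0, h))) (at t within I)"
      by (auto intro!: derivative_eq_intros)
    have "(f has_derivative f' (z, t)) (at (z, t) within Pair z ` I)"
      by (rule has_derivative_subset[OF f']) (use z t in auto)
    from has_derivative_in_compose[OF d this]
    have "((\<lambda>s. f (z, s)) has_derivative (\<lambda>h. f' (z, t) (0, h))) (at t within I)" .
    moreover have "(\<lambda>h. f' (z, t) (0, h)) = (*) (f' (z, t) (0, 1))"
    proof
      fix h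
      have "linear (f' (z, t))" using has_derivative_linear[OF f'] z t by auto
      from linear_scale[OF this, of h "(0, 1)"]
      show "f' (z, t) (0, h) = f' (z, t) (0, 1) * h" by (simp add: mult.commute)
    qed
    ultimately show "((\<lambda>s. f (z, s)) has_real_derivative f' (z, t) (0, 1)) (at t within I)"
      by (simp only: has_field_derivative_def)
  qed
qed

text \<open>The curvature formula turns the Ricci flow equation into logarithmic diffusion. Joint
  continuity of the Laplacian is obtained by identifying it with the time derivative.\<close>

lemma ricci_flow_conformal:
  assumes X: "riemann_surface X A" and g: "ricci_flow X A I g" and I: "\<And>t. t \<in> I \<Longrightarrow> t islimpt I"
    and iso: "\<And>t. t \<in> I \<Longrightarrow> isothermal A (topspace X) (g t)"
  shows "conf_flow A I (\<lambda>c z t. coeff (g t) c 1 1 z)"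
    and "t \<in> I \<Longrightarrow> c \<in> A \<Longrightarrow> p \<in> fst c \<Longrightarrow>
      lap (\<lambda>w. ln (coeff (g t) c 1 1 w)) (snd c p) = - 2 * gauss_curvature (g t) c p * coeff (g t) c 1 1 (snd c p)"
proof -
  have pos: "coeff (g t) c 1 1 z > 0" if t: "t \<in> I" and c: "c \<in> A" and z: "z \<in> cdom c" for t c z
  proof -
    obtain p where p: "p \<in> fst c" "snd c p = z" using z by (rule mem_cdomE)
    then have "g t c p 1 1 > 0"
      using riemannian_metric_pos[OF ricci_flowD(1)[OF g t] c] riemann_surface_chart(3)[OF X c] by blast
    then show ?thesis using coeff_chart[OF X c p(1)] p(2) by metis
  qed
  have C2: "C2 (cdom c) (coeff (g t) c 1 1)" if t: "t \<in> I" and c: "c \<in> A" for t c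
  proof (rule C2_Ck_on[OF riemann_surface_chart(1)[OF X c]])
    have "fst c \<inter> topspace X = fst c" using riemann_surface_chart(3)[OF X c] by blast
    then have "smooth_on (cdom c) (coeff (g t) c 1 1)"
      using ricci_flowD(1)[OF g t] c unfolding riemannian_metric_def cdom_def by metis
    then show "Ck_on 2 (cdom c) (coeff (g t) c 1 1)" by (simp only: smooth_on_def)
  qed
  have lap: "lap (\<lambda>w. ln (coeff (g t) c 1 1 w)) (snd c p) = - 2 * gauss_curvature (g t) c p * coeff (g t) c 1 1 (snd c p)"
    if t: "t \<in> I" and c: "c \<in> A" and p: "p \<in> fst c" for t c p
  proof -
    have z: "snd c p \<in> cdom c" using p by (simp add: cdom_def)
    have "coeff (g t) c (dir i) (dir j) z = (if i = j then coeff (g t) c 1 1 z else 0)" if zc: "z \<in> cdom c" for i j z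
    proof -
      obtain p where p: "p \<in> fst c" "snd c p = z" using zc by (rule mem_cdomE)
      have "g t c p (dir i) (dir j) = g t c p 1 1 * (dir i \<bullet> dir j)"
        using iso[OF t] c p(1) riemann_surface_chart(3)[OF X c] unfolding isothermal_def by blast
      moreover have "dir i \<bullet> dir j = (if i = j then 1 else 0)"
        using exhaust_2[of i] exhaust_2[of j] by (auto simp: dir_def)
      ultimately show ?thesis using coeff_chart[OF X c p(1)] p(2) by auto
    qed
    from gauss_curvature_isothermal[OF riemann_surface_chart(1)[OF X c] z this C2[OF t c] pos[OF t c]]
    show ?thesis using pos[OF t c z] by simp
  qed
  then show "t \<in> I \<Longrightarrow> c \<in> A \<Longrightarrow> p \<in> fst c \<Longrightarrow>
      lap (\<lambda>w. ln (coeff (g t) c 1 1 w)) (snd c p) = - 2 * gauss_curvature (g t) c p * coeff (g t) c 1 1 (snd c p)" .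
  show "conf_flow A I (\<lambda>c z t. coeff (g t) c 1 1 z)"
    unfolding conf_flow_def
  proof (intro conjI ballI)
    fix c assume c: "c \<in> A"
    let ?e = "\<lambda>z t. coeff (g t) c 1 1 z"
    obtain D where D: "continuous_on (cdom c \<times> I) D"
      "\<And>z t. z \<in> cdom c \<Longrightarrow> t \<in> I \<Longrightarrow> ((\<lambda>s. (\<lambda>(z, t). ?e z t) (z, s)) has_real_derivative D (z, t)) (at t within I)"
      using smooth_on_time_derivative[OF ricci_flowD(2)[OF g c]] by blast
    have R: "(?e z has_real_derivative lap (\<lambda>w. ln (?e w t)) z) (at t within I)" if zc: "z \<in> cdom c" and t: "t \<in> I" for z t
    proof -
      obtain p where p: "p \<in> fst c" "snd c p = z" using zc by (rule mem_cdomE)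
      show ?thesis
        using ricci_flowD(3)[OF g t c p(1), of 1 1] lap[OF t c p(1)] coeff_chart[OF X c p(1)] p(2) by simp
    qed
    \<comment> \<open>Derivatives within \<open>I\<close> are unique at limit points of
      \<open>I\<close>; this is where \<open>islimpt\<close> enters.\<close>
    have eq: "lap (\<lambda>w. ln (?e w t)) z = D (z, t)" if "z \<in> cdom c" "t \<in> I" for z t
    proof (rule vector_derivative_unique_within)
      show "at t within I \<noteq> bot" using I[OF that(2)] by (simp add: trivial_limit_within)
      show "(?e z has_vector_derivative lap (\<lambda>w. ln (?e w t)) z) (at t within I)"
        using R[OF that] by (simp add: has_real_derivative_iff_has_vector_derivative)
      show "(?e z has_vector_derivative D (z, t)) (at t within I)"
        using D(2)[OF that] by (simp add: has_real_derivative_iff_has_vector_derivative)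
    qed
    show "log_diffusion (cdom c) I ?e"
      unfolding log_diffusion_def
    proof (intro conjI ballI)
      show "continuous_on (cdom c \<times> I) (\<lambda>(z, t). ?e z t)"
        using smooth_on_continuous[OF ricci_flowD(2)[OF g c]] .
      show "continuous_on (cdom c \<times> I) (\<lambda>(z, t). lap (\<lambda>w. ln (?e w t)) z)"
        using D(1) by (rule continuous_on_eq) (auto simp: eq)
    qed (use pos c C2 R in auto)
  next
    fix t assume t: "t \<in> I"
    show "conf_density A (\<lambda>c. coeff (g t) c 1 1)"
      unfolding conf_density_def
    proof (intro ballI)
      fix c d p assume c: "c \<in> A" and d: "d \<in> A" and p: "p \<in> fst c \<inter> fst d"
      let ?T = "deriv (transition c d) (snd c p)"
      have pX: "p \<in> fst c \<inter> fst d \<inter> topspace X" "p \<in> fst d \<inter> topspace X" using p riemann_surface_chart(3)[OF X c] by auto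
      have "g t c p 1 1 = g t d p (?T * 1) (?T * 1)"
        using ricci_flowD(1)[OF g t] c d pX(1) unfolding riemannian_metric_def by blast
      also have "\<dots> = g t d p 1 1 * (?T \<bullet> ?T)"
        using iso[OF t, unfolded isothermal_def, rule_format, OF d pX(2), of ?T ?T] by simp
      finally show "coeff (g t) c 1 1 (snd c p) = coeff (g t) d 1 1 (snd d p) * (norm ?T)\<^sup>2"
        using coeff_chart[OF X c] coeff_chart[OF X d] p by (simp add: power2_norm_eq_inner)
    qed
  qed
qed

text \<open>The factor \<open>r\<close> adds a constant to the logarithm, so the Laplacian is
  unchanged, and it is cancelled in the time derivative by the factor \<open>1 / r\<close> from
  slowing time.\<close>

lemma log_diffusion_scale:
  assumes V: "open V" and e: "log_diffusion V I e" and r: "r > 0"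
  shows "log_diffusion V ((\<lambda>t. r * t) ` I) (\<lambda>z t. r * e z (t / r))"
    and "z \<in> V \<Longrightarrow> t \<in> I \<Longrightarrow> lap (\<lambda>w. ln (r * e w t)) z = lap (\<lambda>w. ln (e w t)) z"
proof -
  have C2r: "C2 V (\<lambda>z. r * e z t)" and lap: "z \<in> V \<Longrightarrow> lap (\<lambda>w. ln (r * e w t)) z = lap (\<lambda>w. ln (e w t)) z" if t: "t \<in> I" for t z
  proof -
    note f = log_diffusionD(3)[OF e t]
    have pos: "e z t > 0" if "z \<in> V" for z using log_diffusionD(2)[OF e that t] .
    show "C2 V (\<lambda>z. r * e z t)"
      by (rule C2I(1)[OF V, of _ "\<lambda>i z. r * pd i (\<lambda>z. e z t) z" "\<lambda>i z. r * pd i (pd i (\<lambda>z. e z t)) z"])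
        (use f in \<open>auto simp: C2_def intro!: continuous_intros DERIV_cmult\<close>)
    \<comment> \<open>A constant written as a degenerate quadratic, so that
      \<open>C2_quadratic\<close> applies.\<close>
    let ?c = "\<lambda>z :: complex. - ln r + 0 * (norm (z - 0))\<^sup>2"
    have 2: "C2 V (\<lambda>z. ln (e z t))" using C2_ln(1)[OF V f pos] .
    assume z: "z \<in> V"
    have "lap (\<lambda>w. ln (r * e w t)) z = lap (\<lambda>w. ln (e w t) - ?c w) z"
    proof (rule lap_cong[OF V z])
      fix w assume "w \<in> V"
      from pos[OF this] r show "ln (r * e w t) = ln (e w t) - ?c w" by (simp add: ln_mult)
    qed
    also have "\<dots> = lap (\<lambda>w. ln (e w t)) z - lap ?c z"
      by (rule C2_diff(2)[OF V 2 C2_mono[OF C2_quadratic(1)] z]) simp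
    also have "lap ?c z = 0" using C2_quadratic(2)[of "- ln r" 0 0 z] by simp
    finally show "lap (\<lambda>w. ln (r * e w t)) z = lap (\<lambda>w. ln (e w t)) z" by simp
  qed
  then show "z \<in> V \<Longrightarrow> t \<in> I \<Longrightarrow> lap (\<lambda>w. ln (r * e w t)) z = lap (\<lambda>w. ln (e w t)) z" by blast
  let ?I = "(\<lambda>t. r * t) ` I"
  have mem: "t / r \<in> I" if "t \<in> ?I" for t using that r by auto
  have img: "(\<lambda>t. t / r) ` ?I = I" using r by (force simp: image_image)
  have sc: "continuous_on (V \<times> ?I) (\<lambda>x. (fst x, snd x / r))" using r by (intro continuous_intros) auto
  have sub: "(\<lambda>x. (fst x, snd x / r)) ` (V \<times> ?I) \<subseteq> V \<times> I"
    using mem by (intro image_subsetI) (metis fst_conv mem_Times_iff snd_conv)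
  show "log_diffusion V ?I (\<lambda>z t. r * e z (t / r))"
    unfolding log_diffusion_def
  proof (intro conjI ballI)
    have "continuous_on (V \<times> ?I) (\<lambda>x. e (fst x) (snd x / r))"
      using continuous_on_compose2[OF log_diffusionD(1)[OF e] sc sub] by simp
    then show "continuous_on (V \<times> ?I) (\<lambda>(z, t). r * e z (t / r))"
      unfolding case_prod_beta by (intro continuous_intros)
    have "continuous_on (V \<times> ?I) (\<lambda>x. lap (\<lambda>w. ln (e w (snd x / r))) (fst x))"
      using continuous_on_compose2[OF log_diffusionD(4)[OF e] sc sub] by simp
    then show "continuous_on (V \<times> ?I) (\<lambda>(z, t). lap (\<lambda>w. ln (r * e w (t / r))) z)"
    proof (rule continuous_on_eq)
      fix x assume "x \<in> V \<times> ?I"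
      then have "fst x \<in> V" "snd x \<in> ?I" by (simp_all only: mem_Times_iff)
      then show "lap (\<lambda>w. ln (e w (snd x / r))) (fst x) = (case x of (z, t) \<Rightarrow> lap (\<lambda>w. ln (r * e w (t / r))) z)"
        using lap[OF mem] by (simp add: case_prod_beta)
    qed
    fix z t assume z: "z \<in> V" and t: "t \<in> ?I"
    have d1: "(e z has_real_derivative lap (\<lambda>w. ln (e w (t / r))) z) (at (t / r) within (\<lambda>t. t / r) ` ?I)"
      using log_diffusionD(5)[OF e z mem[OF t]] img by simp
    have d2: "((\<lambda>t. t / r) has_real_derivative 1 / r) (at t within ?I)"
      using r by (auto intro!: derivative_eq_intros)
    have "((\<lambda>t. e z (t / r)) has_real_derivative lap (\<lambda>w. ln (e w (t / r))) z * (1 / r)) (at t within ?I)"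
      using DERIV_image_chain[OF d1 d2] by (simp only: o_def)
    from DERIV_cmult[OF this, of r] show "((\<lambda>t. r * e z (t / r)) has_real_derivative lap (\<lambda>w. ln (r * e w (t / r))) z) (at t within ?I)"
      using lap[OF mem[OF t] z] r by simp
  qed (use r log_diffusionD(2)[OF e] mem C2r in auto)
qed

lemma conf_flow_scale:
  assumes X: "riemann_surface X A" and e: "conf_flow A I e" and r: "r > 0"
  shows "conf_flow A ((\<lambda>t. r * t) ` I) (\<lambda>c z t. r * e c z (t / r))"
  unfolding conf_flow_def
proof (intro conjI ballI)
  show "log_diffusion (cdom c) ((\<lambda>t. r * t) ` I) (\<lambda>z t. r * e c z (t / r))" if "c \<in> A" for c
    using log_diffusion_scale(1)[OF riemann_surface_chart(1)[OF X that] _ r] e that by (auto simp: conf_flow_def)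
  fix t assume "t \<in> (\<lambda>t. r * t) ` I"
  then have "conf_density A (\<lambda>c z. e c z (t / r))" using e r by (auto simp: conf_flow_def)
  note cd = this[unfolded conf_density_def, rule_format]
  show "conf_density A (\<lambda>c z. r * e c z (t / r))"
    unfolding conf_density_def
  proof (intro ballI)
    fix c d p assume "c \<in> A" "d \<in> A" "p \<in> fst c \<inter> fst d"
    from cd[OF this] show "r * e c (snd c p) (t / r) = r * e d (snd d p) (t / r) * (norm (deriv (transition c d) (snd c p)))\<^sup>2"
      by (simp only: mult.assoc)
  qed
qed

section \<open>Covering by coordinate squares\<close>

lemma sq_shrink:
  assumes "open V" "z \<in> V"
  obtains r where "r > 0" "sq z r \<subseteq> V"
proof -
  obtain d where d: "d > 0" "cball z d \<subseteq> V" using assms open_contains_cball by blast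
  show thesis
  proof (rule that[of "d / 2"])
    show "sq z (d / 2) \<subseteq> V"
    proof
      fix w assume "w \<in> sq z (d / 2)"
      then have "norm (w - z) \<le> d"
        using cmod_le[of "w - z"] by (simp add: mem_sq)
      then show "w \<in> V" using d(2) by (auto simp: dist_norm norm_minus_commute)
    qed
  qed (use d in auto)
qed

lemma sq_half_ball: "sq 0 (1/2) \<subseteq> ball 0 1"
proof
  fix w :: complex assume "w \<in> sq 0 (1/2)"
  then have "\<bar>Re w\<bar> \<le> 1/2" "\<bar>Im w\<bar> \<le> 1/2" by (auto simp: mem_sq)
  then have "(Re w)\<^sup>2 \<le> (1/2)\<^sup>2" "(Im w)\<^sup>2 \<le> (1/2)\<^sup>2" by (metis abs_le_square_iff abs_numeral abs_divide abs_one)+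
  then have "(norm w)\<^sup>2 \<le> 1/2" by (simp add: cmod_power2 power_divide)
  then have "(norm w)\<^sup>2 < 1\<^sup>2" by simp
  then have "norm w < 1" by (rule power_less_imp_less_base) simp
  then show "w \<in> ball 0 1" by simp
qed

lemma openin_chart_preimage:
  assumes X: "riemann_surface X A" and c: "c \<in> A" and U: "open U"
  shows "openin X {p \<in> fst c. snd c p \<in> U}"
proof -
  have hom: "homeomorphic_map (subtopology X (fst c)) (top_of_set (snd c ` fst c)) (snd c)"
    using X c by (simp add: riemann_surface_def is_chart_def)
  have "continuous_map (subtopology X (fst c)) euclidean (snd c)"
    using homeomorphic_imp_continuous_map[OF hom] continuous_map_in_subtopology by blast
  then have "openin (subtopology X (fst c)) {p \<in> topspace (subtopology X (fst c)). snd c p \<in> U}"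
    using U by (simp add: continuous_map_def)
  moreover have "topspace (subtopology X (fst c)) = fst c"
    using riemann_surface_chart(3)[OF X c] by (simp add: topspace_subtopology Int_absorb1)
  ultimately have "openin (subtopology X (fst c)) {p \<in> fst c. snd c p \<in> U}" by (simp only:)
  then show ?thesis
    by (rule openin_trans_full[OF _ riemann_surface_chart(4)[OF X c]])
qed

lemma cusp_coordinatesD:
  assumes Z: "cusp_coordinates A P g \<zeta>" and p: "p \<in> P"
  shows "\<zeta> p \<in> A" "p \<in> fst (\<zeta> p)" "snd (\<zeta> p) p = 0" "cball 0 1 \<subseteq> cdom (\<zeta> p)"
    and "q \<in> P \<Longrightarrow> q \<in> coord_disc (\<zeta> p) 1 \<Longrightarrow> q = p"
proof -
  note a = conjunct1[OF Z[unfolded cusp_coordinates_def], rule_format, OF p]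
    and b = conjunct2[OF Z[unfolded cusp_coordinates_def], rule_format, OF p]
  show "\<zeta> p \<in> A" "p \<in> fst (\<zeta> p)" "snd (\<zeta> p) p = 0" "cball 0 1 \<subseteq> cdom (\<zeta> p)"
    using a unfolding cdom_def by blast+
  assume q: "q \<in> P" "q \<in> coord_disc (\<zeta> p) 1"
  have "q \<in> fst (\<zeta> q)" "snd (\<zeta> q) q = 0"
    using conjunct1[OF Z[unfolded cusp_coordinates_def], rule_format, OF q(1)] by blast+
  then have "q \<in> coord_disc (\<zeta> q) 1" by (simp add: coord_disc_def)
  then show "q = p" using b[OF q(1)] q(2) by blast
qed

text \<open>Points of the surface index their own squares. A puncture receives its given coordinate
  with a square inside the unit disc, where no other puncture lies; any other point receives a
  square that avoids all punctures.\<close>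

lemma cusp_cover:
  assumes X: "riemann_surface X A" and comp: "compact_space X" and fin: "finite P" and P: "P \<subseteq> topspace X"
    and Z: "cusp_coordinates A P g \<zeta>"
  obtains J ch ctr rad where "boxed_surface X A J ch ctr rad"
    and "\<And>j. j \<in> J \<Longrightarrow> snd (ch j) ` (fst (ch j) \<inter> P) \<inter> sq (ctr j) (rad j) \<subseteq> {ctr j}"
    and "\<And>j. j \<in> J \<Longrightarrow> ctr j \<in> snd (ch j) ` (fst (ch j) \<inter> P) \<Longrightarrow> j \<in> P \<and> ch j = \<zeta> j \<and> ctr j = 0"
proof -
  \<comment> \<open>The last conjunct ties a square centred at a puncture to the coordinate
    \<open>\<zeta>\<close>, in which the blow-up of the metric is known.\<close>
  let ?good = "\<lambda>q c z r. c \<in> A \<and> q \<in> fst c \<and> z = snd c q \<and> 0 < r \<and> sq z r \<subseteq> cdom c \<and>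
      snd c ` (fst c \<inter> P) \<inter> sq z r \<subseteq> {z} \<and> (z \<in> snd c ` (fst c \<inter> P) \<longrightarrow> q \<in> P \<and> c = \<zeta> q \<and> z = 0)"
  have "\<exists>c z r. ?good q c z r" if q: "q \<in> topspace X" for q
  proof (cases "q \<in> P")
    case True
    note z = cusp_coordinatesD[OF Z True]
    have sub: "sq 0 (1/2) \<subseteq> cdom (\<zeta> q)" using sq_half_ball z(4) by force
    have "snd (\<zeta> q) ` (fst (\<zeta> q) \<inter> P) \<inter> sq 0 (1/2) \<subseteq> {0}"
    proof
      fix w assume "w \<in> snd (\<zeta> q) ` (fst (\<zeta> q) \<inter> P) \<inter> sq 0 (1/2)"
      then obtain p where p: "p \<in> fst (\<zeta> q)" "p \<in> P" "w = snd (\<zeta> q) p" "w \<in> sq 0 (1/2)" by blast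
      then have "p \<in> coord_disc (\<zeta> q) 1" using sq_half_ball unfolding coord_disc_def by blast
      then show "w \<in> {0}" using z(5)[OF p(2)] z(3) p(3) by simp
    qed
    then have "?good q (\<zeta> q) 0 (1/2)" using z(1-3) sub True by simp
    then show ?thesis by blast
  next
    case False
    have "(\<Union>c\<in>A. fst c) = topspace X" using X by (simp add: riemann_surface_def)
    then obtain c where c: "c \<in> A" "q \<in> fst c" using q by blast
    note chart = riemann_surface_chart[OF X c(1)]
    have "finite (snd c ` (fst c \<inter> P))" using fin by simp
    then have "open (cdom c - snd c ` (fst c \<inter> P))" using chart(1) by (intro open_Diff finite_imp_closed)
    moreover have nb: "snd c q \<notin> snd c ` (fst c \<inter> P)"
      using chart(2) c(2) False by (metis (no_types, lifting) IntD1 IntD2 image_iff inj_on_eq_iff)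
    then have "snd c q \<in> cdom c - snd c ` (fst c \<inter> P)" using c(2) by (simp add: cdom_def)
    ultimately obtain r where r: "r > 0" "sq (snd c q) r \<subseteq> cdom c - snd c ` (fst c \<inter> P)"
      using sq_shrink by blast
    then have "?good q c (snd c q) r" using c nb by blast
    then show ?thesis by blast
  qed
  then have "\<forall>q. \<exists>c z r. q \<in> topspace X \<longrightarrow> ?good q c z r" by blast
  from choice[OF this] obtain ch where "\<forall>q. \<exists>z r. q \<in> topspace X \<longrightarrow> ?good q (ch q) z r" ..
  from choice[OF this] obtain ctr where "\<forall>q. \<exists>r. q \<in> topspace X \<longrightarrow> ?good q (ch q) (ctr q) r" ..
  from choice[OF this] obtain rad where g0: "\<forall>q. q \<in> topspace X \<longrightarrow> ?good q (ch q) (ctr q) (rad q)" ..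
  note g = g0[rule_format]
  \<comment> \<open>Open half squares, from which compactness extracts the finite index set; the
    closed ones then cover too.\<close>
  define U where "U q = {p \<in> fst (ch q). snd (ch q) p \<in> box (ctr q - Complex (rad q / 2) (rad q / 2)) (ctr q + Complex (rad q / 2) (rad q / 2))}" for q
  have U: "openin X (U q)" if "q \<in> topspace X" for q
    unfolding U_def using openin_chart_preimage[OF X conjunct1[OF g[OF that]] open_box] .
  have qU: "q \<in> U q" if "q \<in> topspace X" for q
    using g[OF that] by (simp add: U_def in_box_complex_iff)
  have "topspace X \<subseteq> \<Union> (U ` topspace X)" using qU by blast
  then obtain F where F: "finite F" "F \<subseteq> U ` topspace X" "topspace X \<subseteq> \<Union> F"
    using comp U unfolding compact_space_alt by (metis (no_types, lifting) imageE)
  then obtain J where J: "J \<subseteq> topspace X" "finite J" "F = U ` J" by (metis finite_subset_image)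
  show thesis
  proof (rule that[of J ch ctr rad])
    show "boxed_surface X A J ch ctr rad"
    proof
      show "\<exists>j\<in>J. p \<in> fst (ch j) \<and> snd (ch j) p \<in> sq (ctr j) (rad j / 2)" if pX: "p \<in> topspace X" for p
      proof -
        obtain j where j: "j \<in> J" "p \<in> U j" using F(3) J(3) pX by blast
        have "snd (ch j) p \<in> sq (ctr j) (rad j / 2)"
          using j(2) box_subset_cbox unfolding U_def sq_def by blast
        then show ?thesis using j unfolding U_def by blast
      qed
    qed (use X J g in blast)+
  next
    fix j assume "j \<in> J"
    then have j: "j \<in> topspace X" using J by blast
    show "snd (ch j) ` (fst (ch j) \<inter> P) \<inter> sq (ctr j) (rad j) \<subseteq> {ctr j}" using g[OF j] by blast
    show "ctr j \<in> snd (ch j) ` (fst (ch j) \<inter> P) \<Longrightarrow> j \<in> P \<and> ch j = \<zeta> j \<and> ctr j = 0" using g[OF j] by blast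
  qed
qed

section \<open>Blow-up of the initial metric at the punctures, and limits under rescaling\<close>

lemma cusp_truncationD:
  assumes "cusp_truncation X A P g0 \<zeta> \<psi> \<kappa> h"
  shows "k \<ge> 1 \<Longrightarrow> riemannian_metric A (topspace X) (h k)" "k \<ge> 1 \<Longrightarrow> conformal A (topspace X) (h k)"
    "k \<ge> 1 \<Longrightarrow> metric_le A (topspace X) (h k) (h (Suc k))"
    "k \<ge> 1 \<Longrightarrow> metric_le A (topspace X - P) (h k) g0"
    "p \<in> P \<Longrightarrow> filterlim (\<lambda>k. INF z\<in>ball 0 (1 / real k). conf_factor (h k) (\<zeta> p) z) at_top sequentially"
  using assms unfolding cusp_truncation_def by simp_all

text \<open>\<open>g0\<close> dominates every truncated metric off the puncture, and the truncated
  metrics are arbitrarily large on small discs.\<close>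

lemma cusp_blowup:
  assumes X: "riemann_surface X A" and Z: "cusp_coordinates A P g0 \<zeta>"
    and h: "cusp_truncation X A P g0 \<zeta> \<psi> \<kappa> h" and p: "p \<in> P"
  shows "filterlim (coeff g0 (\<zeta> p) 1 1) at_top (at 0)"
  unfolding filterlim_at_top
proof
  fix M :: real
  note z = cusp_coordinatesD[OF Z p]
  \<comment> \<open>The conformal factor is half the logarithm of the density;
    \<open>max M 1\<close> keeps the logarithm meaningful for nonpositive \<open>M\<close>.\<close>
  let ?c = "\<zeta> p" and ?K = "ln (max M 1) / 2"
  have "\<forall>\<^sub>F k in sequentially. (INF z\<in>ball 0 (1 / real k). conf_factor (h k) ?c z) \<ge> ?K \<and> k \<ge> 1"
    by (intro eventually_conj cusp_truncationD(5)[OF h p, unfolded filterlim_at_top, rule_format] eventually_ge_at_top)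
  then obtain k where k: "(INF z\<in>ball 0 (1 / real k). conf_factor (h k) ?c z) \<ge> ?K" "k \<ge> 1"
    using eventually_happens'[OF sequentially_bot] by blast
  have X': "fst ?c \<inter> topspace X = fst ?c" using riemann_surface_chart(3)[OF X z(1)] by blast
  have pos: "coeff (h k) ?c 1 1 w > 0" if wV: "w \<in> cdom ?c" for w
  proof -
    obtain q where q: "q \<in> fst ?c" "snd ?c q = w" using wV by (rule mem_cdomE)
    have "h k ?c q 1 1 > 0" using riemannian_metric_pos[OF cusp_truncationD(1)[OF h k(2)] z(1)] q(1) X' by blast
    then show ?thesis using coeff_chart[OF X z(1) q(1)] q(2) by metis
  qed
  have sm: "continuous_on (cdom ?c) (coeff (h k) ?c 1 1)"
    using cusp_truncationD(1)[OF h k(2)] z(1) X' smooth_on_continuous unfolding riemannian_metric_def cdom_def by metis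
  have nz: "\<forall>w\<in>cball 0 1. coeff (h k) ?c 1 1 w \<noteq> 0" using pos z(4) by force
  have cf: "continuous_on (cball 0 1) (conf_factor (h k) ?c)"
    unfolding conf_factor_def
    by (intro continuous_intros continuous_on_subset[OF sm z(4)]) (simp_all add: nz)
  have ball: "ball 0 (1 / real k) \<subseteq> (cball 0 1 :: complex set)"
  proof -
    have "1 / real k \<le> 1" using k(2) by simp
    then show ?thesis by (meson ball_subset_cball order_trans subset_cball)
  qed
  have "bounded (conf_factor (h k) ?c ` cball 0 1)" using cf by (intro compact_imp_bounded compact_continuous_image) auto
  \<comment> \<open>A real \<open>INF\<close> is a lower bound only for a family that is bounded
    below; continuity on the closed unit disc provides this.\<close>
  then have bdd: "bdd_below (conf_factor (h k) ?c ` ball 0 (1 / real k))"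
    by (rule bdd_below_mono[OF bounded_imp_bdd_below image_mono[OF ball]])
  have "coeff g0 ?c 1 1 w \<ge> M" if w: "w \<in> ball 0 (1 / real k)" "w \<noteq> 0" for w
  proof -
    have wV: "w \<in> cdom ?c" using w(1) ball z(4) by blast
    then obtain q where q: "q \<in> fst ?c" "snd ?c q = w" by (rule mem_cdomE)
    have "1 / real k \<le> 1" using k(2) by simp
    then have "w \<in> ball 0 1" using w(1) by (auto simp: dist_norm intro: less_le_trans)
    then have "q \<in> coord_disc ?c 1" using q unfolding coord_disc_def by blast
    then have qP: "q \<notin> P" using z(3) z(5)[of q] q(2) w(2) by blast
    have "?K \<le> conf_factor (h k) ?c w" using k(1) cINF_lower[OF bdd w(1)] by linarith
    then have "ln (max M 1) \<le> ln (coeff (h k) ?c 1 1 w)" by (simp add: conf_factor_def)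
    then have "max M 1 \<le> coeff (h k) ?c 1 1 w" using pos[OF wV] by simp
    also have "\<dots> = h k ?c q 1 1" using coeff_chart[OF X z(1) q(1)] q(2) by metis
    also have "\<dots> \<le> g0 ?c q 1 1"
      using cusp_truncationD(4)[OF h k(2), unfolded metric_le_def] z(1) q(1) qP X' by blast
    also have "\<dots> = coeff g0 ?c 1 1 w" using coeff_chart[OF X z(1) q(1)] q(2) by metis
    finally show ?thesis by simp
  qed
  then show "\<forall>\<^sub>F w in at 0. M \<le> coeff g0 ?c 1 1 w"
    unfolding eventually_at using k(2) by (intro exI[of _ "1 / real k"]) (auto simp: dist_commute)
qed

lemma uniform_limit_rescale:
  fixes f :: "real \<Rightarrow> 'a \<Rightarrow> real"
  assumes f: "uniform_limit K f l (at_right 0)" and r: "r > 0"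
  shows "uniform_limit K (\<lambda>t z. r * f (t / r) z) (\<lambda>z. r * l z) (at_right 0)"
proof -
  have "filterlim (\<lambda>t. t / r) (at_right 0) (at_right 0)"
    unfolding filterlim_at
  proof
    have "((\<lambda>t. t / r) \<longlongrightarrow> 0 / r) (at_right 0)" using r by (intro tendsto_intros) auto
    then show "((\<lambda>t. t / r) \<longlongrightarrow> 0) (at_right 0)" by simp
    show "\<forall>\<^sub>F t in at_right 0. t / r \<in> {0<..} \<and> t / r \<noteq> 0"
      using r eventually_at_right_less[of 0] by (auto elim!: eventually_mono)
  qed
  from filterlim_compose[OF f this] have "uniform_limit K (\<lambda>t. f (t / r)) l (at_right 0)" .
  then show ?thesis by (rule bounded_linear.uniform_limit[OF bounded_linear_mult_right])
qed

lemma converges_coeff: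
  assumes "converges_smoothly_locally A N g g0" "c \<in> A" "compact K" "K \<subseteq> snd c ` (fst c \<inter> N)"
  shows "uniform_limit K (\<lambda>t. coeff (g t) c v w) (coeff g0 c v w) (at_right 0)"
proof -
  have "compact K \<and> K \<subseteq> snd c ` (fst c \<inter> N)" using assms(3,4) ..
  from assms(1)[unfolded converges_smoothly_locally_def, rule_format, OF assms(2) this, of "[]" v w]
  show ?thesis by simp
qed

lemma coeff_scale_metric: "coeff (scale_metric r g) c v w z = r * coeff g c v w z"
  by (simp add: coeff_def scale_metric_def)

lemma islimpt_interval:
  fixes S :: "real set"
  assumes "connected S" "a \<in> S" "b \<in> S" "a \<noteq> b" "t \<in> S"
  shows "t islimpt S"
  by (rule connected_imp_perfect[OF assms(1,5)]) (use assms(2-4) in blast)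

lemma metric_le_chain:
  assumes "\<And>k. k \<ge> 1 \<Longrightarrow> metric_le A N (h k) (h (Suc k))" "(k::nat) \<ge> 1" "c \<in> A" "p \<in> fst c \<inter> N"
  shows "h 1 c p v v \<le> h k c p v v"
  using assms(2)
proof (induction rule: dec_induct)
  case (step n)
  then have "h n c p v v \<le> h (Suc n) c p v v" using assms(1)[of n, unfolded metric_le_def] assms(3,4) by blast
  then show ?case using step by simp
qed simp

theorem theorem1p5:
  fixes X :: "'a topology" and A :: "'a coord set" and P :: "'a set"
    and g0 :: "'a metric_tensor" and g g' :: "real \<Rightarrow> 'a metric_tensor"
    and T \<delta> :: real
  assumes "riemann_surface X A" and "compact_space X"
    and "finite P" and "P \<subseteq> topspace X"
    and "riemannian_metric A (topspace X - P) g0"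
    and "conformal A (topspace X - P) g0"
    and "complete_metric X A (topspace X - P) g0"
    and "bounded_curvature A (topspace X - P) g0"
    and "\<forall>p\<in>P. \<exists>W. openin X W \<and> p \<in> W \<and>
           (\<forall>c\<in>A. \<forall>q\<in>fst c \<inter> (W - P). gauss_curvature g0 c q < 0)"
    and "T > 0" and "cusp_contracting_flow X A P g0 T g"
    and "0 < \<delta>" and "\<delta> \<le> T"
    and "ricci_flow X A {0<..<\<delta>} g'"
    and "converges_smoothly_locally A (topspace X - P) g' g0"
    and "\<exists>b. \<forall>t\<in>{0<..<\<delta>}. curvature_bounded_below A (topspace X) b (g' t)"
  shows "\<forall>t\<in>{0<..<\<delta>}. metric_eq A (topspace X) (g' t) (g t)"
proof -
  note X = assms(1) and \<delta> = assms(12,13) and g' = assms(14) and lim' = assms(15)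
  have gflow: "ricci_flow X A {0<..T} g" and lim: "converges_smoothly_locally A (topspace X - P) g g0"
    using assms(11) by (auto simp: cusp_contracting_flow_def)
  obtain r where r: "r > 0" and nc: "normalised_construction X A P (scale_metric r g0) (r * T)
              (\<lambda>t. scale_metric r (g (t / r)))"
    using assms(11) unfolding cusp_contracting_flow_def by blast
  obtain \<zeta> \<psi> \<kappa> h G where Z: "cusp_coordinates A P (scale_metric r g0) \<zeta>"
    and h: "cusp_truncation X A P (scale_metric r g0) \<zeta> \<psi> \<kappa> h"
    and G: "\<And>k::nat. k \<ge> 1 \<Longrightarrow> ricci_flow X A {0..r * T} (G k)" "\<And>k. k \<ge> 1 \<Longrightarrow> metric_eq A (topspace X) (G k 0) (h k)"
    and Glim: "\<And>t c p v w. t \<in> {0<..r * T} \<Longrightarrow> c \<in> A \<Longrightarrow> p \<in> fst c \<Longrightarrow>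
        (\<lambda>k. G k t c p v w) \<longlonglongrightarrow> scale_metric r (g (t / r)) c p v w"
    using nc unfolding normalised_construction_def by blast
  obtain b where b: "\<And>t. t \<in> {0<..<\<delta>} \<Longrightarrow> curvature_bounded_below A (topspace X) b (g' t)"
    using assms(16) by blast
  obtain J ch ctr rad where box: "boxed_surface X A J ch ctr rad"
    and bad: "\<And>j. j \<in> J \<Longrightarrow> snd (ch j) ` (fst (ch j) \<inter> P) \<inter> sq (ctr j) (rad j) \<subseteq> {ctr j}"
    and cusp: "\<And>j. j \<in> J \<Longrightarrow> ctr j \<in> snd (ch j) ` (fst (ch j) \<inter> P) \<Longrightarrow> j \<in> P \<and> ch j = \<zeta> j \<and> ctr j = 0"
    using cusp_cover[OF X assms(2-4) Z] by blast
  interpret boxed_surface X A J ch ctr rad by (rule box)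
  have rT: "r * T > 0" using r assms(10) by simp
  have iso': "isothermal A (topspace X) (g' t)" if "t \<in> {0<..<\<delta>}" for t
    by (rule ricci_flow_isothermal_limit[OF X g' _ \<delta>(1) order_refl assms(3,6) lim' that]) simp
  have iso: "isothermal A (topspace X) (g t)" if "t \<in> {0<..T}" for t
    by (rule ricci_flow_isothermal_limit[OF X gflow _ assms(10) _ assms(3,6) lim that]) auto
  have isoG: "isothermal A (topspace X) (G k t)" if k: "k \<ge> 1" and t: "t \<in> {0..r * T}" for k t
  proof (rule ricci_flow_isothermal[OF X G(1)[OF k] _ _ _ t])
    have "isothermal A (topspace X) (h k)"
      using conformal_isothermal(1)[OF cusp_truncationD(2)[OF h k]] .
    then show "isothermal A (topspace X) (G k 0)"
      using G(2)[OF k] unfolding isothermal_def metric_eq_def by metis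
  qed (use rT in auto)
  have limpt': "t islimpt {0<..<\<delta>}" if "t \<in> {0<..<\<delta>}" for t
    by (rule islimpt_interval[of _ "\<delta> / 2" "\<delta> / 3"]) (use that \<delta> in auto)
  have limpt: "t islimpt {0<..T}" if "t \<in> {0<..T}" for t
    by (rule islimpt_interval[of _ "T / 2" "T / 3"]) (use that assms(10) in auto)
  have limptG: "t islimpt {0..r * T}" if "t \<in> {0..r * T}" for t
    by (rule islimpt_interval[of _ "0" "r * T"]) (use that rT in auto)
  have flow': "conf_flow A {0<..<\<delta>} (\<lambda>c z t. coeff (g' t) c 1 1 z)"
    by (rule ricci_flow_conformal(1)[OF X g' limpt' iso'])
  have flow: "conf_flow A {0<..T} (\<lambda>c z t. coeff (g t) c 1 1 z)"
    by (rule ricci_flow_conformal(1)[OF X gflow limpt iso])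
  \<comment> \<open>The competitor is rescaled by the factor of the normalisation, so that both
    flows start from \<open>r g0\<close> and share the time scale of the truncated flows.\<close>
  let ?e' = "\<lambda>c z t. r * coeff (g' (t / r)) c 1 1 z" and ?e = "\<lambda>c z t. r * coeff (g (t / r)) c 1 1 z"
  let ?init = "\<lambda>c. coeff (scale_metric r g0) c 1 1"
  have img: "(\<lambda>t. r * t) ` {0<..<\<delta>} = {0<..<r * \<delta>}" "(\<lambda>t. r * t) ` {0<..T} = {0<..r * T}"
    using r by (auto simp: image_iff field_simps intro!: bexI[of _ "_ / r"])
  \<comment> \<open>From \<open>K \<ge> b\<close> the Laplacian \<open>- 2 K e\<close> is at most
    \<open>2 |b| e\<close>. Division by \<open>r\<close> accounts for the rescaled density, and the
    summand 1 makes \<open>B\<close> positive.\<close>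
  define B where "B = (1 + 2 * \<bar>b\<bar>) / r"
  have reg: "cdom (ch j) - snd (ch j) ` (fst (ch j) \<inter> P) = snd (ch j) ` (fst (ch j) \<inter> (topspace X - P))" if "j \<in> J" for j
    using cdom_minus[OF X ch[OF that]] .
  interpret cusp_flows X A J ch ctr rad P ?init ?e' ?e "\<lambda>k c z t. coeff (G k t) c 1 1 z" "r * \<delta>" "r * T" B
  proof
    fix j assume j: "j \<in> J"
    show "snd (ch j) ` (fst (ch j) \<inter> P) \<inter> sq (ctr j) (rad j) \<subseteq> {ctr j}" by (rule bad[OF j])
    have "smooth_on (snd (ch j) ` (fst (ch j) \<inter> (topspace X - P))) (coeff g0 (ch j) 1 1)"
      using assms(5) ch[OF j] unfolding riemannian_metric_def by blast
    then show "continuous_on (cdom (ch j) - snd (ch j) ` (fst (ch j) \<inter> P)) (?init (ch j))"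
      unfolding reg[OF j] coeff_scale_metric by (intro continuous_intros smooth_on_continuous)
    show "filterlim (?init (ch j)) at_top (at (ctr j))" if "ctr j \<in> snd (ch j) ` (fst (ch j) \<inter> P)"
      using cusp_blowup[OF X Z h, of j] cusp[OF j that] by auto
    fix K assume K: "compact K" "K \<subseteq> cdom (ch j) - snd (ch j) ` (fst (ch j) \<inter> P)"
    note K' = K(2)[unfolded reg[OF j]]
    show "uniform_limit K (\<lambda>t z. ?e' (ch j) z t) (?init (ch j)) (at_right 0)"
      unfolding coeff_scale_metric
      by (rule uniform_limit_rescale[OF converges_coeff[OF lim' ch[OF j] K(1) K'] r])
    show "uniform_limit K (\<lambda>t z. ?e (ch j) z t) (?init (ch j)) (at_right 0)"
      unfolding coeff_scale_metric
      by (rule uniform_limit_rescale[OF converges_coeff[OF lim ch[OF j] K(1) K'] r])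
  next
    show "0 < r * \<delta>" "r * \<delta> \<le> r * T" using r \<delta> by auto
    show "conf_flow A {0<..<r * \<delta>} ?e'" using conf_flow_scale[OF X flow' r] unfolding img by simp
    show "conf_flow A {0<..r * T} ?e" using conf_flow_scale[OF X flow r] unfolding img by simp
    show "B > 0" using r by (simp add: B_def add_pos_nonneg)
    fix j z t assume j: "j \<in> J" and z: "z \<in> cdom (ch j)"
    obtain p where p: "p \<in> fst (ch j)" "snd (ch j) p = z" using z by (rule mem_cdomE)
    have pX: "p \<in> topspace X" using p riemann_surface_chart(3)[OF X ch[OF j]] by blast
    {
      assume t: "t \<in> {0<..<r * \<delta>}"
      then have tr: "t / r \<in> {0<..<\<delta>}" using r by (auto simp: field_simps)
      let ?c = "coeff (g' (t / r)) (ch j) 1 1 z"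
      have ld: "log_diffusion (cdom (ch j)) {0<..<\<delta>} (\<lambda>z t. coeff (g' t) (ch j) 1 1 z)"
        using flow' ch[OF j] unfolding conf_flow_def by blast
      have c: "?c > 0" using log_diffusionD(2)[OF ld z tr] .
      have "lap (\<lambda>w. ln (?e' (ch j) w t)) z = lap (\<lambda>w. ln (coeff (g' (t / r)) (ch j) 1 1 w)) z"
        using log_diffusion_scale(2)[OF open_cdom[OF j] ld r z tr] .
      also have "\<dots> = - 2 * gauss_curvature (g' (t / r)) (ch j) p * ?c"
        unfolding p(2)[symmetric] by (rule ricci_flow_conformal(2)[OF X g' limpt' iso' tr ch[OF j] p(1)])
      also have "\<dots> \<le> (1 + 2 * \<bar>b\<bar>) * ?c"
      proof (rule mult_right_mono)
        have "b \<le> gauss_curvature (g' (t / r)) (ch j) p"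
          using b[OF tr] ch[OF j] p(1) pX unfolding curvature_bounded_below_def by blast
        then show "- 2 * gauss_curvature (g' (t / r)) (ch j) p \<le> 1 + 2 * \<bar>b\<bar>" by linarith
      qed (use c in simp)
      also have "\<dots> = B * ?e' (ch j) z t" using r by (simp add: B_def)
      finally show "lap (\<lambda>w. ln (?e' (ch j) w t)) z \<le> B * ?e' (ch j) z t" .
    }
    show "(\<lambda>k. coeff (G k t) (ch j) 1 1 z) \<longlonglongrightarrow> ?e (ch j) z t" if "t \<in> {0<..r * T}"
      using Glim[OF that ch[OF j] p(1), of 1 1] coeff_chart[OF X ch[OF j] p(1)] p(2) by (simp add: scale_metric_def)
    fix k :: nat assume k: "k \<ge> 1"
    have G0: "coeff (G k 0) (ch j) 1 1 z = h k (ch j) p 1 1" if "k \<ge> 1" for k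
      using G(2)[OF that, unfolded metric_eq_def] ch[OF j] p pX coeff_chart[OF X ch[OF j] p(1)] by (metis IntI)
    show "coeff (G 1 0) (ch j) 1 1 z \<le> coeff (G k 0) (ch j) 1 1 z"
      unfolding G0[OF k] G0[OF order_refl]
      by (rule metric_le_chain[where h = h and N = "topspace X" and A = A, OF cusp_truncationD(3)[OF h] k ch[OF j]]) (use p pX in auto)
  next
    fix k :: nat assume k: "k \<ge> 1"
    show "conf_flow A {0..r * T} (\<lambda>c z t. coeff (G k t) c 1 1 z)"
      by (rule ricci_flow_conformal(1)[OF X G(1)[OF k] limptG isoG[OF k]])
    fix j z assume j: "j \<in> J" and z: "z \<in> cdom (ch j) - snd (ch j) ` (fst (ch j) \<inter> P)"
    obtain p where p: "p \<in> fst (ch j) \<inter> (topspace X - P)" "snd (ch j) p = z"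
      using z unfolding reg[OF j] by blast
    have "h k (ch j) p 1 1 \<le> scale_metric r g0 (ch j) p 1 1"
      using cusp_truncationD(4)[OF h k, unfolded metric_le_def] ch[OF j] p(1) by blast
    moreover have "G k 0 (ch j) p 1 1 = h k (ch j) p 1 1"
      using G(2)[OF k, unfolded metric_eq_def] ch[OF j] p(1) by blast
    ultimately show "coeff (G k 0) (ch j) 1 1 z \<le> ?init (ch j) z"
      using coeff_chart[OF X ch[OF j]] p by (metis IntD1)
  qed
  show ?thesis
    unfolding metric_eq_def
  proof (intro ballI allI)
    fix t c p v w assume t: "t \<in> {0<..<\<delta>}" and c: "c \<in> A" and p: "p \<in> fst c \<inter> topspace X"
    have tT: "t \<in> {0<..T}" using t assms(13) by auto
    have p': "p \<in> fst c" "p \<in> topspace X" using p by auto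
    obtain j where j: "j \<in> J" "p \<in> fst (ch j)" "snd (ch j) p \<in> sq (ctr j) (rad j / 2)"
      using cover[OF p'(2)] by blast
    have "r * t \<in> {0<..<r * \<delta>}" using t r by simp
    from flows_agree[OF this j(1,3)] have eq: "coeff (g' t) (ch j) 1 1 (snd (ch j) p) = coeff (g t) (ch j) 1 1 (snd (ch j) p)"
      using r by simp
    \<comment> \<open>Equality is known in the coordinate of the square containing \<open>p\<close>;
      the common transformation law carries it to \<open>c\<close>, and isothermality recovers the
      remaining components.\<close>
    have "conf_density A (\<lambda>c. coeff (g' t) c 1 1)" "conf_density A (\<lambda>c. coeff (g t) c 1 1)"
      using flow' flow t tT unfolding conf_flow_def by blast+
    note cd = this[unfolded conf_density_def, rule_format, OF c ch[OF j(1)], of p]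
    have "coeff (g' t) c 1 1 (snd c p) = coeff (g t) c 1 1 (snd c p)"
      using cd p'(1) j(2) eq by simp
    then have "g' t c p 1 1 = g t c p 1 1" using coeff_chart[OF X c p'(1)] by metis
    moreover have "g' t c p v w = g' t c p 1 1 * (v \<bullet> w)" "g t c p v w = g t c p 1 1 * (v \<bullet> w)"
      using iso'[OF t, unfolded isothermal_def, rule_format, OF c p] iso[OF tT, unfolded isothermal_def, rule_format, OF c p] .
    ultimately show "g' t c p v w = g t c p v w" by simp
  qed
qed

end
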